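(* Let $r\ge1$, $n\ge1$, let $\lambda\in\mathbb{Z}^{r+1}$ with $\lambda_1\ge\dots\ge\lambda_{r+1}\ge0$ and $\rho=(r,r-1,\dots,1,0)$. Then $$\Big(\sum_{u\in S_{r+1}}\mathcal{T}_u\Big)\big(\mathbf{x}^{w_0(\lambda)}\big)=\mathbf{x}^{-w_0(\rho)}\cdot\sum_{\mathfrak{T}}G^{(n,\lambda+\rho)}(\mathfrak{T})\,\mathbf{x}^{\mathrm{wt}(\mathfrak{T})},$$ the sum running over all Gelfand–Tsetlin patterns $\mathfrak{T}$ of rank $r$ with top row $\lambda+\rho$ (equivalently, over the vertices of the type $A_r$ highest weight crystal $\mathcal{C}_{\lambda+\rho}$).
   Context: Notation. $\mathbf{x}=(x_1,\dots,x_{r+1})$, $\mathbf{x}^\mu=\prod_i x_i^{\mu_i}$ for $\mu\in\mathbb{Z}^{r+1}$; $\alpha_i=e_i-e_{i+1}$, $\mathbf{x}^{n\alpha_i}=(x_i/x_{i+1})^n$. $W=S_{r+1}$ acts on $\mathbb{Z}^{r+1}$ by permuting coordinates, $\sigma_i=(i\ i+1)$, $w.f$ is the induced ordinary action on $\mathbb{C}(\mathbf{x})$; $w_0$ is the longest element, $w_0(\mu_1,\dots,\mu_{r+1})=(\mu_{r+1},\dots,\mu_1)$; $r_n(j)\in\{0,\dots,n-1\}$ is the residue of $j$ mod $n$. Parameters: $F$ a number field containing the $2n$-th roots of unity, $\mathfrak{o}_S$ a ring of $S$-integers which is a PID ($S$ containing archimedean and ramified places), $\psi$ an additive character of conductor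 $\mathfrak{o}_S$, $p$ a prime with residue field of size $q\equiv1\bmod 2n$, $(\cdot/p)_n$ the $n$-th power residue symbol. $v=q^{-1}$, $g_j=\sum_{b\in(\mathfrak{o}_S/p)^\times}(b/p)_n^{\,j}\psi(b/p)$ (depends on $j\bmod n$; $g_0=-1$; $g_jg_{n-j}=v^{-1}$ for $0<j<n$). $h^\flat(a)=1-v$ if $n\mid a$, $0$ otherwise; $g^\flat(a)=v\,g_a$. Chinta–Gunnells action: $\Lambda_0=\{\mu:\mu_i\equiv\mu_j\bmod n\}$; characters $\xi$ of $\mathbb{Z}^{r+1}/\Lambda_0$ act on $\mathbb{C}(\mathbf{x})$ by $\mathbf{x}^\mu\mapsto\xi(\mu)\mathbf{x}^\mu$, $\mathcal{K}_{\bar\mu}$ is the $\xi(\mu)$-eigenspace for all $\xi$, and $\mathbb{C}(\mathbf{x})=\bigoplus\mathcal{K}_{\bar\mu}$. For $f\in\mathcal{K}_{\bar\mu}$ with lift $\mu$: $\sigma_i(f)=\frac{\sigma_i.f}{1-v\mathbf{x}^{n\alpha_i}}\big[\mathbf{x}^{-r_n(\mu_{i+1}-\mu_i)\alpha_i}(1-v)-v\,g_{1+\mu_{i+1}-\mu_i}\mathbf{x}^{(1-n)\alpha_i}(1-\mathbf{x}^{n\alpha_i})\big]$, extended linearly. $\mathcal{D}_i(f)=\frac{f-\mathbf{x}^{n\alpha_i}\sigma_i(f)}{1-\mathbf{x}^{n\alpha_i}}$, $\mathcal{T}_i=(1-v\mathbf{x}^{n\alpha_i})\mathcal{D}_i-1$,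 and $\mathcal{T}_u=\mathcal{T}_{i_1}\circ\cdots\circ\mathcal{T}_{i_l}$ for a reduced expression $u=\sigma_{i_1}\cdots\sigma_{i_l}$ (well defined). Gelfand–Tsetlin patterns of rank $s$ with top row non-increasing $\kappa\in\mathbb{Z}^{s+1}$: integer arrays $(a_{ij})_{0\le i\le j\le s}$, top row $\kappa$, $a_{i-1,j-1}\ge a_{ij}\ge a_{i-1,j}$. $\Gamma_{ij}=\sum_{k=j}^s(a_{ik}-a_{i-1,k})$. $d_i=\sum_{j\ge i}a_{ij}$, $\mathrm{wt}(\mathfrak{T})=(d_s,d_{s-1}-d_s,\dots,d_0-d_1)$. $G^{(n,\kappa)}(\mathfrak{T})=\prod_{1\le i\le j\le s}g_{ij}$ with $g_{ij}=1$ if $a_{ij}=a_{i-1,j}<a_{i-1,j-1}$; $h^\flat(\Gamma_{ij})$ if $a_{i-1,j}<a_{ij}<a_{i-1,j-1}$; $g^\flat(\Gamma_{ij})$ if $a_{i-1,j}<a_{ij}=a_{i-1,j-1}$; $0$ if $a_{i-1,j}=a_{ij}=a_{i-1,j-1}$. *)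

theory Defs
  imports
    Complex_Main
    "HOL-Library.Poly_Mapping"
    "HOL-Library.FuncSet"
    "HOL-Computational_Algebra.Fraction_Field"
    "HOL-Computational_Algebra.Polynomial"
    "HOL-Combinatorics.Permutations"
    "HOL-Number_Theory.Cong"
    "HOL-Algebra.Ring_Divisibility"
    "HOL-Algebra.Ideal_Product"
    "HOL-Algebra.QuotRing"
begin

section \<open>Arithmetic data and Gauss sums\<close>

text \<open>
  The number field \<open>F\<close> is a type \<open>'f\<close> of characteristic 0, finite-dimensional over the rationals.
  Subrings of it are turned into HOL-Algebra rings, so that the library notions of
  ideal, principal ideal domain, prime element and quotient ring apply.
\<close>

definition subring_of :: "'f::field_char_0 set \<Rightarrow> 'f ring" where
  "subring_of A = \<lparr>carrier = A, monoid.mult = (*), one = 1, ring.zero = 0, add = (+)\<rparr>"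

definition finite_dim_over_rat :: "'f::field_char_0 itself \<Rightarrow> bool" where
  "finite_dim_over_rat _ \<longleftrightarrow>
     (\<exists>B :: 'f set. finite B \<and> module.span (\<lambda>(c::rat) x. of_rat c * x) B = UNIV)"

definition integers_of_field :: "'f::field_char_0 set" where
  "integers_of_field = {x. algebraic_int x}"

definition finite_places :: "'f::field_char_0 set set" where
  "finite_places = {P. primeideal P (subring_of integers_of_field) \<and> P \<noteq> {0}}"

text \<open>A place is ramified over the rationals iff the rational prime \<open>l\<close> below it lies in \<open>P\<^sup>2\<close>.\<close>

definition ramified_place :: "'f::field_char_0 set \<Rightarrow> bool" where
  "ramified_place P \<longleftrightarrow>
     (\<exists>l::nat. Factorial_Ring.prime l \<and>
        (of_nat l :: 'f) \<in> ideal_prod (subring_of integers_of_field) P P)"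

text \<open>
  A set \<open>S\<close> of places containing all archimedean ones is recorded by its non-archimedean members:
  the archimedean places impose no condition on \<open>S\<close>-integers. An element is integral
  at \<open>P\<close> iff it is a fraction of integers whose denominator avoids \<open>P\<close>.
\<close>

definition S_integers :: "'f::field_char_0 set set \<Rightarrow> 'f set" where
  "S_integers S =
     {x. \<forall>P \<in> finite_places - S. \<exists>a \<in> integers_of_field. \<exists>b \<in> integers_of_field - P. x = a / b}"

definition residue_ring_at :: "'f::field_char_0 set set \<Rightarrow> 'f \<Rightarrow> 'f set ring" where
  "residue_ring_at S p =
     subring_of (S_integers S) Quot (cgenideal (subring_of (S_integers S)) p)"

definition residue_card :: "'f::field_char_0 set set \<Rightarrow> 'f \<Rightarrow> nat" where
  "residue_card S p = card (carrier (residue_ring_at S p))"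

text \<open>
  For \<open>b\<close> prime to \<open>p\<close>, \<open>(b/p)\<^sub>n\<close> is the \<open>n\<close>-th root of unity in \<open>F\<close> congruent to
  \<open>b ^ ((q - 1) / n)\<close> modulo \<open>p\<close>.
\<close>

definition power_residue :: "nat \<Rightarrow> 'f::field_char_0 set set \<Rightarrow> 'f \<Rightarrow> 'f \<Rightarrow> 'f" where
  "power_residue n S p b =
     (THE z. z ^ n = 1 \<and>
        z - b ^ ((residue_card S p - 1) div n) \<in> cgenideal (subring_of (S_integers S)) p)"

text \<open>
  The conductor condition: \<open>o\<^sub>S\<close> consists exactly of those \<open>x\<close> for which \<open>\<psi>\<close> is trivial on \<open>x o\<^sub>S\<close>.
  The map \<open>\<epsilon>\<close> identifies the \<open>n\<close>-th roots of unity of \<open>F\<close> with complex ones, so that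
  the power residue symbol takes complex values.
\<close>

locale metaplectic_data =
  fixes n :: nat
    and S :: "'f::field_char_0 set set"
    and \<psi> :: "'f \<Rightarrow> complex"
    and \<epsilon> :: "'f \<Rightarrow> complex"
    and p :: 'f
  assumes n_pos: "n \<ge> 1"
    and number_field: "finite_dim_over_rat TYPE('f)"
    and roots_of_unity: "card {z::'f. z ^ (2 * n) = 1} = 2 * n"
    and S_places: "finite S" "S \<subseteq> finite_places"
    and S_ramified: "{P \<in> finite_places. ramified_place P} \<subseteq> S"
    and S_pid: "principal_domain (subring_of (S_integers S))"
    and psi_add: "\<psi> (x + y) = \<psi> x * \<psi> y"
    and psi_norm: "norm (\<psi> x) = 1"
    and psi_conductor: "{x. \<forall>a \<in> S_integers S. \<psi> (x * a) = 1} = S_integers S"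
    and eps_one: "\<epsilon> 1 = 1"
    and eps_mult: "\<lbrakk>x ^ n = 1; y ^ n = 1\<rbrakk> \<Longrightarrow> \<epsilon> (x * y) = \<epsilon> x * \<epsilon> y"
    and eps_inj: "inj_on \<epsilon> {z. z ^ n = 1}"
    and p_carrier: "p \<in> S_integers S"
    and p_prime: "ring_prime\<^bsub>subring_of (S_integers S)\<^esub> p"
    and q_cong: "[residue_card S p = 1] (mod (2 * n))"

text \<open>
  The summand depends only on the residue class \<open>B\<close> of \<open>b\<close>, so any representative may be chosen.
\<close>

definition gauss_sum ::
  "nat \<Rightarrow> 'f::field_char_0 set set \<Rightarrow> ('f \<Rightarrow> complex) \<Rightarrow> ('f \<Rightarrow> complex) \<Rightarrow> 'f \<Rightarrow> int \<Rightarrow> complex" where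
  "gauss_sum n S \<psi> \<epsilon> p j =
     (\<Sum>B \<in> Units (residue_ring_at S p).
        let b = (SOME b. b \<in> B) in \<epsilon> (power_residue n S p b) powi j * \<psi> (b / p))"


section \<open>Rational functions\<close>

text \<open>
  Polynomials are written in variables \<open>x\<^sub>i\<close> indexed by all naturals; the field
  of rational functions in \<open>x\<^sub>1, \<dots>, x\<^bsub>r+1\<^esub>\<close> is the subset \<open>ratfun_field r\<close>.
\<close>

type_synonym cpoly = "(nat \<Rightarrow>\<^sub>0 nat) \<Rightarrow>\<^sub>0 complex"
type_synonym ratfun = "cpoly fract"

definition poly_vars :: "cpoly \<Rightarrow> nat set" where
  "poly_vars a = (\<Union>m \<in> Poly_Mapping.keys a. Poly_Mapping.keys m)"

definition ratfun_field :: "nat \<Rightarrow> ratfun set" where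
  "ratfun_field r =
     {Fraction_Field.Fract a b | a b. b \<noteq> 0 \<and> poly_vars a \<subseteq> {1..r+1} \<and> poly_vars b \<subseteq> {1..r+1}}"

definition rconst :: "complex \<Rightarrow> ratfun" where
  "rconst c = Fraction_Field.Fract (Poly_Mapping.single 0 c) 1"

definition rvar :: "nat \<Rightarrow> ratfun" where
  "rvar i = Fraction_Field.Fract (Poly_Mapping.single (Poly_Mapping.single i 1) 1) 1"

definition rmonom :: "nat \<Rightarrow> (nat \<Rightarrow> int) \<Rightarrow> ratfun" where
  "rmonom r \<mu> = (\<Prod>i = 1..r+1. rvar i powi \<mu> i)"

text \<open>\<open>root_monom i k\<close> is \<open>\<^bold>x\<close> to the power \<open>k \<alpha>\<^sub>i\<close>.\<close>

definition root_monom :: "nat \<Rightarrow> int \<Rightarrow> ratfun" where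
  "root_monom i k = (rvar i / rvar (i + 1)) powi k"

definition poly_subst :: "(nat \<Rightarrow> ratfun) \<Rightarrow> cpoly \<Rightarrow> ratfun" where
  "poly_subst s a =
     (\<Sum>m \<in> Poly_Mapping.keys a. rconst (Poly_Mapping.lookup a m) *
        (\<Prod>i \<in> Poly_Mapping.keys m. s i ^ Poly_Mapping.lookup m i))"

text \<open>
  Substitution of \<open>s i\<close> for \<open>x\<^sub>i\<close>; the value does not depend on the fraction chosen,
  provided its denominator does not vanish under the substitution.
\<close>

definition ratfun_subst :: "(nat \<Rightarrow> ratfun) \<Rightarrow> ratfun \<Rightarrow> ratfun" where
  "ratfun_subst s f =
     (THE h. \<exists>a b. f = Fraction_Field.Fract a b \<and> poly_subst s b \<noteq> 0 \<and> h = poly_subst s a / poly_subst s b)"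

definition perm_act :: "(nat \<Rightarrow> nat) \<Rightarrow> ratfun \<Rightarrow> ratfun" where
  "perm_act w = ratfun_subst (\<lambda>i. rvar (w i))"


section \<open>The Chinta--Gunnells action\<close>

definition weight_lattice :: "nat \<Rightarrow> (nat \<Rightarrow> int) set" where
  "weight_lattice r = {\<mu>. \<forall>i. i \<notin> {1..r+1} \<longrightarrow> \<mu> i = 0}"

definition lattice0 :: "nat \<Rightarrow> nat \<Rightarrow> (nat \<Rightarrow> int) set" where
  "lattice0 n r =
     {\<mu> \<in> weight_lattice r. \<forall>i \<in> {1..r+1}. \<forall>j \<in> {1..r+1}. [\<mu> i = \<mu> j] (mod int n)}"

text \<open>
  Characters of the quotient of the weight lattice by \<open>lattice0\<close>, as characters of the weight
  lattice trivial on \<open>lattice0\<close>. Values off the weight lattice are irrelevant.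
\<close>

definition quotient_chars :: "nat \<Rightarrow> nat \<Rightarrow> ((nat \<Rightarrow> int) \<Rightarrow> complex) set" where
  "quotient_chars n r =
     {\<xi>. (\<forall>\<mu> \<in> weight_lattice r. \<forall>\<nu> \<in> weight_lattice r. \<xi> (\<lambda>i. \<mu> i + \<nu> i) = \<xi> \<mu> * \<xi> \<nu>) \<and>
         (\<forall>\<mu> \<in> lattice0 n r. \<xi> \<mu> = 1)}"

definition unit_weight :: "nat \<Rightarrow> nat \<Rightarrow> int" where
  "unit_weight i = (\<lambda>j. if j = i then 1 else 0)"

definition char_act :: "nat \<Rightarrow> ((nat \<Rightarrow> int) \<Rightarrow> complex) \<Rightarrow> ratfun \<Rightarrow> ratfun" where
  "char_act r \<xi> =
     ratfun_subst (\<lambda>i. if i \<in> {1..r+1} then rconst (\<xi> (unit_weight i)) * rvar i else rvar i)"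

definition eigenspace_K :: "nat \<Rightarrow> nat \<Rightarrow> (nat \<Rightarrow> int) \<Rightarrow> ratfun set" where
  "eigenspace_K n r \<mu> =
     {f \<in> ratfun_field r. \<forall>\<xi> \<in> quotient_chars n r. char_act r \<xi> f = rconst (\<xi> \<mu>) * f}"

definition cg_formula ::
  "nat \<Rightarrow> complex \<Rightarrow> (int \<Rightarrow> complex) \<Rightarrow> nat \<Rightarrow> (nat \<Rightarrow> int) \<Rightarrow> ratfun \<Rightarrow> ratfun" where
  "cg_formula n v g i \<mu> f =
     perm_act (Transposition.transpose i (i + 1)) f / (1 - rconst v * root_monom i (int n)) *
     (root_monom i (- ((\<mu> (i + 1) - \<mu> i) mod int n)) * (1 - rconst v)
      - rconst v * rconst (g (1 + \<mu> (i + 1) - \<mu> i)) * root_monom i (1 - int n)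
          * (1 - root_monom i (int n)))"

text \<open>
  The action of \<open>\<sigma>\<^sub>i\<close> is the linear map on the field of rational functions, which is the direct sum of
  the eigenspaces, that restricts to \<open>cg_formula\<close> on each of them.
\<close>

definition cg_act ::
  "nat \<Rightarrow> nat \<Rightarrow> complex \<Rightarrow> (int \<Rightarrow> complex) \<Rightarrow> nat \<Rightarrow> ratfun \<Rightarrow> ratfun" where
  "cg_act n r v g i =
     (THE \<phi>. \<phi> \<in> extensional (ratfun_field r) \<and>
        (\<forall>f \<in> ratfun_field r. \<forall>h \<in> ratfun_field r. \<phi> (f + h) = \<phi> f + \<phi> h) \<and>
        (\<forall>c. \<forall>f \<in> ratfun_field r. \<phi> (rconst c * f) = rconst c * \<phi> f) \<and>
        (\<forall>\<mu> \<in> weight_lattice r. \<forall>f \<in> eigenspace_K n r \<mu>. \<phi> f = cg_formula n v g i \<mu> f))"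

definition demazure ::
  "nat \<Rightarrow> nat \<Rightarrow> complex \<Rightarrow> (int \<Rightarrow> complex) \<Rightarrow> nat \<Rightarrow> ratfun \<Rightarrow> ratfun" where
  "demazure n r v g i f =
     (f - root_monom i (int n) * cg_act n r v g i f) / (1 - root_monom i (int n))"

definition demazure_lusztig ::
  "nat \<Rightarrow> nat \<Rightarrow> complex \<Rightarrow> (int \<Rightarrow> complex) \<Rightarrow> nat \<Rightarrow> ratfun \<Rightarrow> ratfun" where
  "demazure_lusztig n r v g i f =
     (1 - rconst v * root_monom i (int n)) * demazure n r v g i f - f"

definition word_perm :: "nat list \<Rightarrow> nat \<Rightarrow> nat" where
  "word_perm ws = foldr (\<lambda>i w. Transposition.transpose i (i + 1) \<circ> w) ws id"

definition reduced_word :: "nat \<Rightarrow> (nat \<Rightarrow> nat) \<Rightarrow> nat list \<Rightarrow> bool" where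
  "reduced_word r u ws \<longleftrightarrow> set ws \<subseteq> {1..r} \<and> word_perm ws = u \<and>
     (\<forall>ws'. set ws' \<subseteq> {1..r} \<and> word_perm ws' = u \<longrightarrow> length ws \<le> length ws')"

definition demazure_lusztig_perm ::
  "nat \<Rightarrow> nat \<Rightarrow> complex \<Rightarrow> (int \<Rightarrow> complex) \<Rightarrow> (nat \<Rightarrow> nat) \<Rightarrow> ratfun \<Rightarrow> ratfun" where
  "demazure_lusztig_perm n r v g u =
     foldr (\<lambda>i F. demazure_lusztig n r v g i \<circ> F) (SOME ws. reduced_word r u ws) id"

definition w0_act :: "nat \<Rightarrow> (nat \<Rightarrow> int) \<Rightarrow> nat \<Rightarrow> int" where
  "w0_act r \<mu> = (\<lambda>i. \<mu> (r + 2 - i))"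

definition rho :: "nat \<Rightarrow> nat \<Rightarrow> int" where
  "rho r = (\<lambda>i. int r + 1 - int i)"


section \<open>Gelfand--Tsetlin patterns\<close>

text \<open>
  Arrays are extended by 0 outside the triangle \<open>0 \<le> i \<le> j \<le> s\<close>, so that each pattern is
  represented once. Weights \<open>\<kappa>\<close> are indexed from 1, the columns of an array from 0.
\<close>

definition gt_patterns :: "nat \<Rightarrow> (nat \<Rightarrow> int) \<Rightarrow> (nat \<Rightarrow> nat \<Rightarrow> int) set" where
  "gt_patterns s \<kappa> =
     {a. (\<forall>i j. \<not> (i \<le> j \<and> j \<le> s) \<longrightarrow> a i j = 0) \<and>
         (\<forall>j \<le> s. a 0 j = \<kappa> (j + 1)) \<and>
         (\<forall>i j. 1 \<le> i \<and> i \<le> j \<and> j \<le> s \<longrightarrow> a (i - 1) (j - 1) \<ge> a i j \<and> a i j \<ge> a (i - 1) j)}"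

definition gt_Gamma :: "nat \<Rightarrow> (nat \<Rightarrow> nat \<Rightarrow> int) \<Rightarrow> nat \<Rightarrow> nat \<Rightarrow> int" where
  "gt_Gamma s a i j = (\<Sum>k = j..s. a i k - a (i - 1) k)"

definition gt_rowsum :: "nat \<Rightarrow> (nat \<Rightarrow> nat \<Rightarrow> int) \<Rightarrow> nat \<Rightarrow> int" where
  "gt_rowsum s a i = (\<Sum>j = i..s. a i j)"

text \<open>The row sum of index \<open>s + 1\<close> is empty, which gives the first entry \<open>d\<^sub>s\<close> of the weight.\<close>

definition gt_weight :: "nat \<Rightarrow> (nat \<Rightarrow> nat \<Rightarrow> int) \<Rightarrow> nat \<Rightarrow> int" where
  "gt_weight s a = (\<lambda>k. gt_rowsum s a (s + 1 - k) - gt_rowsum s a (s + 2 - k))"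

definition h_flat :: "nat \<Rightarrow> complex \<Rightarrow> int \<Rightarrow> complex" where
  "h_flat n v a = (if int n dvd a then 1 - v else 0)"

definition g_flat :: "complex \<Rightarrow> (int \<Rightarrow> complex) \<Rightarrow> int \<Rightarrow> complex" where
  "g_flat v g a = v * g a"

definition gt_factor ::
  "nat \<Rightarrow> complex \<Rightarrow> (int \<Rightarrow> complex) \<Rightarrow> nat \<Rightarrow> (nat \<Rightarrow> nat \<Rightarrow> int) \<Rightarrow> nat \<Rightarrow> nat \<Rightarrow> complex" where
  "gt_factor n v g s a i j =
     (if a i j = a (i - 1) j \<and> a i j < a (i - 1) (j - 1) then 1
      else if a (i - 1) j < a i j \<and> a i j < a (i - 1) (j - 1) then h_flat n v (gt_Gamma s a i j)
      else if a (i - 1) j < a i j \<and> a i j = a (i - 1) (j - 1) then g_flat v g (gt_Gamma s a i j)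
      else 0)"

definition gt_coeff ::
  "nat \<Rightarrow> complex \<Rightarrow> (int \<Rightarrow> complex) \<Rightarrow> nat \<Rightarrow> (nat \<Rightarrow> nat \<Rightarrow> int) \<Rightarrow> complex" where
  "gt_coeff n v g s a = (\<Prod>j = 1..s. \<Prod>i = 1..j. gt_factor n v g s a i j)"

end

theory Submission
  imports Defs "HOL-Library.Function_Algebras" "HOL-Algebra.Multiplicative_Group"
begin

text \<open>Conjugation by \<open>x\<close> to the power \<open>w\<^sub>0(\<rho>)\<close> turns the Demazure--Lusztig operators into operators
\<open>T\<^sub>i\<close> on Laurent polynomials for which \<open>T\<^sub>i x\<^sup>\<nu>\<close>, with \<open>d = \<nu>\<^sub>i\<^sub>+\<^sub>1 - \<nu>\<^sub>i > 0\<close>, is the sum of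
\<open>c\<^sub>f x\<^sup>\<nu>\<^sup>+\<^sup>f\<^sup>\<alpha>\<close> over \<open>0 < f \<le> d\<close>, where \<open>c\<^sub>f\<close> is \<open>h\<^sup>\<flat>(f)\<close> for \<open>f < d\<close> and \<open>g\<^sup>\<flat>(d)\<close> for \<open>f = d\<close>:
these are the weights of a Gelfand--Tsetlin pattern of rank one.
The quadratic and braid relations hold on monomials with exponents in \<open>{0..<n}\<close> by inspection, and they
propagate to all monomials because the defects of the relations intertwine multiplication by the
\<open>x\<^sub>j\<^sup>n\<close> (Bernstein relations). Hence the sum over \<open>S\<^sub>r\<^sub>+\<^sub>1\<close> factors as the symmetrizer of \<open>S\<^sub>r\<close> applied to
\<open>1 + T\<^sub>r + T\<^sub>rT\<^sub>r\<^sub>-\<^sub>1 + \<dots> + T\<^sub>r\<cdots>T\<^sub>1\<close>, and the theorem follows by induction on the rank once the latter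
operator produces the second row of the pattern. It does not do so term by term: the difference is a
combination of vectors \<open>(T\<^sub>i - v) x\<^sup>\<tau>\<close> and of monomials with \<open>\<tau>\<^sub>i = \<tau>\<^sub>i\<^sub>+\<^sub>1\<close>, with \<open>i < r\<close>, and both
are killed by the symmetrizer.\<close>

section \<open>The ring of Laurent polynomials and the Demazure--Lusztig operators\<close>

text \<open>The operators and the patterns disagree for this reason. In T_r ... T_1 a step may move
  any f from 1 to the current gap, whatever e the previous step moved, whereas along a pattern row f
  >= e, and f = e has weight 1. The surplus at f <= e does not cancel for fixed e. Fixing f and
  summing over the earlier move e instead leaves an expression in a single operator; it can be
  recognised because \<open>h_flat n v f\<close> vanishes unless n divides f, and a shift by a
  multiple of n changes neither \<open>h_flat\<close> nor the Gauss sum. Second rows of strict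
  patterns may have equal entries, so the induction runs over weakly decreasing top rows; at a tie
  both sides vanish. Two definitions are descriptions that must be earned: \<sigma>_i is the unique
  linear map with prescribed values on the eigenspaces, and T_u is read off a chosen reduced word.
  The first is settled by averaging over n-th roots of unity, the second by Matsumoto's theorem,
  proved on Laurent polynomials, where no denominators occur.\<close>

lemma poly_mapping_single_induct [case_names single add]:
  fixes p :: "'a \<Rightarrow>\<^sub>0 'b::comm_monoid_add"
  assumes "\<And>a b. P (Poly_Mapping.single a b)" and "\<And>p q. P p \<Longrightarrow> P q \<Longrightarrow> P (p + q)"
  shows "P p"
proof (induction p rule: Poly_Mapping.update_induct)
  show "P 0" using assms(1)[of undefined 0] by simp
next
  fix f :: "'a \<Rightarrow>\<^sub>0 'b" and a :: 'a and b :: 'b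
  assume 2: "a \<notin> Poly_Mapping.keys f" "b \<noteq> 0" "P f"
  have "Poly_Mapping.update a b f = f + Poly_Mapping.single a b"
    using 2(1) by (intro poly_mapping_eqI)
      (auto simp: lookup_update lookup_add lookup_single when_def not_in_keys_iff_lookup_eq_zero)
  then show "P (Poly_Mapping.update a b f)" using assms 2 by simp
qed

text \<open>Exponents are arbitrary functions on the naturals and carry no rank. Operators of every
  rank therefore act on one ring, and in the induction the variables beyond the current rank ride
  along as spectators.\<close>

type_synonym laurent = "(nat \<Rightarrow> int) \<Rightarrow>\<^sub>0 complex"

definition lconst :: "complex \<Rightarrow> laurent" where
  "lconst c = Poly_Mapping.single 0 c"

definition lmon :: "(nat \<Rightarrow> int) \<Rightarrow> laurent" where
  "lmon \<nu> = Poly_Mapping.single \<nu> 1"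

definition xpow :: "nat \<Rightarrow> int \<Rightarrow> nat \<Rightarrow> int" where
  "xpow i k = (\<lambda>j. if j = i then k else 0)"

definition apow :: "nat \<Rightarrow> int \<Rightarrow> nat \<Rightarrow> int" where
  "apow i k = (\<lambda>j. if j = i then k else if j = i + 1 then - k else 0)"

lemma lmon_mult: "lmon a * lmon b = lmon (a + b)"
  by (simp add: lmon_def mult_single)

lemma lmon_0 [simp]: "lmon 0 = 1"
  by (simp add: lmon_def)

lemma lmon_zero_fun [simp]: "lmon (\<lambda>_. 0) = 1"
  by (simp add: lmon_def zero_fun_def[symmetric])

lemma lconst_mult: "lconst (a * b) = lconst a * lconst b"
  by (simp add: lconst_def mult_single)

lemma lconst_lmon: "lconst c * lmon \<nu> = Poly_Mapping.single \<nu> c"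
  by (simp add: lconst_def lmon_def mult_single)

lemma lconst_1 [simp]: "lconst 1 = 1" and lconst_0 [simp]: "lconst 0 = 0"
  by (simp_all add: lconst_def)

lemma lconst_add: "lconst (a + b) = lconst a + lconst b"
  and lconst_diff: "lconst (a - b) = lconst a - lconst b"
  and lconst_uminus: "lconst (- a) = - lconst a"
  by (simp_all add: lconst_def single_add single_diff single_uminus)

lemma laurent_induct [case_names mon add]:
  assumes "\<And>c \<nu>. P (lconst c * lmon \<nu>)" and "\<And>p q. P p \<Longrightarrow> P q \<Longrightarrow> P (p + q)"
  shows "P p"
  by (induction p rule: poly_mapping_single_induct) (use assms in \<open>auto simp: lconst_lmon\<close>)

lemma xpow_add: "xpow i (a + b) = xpow i a + xpow i b"
  by (auto simp: xpow_def)

lemma apow_add: "apow i (a + b) = apow i a + apow i b"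
  by (auto simp: apow_def)

lemma apow_0 [simp]: "apow i 0 = 0" and xpow_0 [simp]: "xpow i 0 = 0"
  by (auto simp: apow_def xpow_def)

text \<open>
  The quotient \<open>(y - y\<^bsup>q+1\<^esup>) / (1 - y)\<close> for \<open>y = \<^bold>x\<^bsup>n\<alpha>\<^esup>\<close> and \<open>q\<close> of either sign; at most one of the
  two sums is nonempty.
\<close>

definition geom_sum :: "nat \<Rightarrow> nat \<Rightarrow> int \<Rightarrow> laurent" where
  "geom_sum n i q = (\<Sum>k\<in>{1..q}. lmon (apow i (k * int n))) - (\<Sum>k\<in>{q+1..0}. lmon (apow i (k * int n)))"

lemma geom_sum_0: "geom_sum n i 0 = 0" and geom_sum_m1: "geom_sum n i (-1) = -1"
  by (simp_all add: geom_sum_def lmon_0)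

lemma geom_sum_step: "geom_sum n i q = geom_sum n i (q - 1) + lmon (apow i (q * int n))"
proof (cases "q \<ge> 1")
  case True
  then have "{1..q} = insert q {1..q-1}" by auto
  then show ?thesis using True by (simp add: geom_sum_def)
next
  case False
  then have "{q..0} = insert q {q+1..0}" by auto
  then show ?thesis using False by (simp add: geom_sum_def)
qed

text \<open>Multiplying a geometric sum by its ratio shifts it, and the sign convention makes this
  hold across q = 0. It becomes the effect on \<open>dlop\<close> of moving an exponent by
  n.\<close>

lemma geom_sum_shift: "lmon (apow i (int n)) * (geom_sum n i (q - 1) + 1) = geom_sum n i q"
proof -
  have "(\<lambda>q. lmon (apow i (int n)) * (geom_sum n i (q - 1) + 1) = geom_sum n i q) q"
  proof (induction q rule: int_induct[where k = 0])
    case base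
    show ?case by (simp add: geom_sum_0 geom_sum_m1)
  next
    case (step1 q)
    have "lmon (apow i (int n)) * (geom_sum n i q + 1)
        = lmon (apow i (int n)) * (geom_sum n i (q-1) + 1) + lmon (apow i (int n)) * lmon (apow i (q * int n))"
      using geom_sum_step[of n i q] by (simp add: algebra_simps)
    also have "\<dots> = geom_sum n i (q+1)"
      using step1 geom_sum_step[of n i "q+1"] by (simp add: lmon_mult flip: apow_add) (simp add: algebra_simps)
    finally show ?case by simp
  next
    case (step2 q)
    have "lmon (apow i (int n)) * (geom_sum n i (q-2) + 1)
        = lmon (apow i (int n)) * (geom_sum n i (q-1) + 1) - lmon (apow i (int n)) * lmon (apow i ((q-1) * int n))"
      using geom_sum_step[of n i "q-1"] by (simp add: algebra_simps)
    also have "\<dots> = geom_sum n i (q-1)"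
      using step2 geom_sum_step[of n i q] by (simp add: lmon_mult flip: apow_add) (simp add: algebra_simps)
    finally show ?case by simp
  qed
  then show ?thesis .
qed

text \<open>Cleared of its denominator, so that it can be compared with the fraction in
  \<open>demazure\<close>.\<close>

lemma geom_sum_closed: "(1 - lmon (apow i (int n))) * geom_sum n i q = lmon (apow i (int n)) - lmon (apow i ((q + 1) * int n))"
  using geom_sum_shift[of i n "q+1"] geom_sum_step[of n i "q+1"] by (simp add: algebra_simps)

text \<open>The combinatorics uses the Gauss sums through three properties: periodicity, the value
  at 0 and the reflection formula, where by periodicity \<open>g (- a)\<close> stands for g_{n-a}.
  The number field returns only where these are verified for \<open>gauss_sum\<close>.\<close>

locale metaplectic_parameters =
  fixes n :: nat and v :: complex and g :: "int \<Rightarrow> complex"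
  assumes n_pos: "n \<ge> 1"
    and g_cong: "[a = b] (mod int n) \<Longrightarrow> g a = g b"
    and g_0: "g 0 = -1"
    and g_refl: "\<not> int n dvd a \<Longrightarrow> v * (g a * g (- a)) = 1"
begin

text \<open>
  \<open>dlop i\<close> is the Demazure--Lusztig operator on monomials, conjugated by \<open>\<^bold>x\<close> to the power \<open>w\<^sub>0(\<rho>)\<close>:
  the conjugation turns the index \<open>1 + \<mu>\<^bsub>i+1\<^esub> - \<mu>\<^sub>i\<close> of the Gauss sum into \<open>d = \<nu>\<^bsub>i+1\<^esub> - \<nu>\<^sub>i\<close>, and
  the division by \<open>1 - \<^bold>x\<^bsup>n\<alpha>\<^esup>\<close> is carried out in \<open>geom_sum\<close>.
\<close>

definition dlop_factor :: "nat \<Rightarrow> int \<Rightarrow> laurent" where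
  "dlop_factor i d = lconst (1 - v) * geom_sum n i ((d - 1) div int n) + lconst (v * g d) * lmon (apow i d)"

definition dlop_monom :: "nat \<Rightarrow> (nat \<Rightarrow> int) \<Rightarrow> laurent" where
  "dlop_monom i \<nu> = lmon \<nu> * dlop_factor i (\<nu> (i + 1) - \<nu> i)"

definition dlop :: "nat \<Rightarrow> laurent \<Rightarrow> laurent" where
  "dlop i p = (\<Sum>\<nu>\<in>Poly_Mapping.keys p. lconst (Poly_Mapping.lookup p \<nu>) * dlop_monom i \<nu>)"

lemma dlop_single: "dlop i (lconst c * lmon \<nu>) = lconst c * dlop_monom i \<nu>"
  by (cases "c = 0") (simp_all add: dlop_def lconst_lmon)

lemma dlop_lmon: "dlop i (lmon \<nu>) = dlop_monom i \<nu>"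
  using dlop_single[of i 1 \<nu>] by simp

lemma dlop_add: "dlop i (p + q) = dlop i p + dlop i q"
  unfolding dlop_def by (rule setsum_keys_plus_distrib) (simp_all add: lconst_add algebra_simps)

lemma dlop_0 [simp]: "dlop i 0 = 0"
  by (simp add: dlop_def)

lemma dlop_lconst: "dlop i (lconst c * p) = lconst c * dlop i p"
proof (induction p rule: laurent_induct)
  case (mon c' \<nu>)
  have "lconst c * (lconst c' * lmon \<nu>) = lconst (c * c') * lmon \<nu>"
    by (simp add: lconst_mult mult.assoc)
  then show ?case by (simp only: dlop_single) (simp add: lconst_mult mult.assoc)
next
  case (add p q)
  then show ?case by (simp add: dlop_add distrib_left)
qed

lemma dlop_uminus: "dlop i (- p) = - dlop i p"
  using dlop_add[of i p "-p"] by (simp add: add_eq_0_iff)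

lemma dlop_diff: "dlop i (p - q) = dlop i p - dlop i q"
  using dlop_add[of i p "-q"] by (simp add: dlop_uminus)

lemma dlop_sum: "dlop i (sum f A) = (\<Sum>a\<in>A. dlop i (f a))"
  by (induction A rule: infinite_finite_induct) (simp_all add: dlop_add)

text \<open>\<open>dlop_factor\<close> sees only \<nu>_{i+1} - \<nu>_i, which a monomial with
  \<beta>_i = \<beta>_{i+1} leaves unchanged. The condition is on each monomial: a polynomial such
  as x_i + x_{i+1}, symmetric only as a whole, need not pass through when n > 1.\<close>

lemma dlop_mult_symmetric:
  assumes "\<And>\<beta>. \<beta> \<in> Poly_Mapping.keys y \<Longrightarrow> \<beta> i = \<beta> (i + 1)"
  shows "dlop i (y * p) = y * dlop i p"
proof (induction p rule: laurent_induct)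
  case (mon c \<nu>)
  have y: "y = (\<Sum>\<beta>\<in>Poly_Mapping.keys y. lconst (Poly_Mapping.lookup y \<beta>) * lmon \<beta>)"
    by (rule poly_mapping_eqI) (simp add: lconst_lmon lookup_sum lookup_single when_def in_keys_iff)
  have "dlop i (y * (lconst c * lmon \<nu>)) =
      (\<Sum>\<beta>\<in>Poly_Mapping.keys y. dlop i (lconst (Poly_Mapping.lookup y \<beta>) * lmon \<beta> * (lconst c * lmon \<nu>)))"
    by (subst y) (simp add: sum_distrib_right dlop_sum)
  also have "\<dots> = (\<Sum>\<beta>\<in>Poly_Mapping.keys y. lconst (Poly_Mapping.lookup y \<beta>) * lmon \<beta> * (lconst c * dlop_monom i \<nu>))"
  proof (rule sum.cong[OF refl])
    fix \<beta> assume "\<beta> \<in> Poly_Mapping.keys y"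
    then have "dlop_monom i (\<beta> + \<nu>) = lmon \<beta> * dlop_monom i \<nu>"
      using assms[of \<beta>] by (simp add: dlop_monom_def mult.assoc flip: lmon_mult)
    moreover have "lconst (Poly_Mapping.lookup y \<beta>) * lmon \<beta> * (lconst c * lmon \<nu>)
        = lconst (Poly_Mapping.lookup y \<beta> * c) * lmon (\<beta> + \<nu>)"
      by (simp add: lconst_mult flip: lmon_mult)
    moreover have "dlop i (lconst (Poly_Mapping.lookup y \<beta> * c) * lmon (\<beta> + \<nu>))
        = lconst (Poly_Mapping.lookup y \<beta> * c) * dlop_monom i (\<beta> + \<nu>)"
      by (rule dlop_single)
    ultimately show "dlop i (lconst (Poly_Mapping.lookup y \<beta>) * lmon \<beta> * (lconst c * lmon \<nu>))
       = lconst (Poly_Mapping.lookup y \<beta>) * lmon \<beta> * (lconst c * dlop_monom i \<nu>)"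
      by (simp only: lconst_mult ac_simps)
  qed
  also have "\<dots> = y * dlop i (lconst c * lmon \<nu>)"
    by (subst (2) y) (simp add: sum_distrib_right dlop_single)
  finally show ?case .
next
  case (add p q)
  then show ?case by (simp add: dlop_add distrib_left)
qed

lemma dlop_lmon_mult: "\<beta> i = \<beta> (i + 1) \<Longrightarrow> dlop i (lmon \<beta> * p) = lmon \<beta> * dlop i p"
  by (rule dlop_mult_symmetric) (simp add: lmon_def)

section \<open>Bernstein relations between T_i and multiplication by x_j^n\<close>

lemma dlop_factor_shift:
  "lmon (apow i (int n)) * (dlop_factor i (d - int n) + lconst (1 - v)) = dlop_factor i d"
proof -
  have "(d - int n - 1) div int n = (d - 1) div int n - 1"
    using n_pos div_mult_self1[of "int n" "d - int n - 1" 1] by simp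
  moreover have "g (d - int n) = g d"
    by (rule g_cong) (simp add: cong_def)
  moreover have "lmon (apow i (int n)) * lmon (apow i (d - int n)) = lmon (apow i d)"
    by (simp add: lmon_mult flip: apow_add)
  ultimately show ?thesis
    unfolding dlop_factor_def geom_sum_shift[of i n "(d - 1) div int n", symmetric]
    by (simp only: distrib_left distrib_right ac_simps mult_1_right mult_1_left)
qed

definition xn :: "nat \<Rightarrow> laurent" where "xn i = lmon (xpow i (int n))"

lemma xn_apow: "xn (i + 1) * lmon (apow i (int n)) = xn i"
proof -
  have "xpow (Suc i) (int n) + apow i (int n) = xpow i (int n)"
    by (rule ext) (simp add: xpow_def apow_def)
  then show ?thesis by (simp add: xn_def lmon_mult)
qed

text \<open>Multiplying by x_i^n lowers the gap d by n, and \<open>dlop_factor_shift\<close> tells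
  what that does to the factor. For n = 1 this is the Bernstein relation of the affine Hecke
  algebra.\<close>

lemma dlop_XX: "dlop i (xn i * p) = xn (i + 1) * dlop i p - lconst (1 - v) * (xn i * p)"
proof (induction p rule: laurent_induct)
  case (mon c \<nu>)
  define d where "d = \<nu> (i + 1) - \<nu> i"
  have "dlop i (xn i * (lconst c * lmon \<nu>)) = dlop i (lconst c * lmon (xpow i (int n) + \<nu>))"
    by (simp add: xn_def mult.left_commute flip: lmon_mult)
  also have "\<dots> = lconst c * (xn i * lmon \<nu>) * dlop_factor i (d - int n)"
    unfolding dlop_single dlop_monom_def
    by (simp add: xn_def d_def xpow_def algebra_simps flip: lmon_mult)
  also have "\<dots> = xn (i + 1) * (lconst c * lmon \<nu> * (lmon (apow i (int n)) * (dlop_factor i (d - int n) + lconst (1 - v))))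
       - lconst (1 - v) * (xn i * (lconst c * lmon \<nu>))"
    unfolding xn_apow[of i, symmetric] by (simp only: algebra_simps)
  also have "\<dots> = xn (i + 1) * dlop i (lconst c * lmon \<nu>) - lconst (1 - v) * (xn i * (lconst c * lmon \<nu>))"
    unfolding dlop_factor_shift dlop_single dlop_monom_def d_def by (simp add: mult.assoc)
  finally show ?case .
next
  case (add p q)
  then show ?case by (simp add: dlop_add algebra_simps)
qed

text \<open>No second calculation: x_i^n x_{i+1}^n commutes with T_i, so \<open>dlop_XX\<close> at
  \<open>xn (i + 1) * p\<close> determines the value once the invertible \<open>xn (i + 1)\<close>
  is cancelled.\<close>

lemma dlop_XX_Suc: "dlop i (xn (i + 1) * p) = xn i * dlop i p + lconst (1 - v) * (xn i * p)"
proof -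
  have "dlop i ((xn i * xn (i + 1)) * p) = (xn i * xn (i + 1)) * dlop i p"
    unfolding xn_def lmon_mult by (rule dlop_lmon_mult) (simp add: xpow_def)
  moreover have "dlop i (xn i * (xn (i + 1) * p)) = xn (i + 1) * dlop i (xn (i + 1) * p) - lconst (1 - v) * (xn i * (xn (i + 1) * p))"
    by (rule dlop_XX)
  ultimately have "xn (i + 1) * dlop i (xn (i + 1) * p) = xn (i + 1) * (xn i * dlop i p + lconst (1 - v) * (xn i * p))"
    by (simp add: algebra_simps)
  moreover have "lmon (xpow (i + 1) (- int n)) * xn (i + 1) = 1"
    by (simp add: xn_def lmon_mult flip: xpow_add)
  moreover have "a = b" if "x * a = x * b" "y * x = 1" for a b x y :: laurent
    using arg_cong[OF that(1), of "(*) y"] that(2) by (simp flip: mult.assoc)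
  ultimately show ?thesis by blast
qed

lemma dlop_XX_other: "j \<noteq> i \<Longrightarrow> j \<noteq> i + 1 \<Longrightarrow> dlop i (xn j * p) = xn j * dlop i p"
  unfolding xn_def by (rule dlop_lmon_mult) (auto simp: xpow_def)

text \<open>The factors produced by T_j are combinations of powers of x^{\<alpha>_j}, which involve
  neither x_i nor x_{i+1} unless i and j are equal or adjacent; hence they pass through T_i by
  \<open>dlop_mult_symmetric\<close>.\<close>

lemma dlop_commute: 
  assumes "i + 1 < j \<or> j + 1 < i"
  shows "dlop i (dlop j p) = dlop j (dlop i p)"
proof -
  have keys: "\<beta> k = 0" if "\<beta> \<in> Poly_Mapping.keys (dlop_factor i d)" "k \<noteq> i" "k \<noteq> i + 1" for i d \<beta> k
  proof -
    have cst: "Poly_Mapping.keys (lconst c * y) \<subseteq> Poly_Mapping.keys y" for c y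
      using keys_mult[of "lconst c" y] by (fastforce simp: lconst_def split: if_splits)
    have mon: "Poly_Mapping.keys (lmon (apow i k)) \<subseteq> range (apow i)" for k
      by (simp add: lmon_def)
    have sums: "Poly_Mapping.keys (\<Sum>k\<in>A. lmon (apow i (f k))) \<subseteq> range (apow i)" for A :: "int set" and f
      using keys_sum[of "\<lambda>k. lmon (apow i (f k))" A] mon by blast
    have "Poly_Mapping.keys (geom_sum n i q) \<subseteq> range (apow i)" for q
      unfolding geom_sum_def by (rule order_trans[OF keys_diff]) (intro Un_least sums)
    then have "Poly_Mapping.keys (dlop_factor i d) \<subseteq> range (apow i)"
      unfolding dlop_factor_def
      by (intro order_trans[OF Poly_Mapping.keys_add] Un_least order_trans[OF cst] mon)
    then show ?thesis using that by (auto simp: apow_def)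
  qed
  show ?thesis
  proof (induction p rule: laurent_induct)
    case (mon c \<nu>)
    have *: "dlop a (dlop_factor b d * (lconst c * lmon \<nu>)) = dlop_factor b d * (lconst c * dlop_monom a \<nu>)"
      if "a + 1 < b \<or> b + 1 < a" for a b d
      unfolding dlop_single[symmetric]
    proof (rule dlop_mult_symmetric)
      fix \<beta> assume "\<beta> \<in> Poly_Mapping.keys (dlop_factor b d)"
      then show "\<beta> a = \<beta> (a + 1)"
        using keys[of \<beta> b d a] keys[of \<beta> b d "a + 1"] that by auto
    qed
    show ?case
      using *[of i j "\<nu> (j+1) - \<nu> j"] *[of j i "\<nu> (i+1) - \<nu> i"] assms
      unfolding dlop_single unfolding dlop_monom_def by (auto simp: algebra_simps)
  next
    case (add p q)
    then show ?case by (simp add: dlop_add)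
  qed
qed


section \<open>The quadratic and braid relations\<close>

lemma xn_inverse: "lmon (xpow j (- int n)) * xn j = 1"
  by (simp add: xn_def lmon_mult flip: xpow_add)

text \<open>An equivalence in the hypothesis, rather than an implication, is what reaches negative
  powers.\<close>

lemma xn_pow_shift: 
  assumes "\<And>p. P (xn j * p) \<longleftrightarrow> P p"
  shows "P (lmon (xpow j (k * int n)) * p) \<longleftrightarrow> P p"
proof (induction k rule: int_induct[where k = 0])
  case base
  then show ?case by simp
next
  case (step1 k)
  have "lmon (xpow j ((k + 1) * int n)) * p = xn j * (lmon (xpow j (k * int n)) * p)"
    by (simp add: xn_def algebra_simps xpow_add flip: lmon_mult)
  then show ?case using step1 assms by simp
next
  case (step2 k)
  have "xn j * (lmon (xpow j ((k - 1) * int n)) * p) = lmon (xpow j (k * int n)) * p"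
    by (simp add: xn_def lmon_mult flip: mult.assoc xpow_add) (simp add: algebra_simps)
  then show ?case using step2 assms by metis
qed

text \<open>For exponents in the box, (d - 1) div n is 0 or -1, so the geometric sum collapses to 0
  or -1 and T_i preserves the span of a monomial and its transpose. On such spans the relations are
  identities between small matrices.\<close>

lemma dlop_box:
  assumes "0 \<le> \<nu> i" "\<nu> i < int n" "0 \<le> \<nu> (i + 1)" "\<nu> (i + 1) < int n"
  shows "dlop i (lmon \<nu>) = (if \<nu> (i + 1) \<le> \<nu> i then - lconst (1 - v) * lmon \<nu> else 0)
     + lconst (v * g (\<nu> (i + 1) - \<nu> i)) * lmon (\<nu>(i := \<nu> (i + 1), i + 1 := \<nu> i))"
proof -
  define d where "d = \<nu> (i + 1) - \<nu> i"
  have "(d - 1) div int n = -1" if "d \<le> 0"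
  proof -
    have "(d - 1 + int n) div int n = 0"
      using that assms by (intro div_pos_pos_trivial) (auto simp: d_def)
    then show ?thesis using n_pos div_add_self2[of "int n" "d - 1"] by simp
  qed
  moreover have "(d - 1) div int n = 0" if "d > 0"
    using that assms by (intro div_pos_pos_trivial) (auto simp: d_def)
  ultimately have "(d - 1) div int n = (if \<nu> (i + 1) \<le> \<nu> i then -1 else 0)"
    by (auto simp: d_def)
  moreover have "\<nu> + apow i d = \<nu>(i := \<nu> (i + 1), i + 1 := \<nu> i)"
    by (rule ext) (simp add: apow_def d_def)
  ultimately show ?thesis
    unfolding dlop_lmon dlop_monom_def dlop_factor_def d_def[symmetric]
    by (simp add: geom_sum_0 geom_sum_m1 distrib_left mult.left_commute[of "lmon \<nu>"] lmon_mult)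
qed

lemma xn_cancel: "xn j * p = 0 \<longleftrightarrow> p = 0"
proof
  assume "xn j * p = 0"
  then have "lmon (xpow j (- int n)) * xn j * p = 0" by (simp only: mult.assoc mult_zero_right)
  then show "p = 0" by (simp add: xn_inverse)
qed simp

text \<open>This is (T_i + 1)(T_i - v) p.\<close>

definition hecke_defect :: "nat \<Rightarrow> laurent \<Rightarrow> laurent" where
  "hecke_defect i p = dlop i (dlop i p) + lconst (1 - v) * dlop i p - lconst v * p"

lemma hecke_defect_XX: "hecke_defect i (xn i * p) = xn i * hecke_defect i p"
  unfolding hecke_defect_def
  by (simp only: dlop_XX dlop_XX_Suc dlop_diff dlop_add dlop_lconst) (simp add: algebra_simps lconst_diff)

lemma hecke_defect_XX_Suc: "hecke_defect i (xn (i + 1) * p) = xn (i + 1) * hecke_defect i p"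
  unfolding hecke_defect_def
  by (simp only: dlop_XX dlop_XX_Suc dlop_diff dlop_add dlop_lconst) (simp add: algebra_simps lconst_diff)

definition braid_defect :: "nat \<Rightarrow> laurent \<Rightarrow> laurent" where
  "braid_defect i p = dlop i (dlop (i + 1) (dlop i p)) - dlop (i + 1) (dlop i (dlop (i + 1) p))"


text \<open>
  The relations are checked on exponents in \<open>{0..<n}\<close>; since their defects intertwine multiplication by
  the invertible elements \<open>xn j\<close>, they extend to all monomials.
\<close>

lemma dlop_quadratic: "dlop i (dlop i p) = lconst v * p - lconst (1 - v) * dlop i p"
proof -
  have box: "hecke_defect i (lmon \<nu>) = 0" if "0 \<le> \<nu> i" "\<nu> i < int n" "0 \<le> \<nu> (i + 1)" "\<nu> (i + 1) < int n" for \<nu>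
  proof -
    define \<nu>' where "\<nu>' = \<nu>(i := \<nu> (i + 1), i + 1 := \<nu> i)"
    define d where "d = \<nu> (i + 1) - \<nu> i"
    have \<nu>'': "\<nu>'(i := \<nu>' (i + 1), i + 1 := \<nu>' i) = \<nu>" by (auto simp: \<nu>'_def)
    have \<nu>'d: "\<nu>' (i + 1) - \<nu>' i = - d" "\<nu>' (i + 1) \<le> \<nu>' i \<longleftrightarrow> d \<ge> 0" by (simp_all add: \<nu>'_def d_def)
    have 1: "dlop i (lmon \<nu>) = (if d \<le> 0 then - lconst (1 - v) * lmon \<nu> else 0) + lconst (v * g d) * lmon \<nu>'"
      using dlop_box[OF that] by (simp add: \<nu>'_def d_def)
    have 2: "dlop i (lmon \<nu>') = (if d \<ge> 0 then - lconst (1 - v) * lmon \<nu>' else 0) + lconst (v * g (- d)) * lmon \<nu>"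
      using dlop_box[of \<nu>' i] that unfolding \<nu>'d \<nu>'' by (simp add: \<nu>'_def)
    show ?thesis
    proof (cases "d = 0")
      case True
      then have "\<nu>' = \<nu>" by (auto simp: \<nu>'_def d_def)
      then have "dlop i (lmon \<nu>) = - lmon \<nu>" using 1 True by (simp add: g_0 lconst_diff lconst_uminus algebra_simps)
      then show ?thesis by (simp add: hecke_defect_def dlop_uminus lconst_diff algebra_simps)
    next
      case False
      \<comment> \<open>Within the box a nonzero d is never a multiple of n, so the reflection
        formula applies; d = 0 was settled by g_0 = -1.\<close>
      have "\<bar>d\<bar> < int n" using that by (auto simp: d_def)
      then have "\<not> int n dvd d" using False zdvd_imp_le[of "int n" "\<bar>d\<bar>"] by auto
      then have "lconst (v * g d) * lconst (v * g (- d)) = lconst v"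
        using g_refl[of d] by (simp flip: lconst_mult) (metis mult.assoc mult.left_commute mult.right_neutral)
      then have gg: "lconst (v * g d) * (lconst (v * g (- d)) * p) = lconst v * p" for p
        by (simp flip: mult.assoc)
      then have gg': "lconst (v * g (- d)) * (lconst (v * g d) * p) = lconst v * p" for p
        by (simp only: mult.left_commute)
      show ?thesis using False
        by (cases "d > 0") (simp_all add: hecke_defect_def 1 2 dlop_add dlop_diff dlop_lconst dlop_uminus gg gg'
              right_diff_distrib distrib_left, (simp_all add: mult.left_commute)?)
    qed
  qed
  have "hecke_defect i (lmon \<nu>) = 0" for \<nu>
  proof -
    define \<mu> where "\<mu> = \<nu>(i := \<nu> i mod int n, i + 1 := \<nu> (i + 1) mod int n)"
    have "\<nu> = xpow i (\<nu> i div int n * int n) + (xpow (i + 1) (\<nu> (i + 1) div int n * int n) + \<mu>)"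
      by (rule ext) (simp add: \<mu>_def xpow_def)
    then have \<nu>: "lmon \<nu> = lmon (xpow i (\<nu> i div int n * int n)) * (lmon (xpow (i + 1) (\<nu> (i + 1) div int n * int n)) * lmon \<mu>)"
      by (simp only: lmon_mult)
    have "hecke_defect i (lmon \<mu>) = 0" by (rule box) (use n_pos in \<open>auto simp: \<mu>_def\<close>)
    moreover have "hecke_defect i (xn j * p) = 0 \<longleftrightarrow> hecke_defect i p = 0" if "j = i \<or> j = i + 1" for j p
      using that hecke_defect_XX[of i p] hecke_defect_XX_Suc[of i p] xn_cancel by auto
    ultimately show ?thesis
      unfolding \<nu> using xn_pow_shift[of "\<lambda>p. hecke_defect i p = 0" i] xn_pow_shift[of "\<lambda>p. hecke_defect i p = 0" "i + 1"]
      by simp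
  qed
  then have "hecke_defect i p = 0"
    by (induction p rule: laurent_induct)
      (auto simp: hecke_defect_def dlop_lconst dlop_add mult.left_commute[of "lconst v"] mult.left_commute[of "lconst (1 - v)"]
        simp flip: distrib_left right_diff_distrib, simp add: algebra_simps)
  then show ?thesis by (simp add: hecke_defect_def algebra_simps)
qed

context
  fixes i j k :: nat
  assumes j: "j = i + 1" and k: "k = i + 2"
begin

lemma braid_rules:
  "dlop i (xn i * p) = xn j * dlop i p - lconst (1 - v) * (xn i * p)"
  "dlop i (xn j * p) = xn i * dlop i p + lconst (1 - v) * (xn i * p)"
  "dlop i (xn k * p) = xn k * dlop i p"
  "dlop j (xn j * p) = xn k * dlop j p - lconst (1 - v) * (xn j * p)"
  "dlop j (xn k * p) = xn j * dlop j p + lconst (1 - v) * (xn j * p)"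
  "dlop j (xn i * p) = xn i * dlop j p"
  using dlop_XX[of i p] dlop_XX_Suc[of i p] dlop_XX[of j p] dlop_XX_Suc[of j p] dlop_XX_other[of k i p] dlop_XX_other[of i j p]
  by (simp_all add: j k)

text \<open>Either side of the braid relation reverses the three variables, so x_i^n emerges as
  x_{i+2}^n. The leftover corrections cancel because T^2 + (1 - v) T is the same scalar v for both
  operators; hence the quadratic relation comes first.\<close>

lemma braid_defect_XX_1: "braid_defect i (xn i * p) = xn k * braid_defect i p"
  unfolding braid_defect_def j[symmetric]
  by (simp only: braid_rules dlop_diff dlop_add dlop_lconst dlop_quadratic) (simp add: algebra_simps lconst_diff)

lemma braid_defect_XX_2: "braid_defect i (xn j * p) = xn j * braid_defect i p"
  unfolding braid_defect_def j[symmetric]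
  by (simp only: braid_rules dlop_diff dlop_add dlop_lconst) (simp add: algebra_simps)

lemma braid_defect_XX_3: "braid_defect i (xn k * p) = xn i * braid_defect i p"
  unfolding braid_defect_def j[symmetric]
  by (simp only: braid_rules dlop_diff dlop_add dlop_lconst dlop_quadratic) (simp add: algebra_simps lconst_diff)

end

lemma dlop_braid: "dlop i (dlop (i + 1) (dlop i p)) = dlop (i + 1) (dlop i (dlop (i + 1) p))"
proof -
  have box: "braid_defect i (lmon \<nu>) = 0"
    if "0 \<le> \<nu> i" "\<nu> i < int n" "0 \<le> \<nu> (i + 1)" "\<nu> (i + 1) < int n" "0 \<le> \<nu> (i + 2)" "\<nu> (i + 2) < int n" for \<nu>
  proof -
    define w where "w a b c = lmon (\<nu>(i := a, i + 1 := b, i + 2 := c))" for a b c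
    define R where "R a b = (if b \<le> a then - lconst (1 - v) else 0)" for a b :: int
    define G where "G a b = lconst (v * g (b - a))" for a b
    have T1: "dlop i (w a b c) = R a b * w a b c + G a b * w b a c" 
      if "0 \<le> a" "a < int n" "0 \<le> b" "b < int n" for a b c
      unfolding w_def using that by (subst dlop_box) (auto simp: R_def G_def fun_upd_twist)
    have T2: "dlop (i + 1) (w a b c) = R b c * w a b c + G b c * w a c b"
      if "0 \<le> b" "b < int n" "0 \<le> c" "c < int n" for a b c
      unfolding w_def using that by (subst dlop_box) (auto simp: R_def G_def fun_upd_twist)
    have lin: "dlop i (R a b * p) = R a b * dlop i p" "dlop i (G a b * p) = G a b * dlop i p" for i a b p
      using dlop_lconst[of i "- (1 - v)"] by (auto simp: R_def G_def dlop_lconst lconst_uminus dlop_uminus)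
    have GG: "G a b * (G b a * p) = lconst v * p" 
      if "0 \<le> a" "a < int n" "0 \<le> b" "b < int n" "a \<noteq> b" for a b p
    proof -
      have "\<bar>b - a\<bar> < int n" using that by auto
      then have "\<not> int n dvd (b - a)" using that zdvd_imp_le[of "int n" "\<bar>b - a\<bar>"] by auto
      then have "v * (v * (g (b - a) * g (a - b))) = v"
        using g_refl[of "b - a"] by simp
      then have "(v * g (b - a)) * (v * g (a - b)) = v"
        by (simp only: ac_simps)
      then have "lconst (v * g (b - a)) * lconst (v * g (a - b)) = lconst v"
        by (simp only: lconst_mult[symmetric])
      then show ?thesis by (simp only: G_def mult.assoc[symmetric])
    qed
    have G0: "G a a = - lconst v" for a by (simp add: G_def g_0 lconst_uminus)
    define a b c where abc: "a = \<nu> i" "b = \<nu> (i + 1)" "c = \<nu> (i + 2)"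
    have bnd: "0 \<le> a" "a < int n" "0 \<le> b" "b < int n" "0 \<le> c" "c < int n" using that by (auto simp: abc)
    have "dlop i (dlop (i + 1) (dlop i (w a b c))) - dlop (i + 1) (dlop i (dlop (i + 1) (w a b c))) = 0"
      apply (simp only: T1 T2 bnd lin dlop_add)
      \<comment> \<open>\<open>R\<close> depends only on the order of its arguments and opposite
        factors \<open>G\<close> multiply to v, so the comparisons of the three exponents leave
        finitely many ring identities.\<close>
      apply (cases a b rule: linorder_cases; cases b c rule: linorder_cases; cases a c rule: linorder_cases)
      apply (simp_all add: R_def G0 algebra_simps GG bnd lconst_diff)
      done
    moreover have "w a b c = lmon \<nu>" by (simp add: w_def abc)
    ultimately show ?thesis by (simp add: braid_defect_def)
  qed
  have "braid_defect i (lmon \<nu>) = 0" for \<nu>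
  proof -
    define \<mu> where "\<mu> = \<nu>(i := \<nu> i mod int n, i + 1 := \<nu> (i + 1) mod int n, i + 2 := \<nu> (i + 2) mod int n)"
    have "\<nu> = xpow i (\<nu> i div int n * int n) + (xpow (i + 1) (\<nu> (i + 1) div int n * int n)
        + (xpow (i + 2) (\<nu> (i + 2) div int n * int n) + \<mu>))"
      by (rule ext) (simp add: \<mu>_def xpow_def)
    then have \<nu>: "lmon \<nu> = lmon (xpow i (\<nu> i div int n * int n)) * (lmon (xpow (i + 1) (\<nu> (i + 1) div int n * int n))
        * (lmon (xpow (i + 2) (\<nu> (i + 2) div int n * int n)) * lmon \<mu>))"
      by (simp only: lmon_mult)
    have "braid_defect i (lmon \<mu>) = 0" by (rule box) (use n_pos in \<open>auto simp: \<mu>_def\<close>)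
    moreover have "braid_defect i (xn j * p) = 0 \<longleftrightarrow> braid_defect i p = 0" if "j = i \<or> j = i + 1 \<or> j = i + 2" for j p
      using that xn_cancel braid_defect_XX_1[OF refl refl, of i p] braid_defect_XX_2[OF refl refl, of i p] braid_defect_XX_3[OF refl refl, of i p]
      by auto
    ultimately show ?thesis
      unfolding \<nu> using xn_pow_shift[of "\<lambda>p. braid_defect i p = 0" i] xn_pow_shift[of "\<lambda>p. braid_defect i p = 0" "i + 1"]
        xn_pow_shift[of "\<lambda>p. braid_defect i p = 0" "i + 2"]
      by simp
  qed
  then have "braid_defect i p = 0"
    by (induction p rule: laurent_induct)
      (auto simp: braid_defect_def dlop_lconst dlop_add simp flip: right_diff_distrib)
  then show ?thesis by (simp add: braid_defect_def)
qed

end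

section \<open>Reduced words in the symmetric group\<close>

definition adj :: "nat \<Rightarrow> nat \<Rightarrow> nat" where
  "adj i = Transposition.transpose i (i + 1)"

lemma adj_apply: "adj i x = (if x = i then i + 1 else if x = i + 1 then i else x)"
  by (simp add: adj_def Transposition.transpose_def)

lemma adj_self [simp]: "adj i i = Suc i" "adj i (Suc i) = i"
  by (simp_all add: adj_apply)

lemma word_perm_Nil [simp]: "word_perm [] = id"
  by (simp add: word_perm_def)

lemma adj_adj [simp]: "adj i (adj i x) = x"
  by (simp add: adj_def)

definition inversions :: "(nat \<Rightarrow> nat) \<Rightarrow> (nat \<times> nat) set" where
  "inversions u = {(a, b). a < b \<and> u b < u a}"

lemma inversions_id [simp]: "inversions id = {}" "inversions (\<lambda>x. x) = {}"
  by (auto simp: inversions_def)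

lemma inversions_finite:
  assumes "u permutes {1..m}"
  shows "finite (inversions u)"
proof (rule finite_subset)
  show "inversions u \<subseteq> {1..m} \<times> {1..m}"
  proof
    fix x assume "x \<in> inversions u"
    then obtain a b where x: "x = (a, b)" and ab: "a < b" "u b < u a" by (auto simp: inversions_def)
    have fix_out: "u x = x" if "x \<notin> {1..m}" for x using assms that by (simp add: permutes_not_in)
    have "u x \<in> {1..m}" if "x \<in> {1..m}" for x using permutes_in_image[OF assms] that by blast
    then show "x \<in> {1..m} \<times> {1..m}"
      using ab fix_out[of a] fix_out[of b] unfolding x by (cases "a \<in> {1..m}"; cases "b \<in> {1..m}") force+
  qed
qed simp

lemma adj_less: "a < b \<Longrightarrow> (a, b) \<noteq> (i, i + 1) \<Longrightarrow> adj i a < adj i b"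
  by (auto simp: adj_apply)

text \<open>Swapping the positions i and i + 1 preserves the order of every other pair, so it
  carries the inversions of u bijectively to those of \<open>u \<circ> adj i\<close> other than (i,
  i + 1).\<close>

lemma card_inversions_adj:
  assumes u: "u permutes {1..m}" and asc: "u i < u (i + 1)"
  shows "card (inversions (u \<circ> adj i)) = Suc (card (inversions u))"
proof -
  let ?\<phi> = "\<lambda>(a, b). (adj i a, adj i b)"
  have "inversions (u \<circ> adj i) = insert (i, i + 1) (?\<phi> ` inversions u)"
  proof (intro equalityI subsetI)
    fix x assume x: "x \<in> inversions (u \<circ> adj i)"
    show "x \<in> insert (i, i + 1) (?\<phi> ` inversions u)"
    proof (cases "x = (i, i + 1)")
      case False
      obtain a b where ab: "x = (a, b)" by force
      then have "(adj i a, adj i b) \<in> inversions u"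
        using x False adj_less[of a b i] by (auto simp: inversions_def)
      then show ?thesis unfolding ab by (intro insertI2 image_eqI[where x = "(adj i a, adj i b)"]) auto
    qed simp
  next
    fix x assume x: "x \<in> insert (i, i + 1) (?\<phi> ` inversions u)"
    show "x \<in> inversions (u \<circ> adj i)"
    proof (cases "x = (i, i + 1)")
      case True
      then show ?thesis using asc by (auto simp: inversions_def)
    next
      case False
      then obtain a b where ab: "(a, b) \<in> inversions u" "x = (adj i a, adj i b)" using x by auto
      then have "(a, b) \<noteq> (i, i + 1)" using asc by (auto simp: inversions_def)
      then show ?thesis using ab adj_less[of a b i] by (auto simp: inversions_def)
    qed
  qed
  moreover have "(i, i + 1) \<notin> ?\<phi> ` inversions u"
  proof
    assume "(i, i + 1) \<in> ?\<phi> ` inversions u"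
    then obtain a b where "a < b" "adj i a = i" "adj i b = i + 1" by (auto simp: inversions_def)
    then show False by (auto simp: adj_apply split: if_splits)
  qed
  moreover have "inj_on ?\<phi> (inversions u)" 
    by (rule inj_onI) (auto, (metis adj_adj)+)
  ultimately show ?thesis using inversions_finite[OF u] by (simp add: card_image)
qed

lemma adj_permutes: "i \<in> {1..r} \<Longrightarrow> adj i permutes {1..r+1}"
  unfolding adj_def by (intro permutes_swap_id) auto

lemma comp_adj_permutes: "u permutes {1..r+1} \<Longrightarrow> i \<in> {1..r} \<Longrightarrow> u \<circ> adj i permutes {1..r+1}"
  by (intro permutes_compose adj_permutes)

lemma comp_adj_adj [simp]: "u \<circ> adj i \<circ> adj i = u"
  by (simp add: fun_eq_iff)

lemma card_inversions_adj_desc: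
  assumes u: "u permutes {1..r+1}" and i: "i \<in> {1..r}" and "u (i + 1) < u i"
  shows "card (inversions u) = Suc (card (inversions (u \<circ> adj i)))"
  using card_inversions_adj[OF comp_adj_permutes[OF u i], of i] assms(3) by simp

lemma asc_or_desc:
  fixes u :: "nat \<Rightarrow> nat"
  assumes "u permutes {1..r+1}"
  shows "u i < u (i + 1) \<or> u (i + 1) < u (i :: nat)"
proof -
  have "u i \<noteq> u (i + 1)" using injD[OF permutes_inj[OF assms], of i "i + 1"] by auto
  then show ?thesis by linarith
qed

lemma word_perm_append: "word_perm (xs @ ys) = word_perm xs \<circ> word_perm ys"
  by (induction xs) (simp_all add: word_perm_def comp_assoc)

lemma word_perm_snoc: "word_perm (xs @ [i]) = word_perm xs \<circ> adj i"
  by (simp add: word_perm_append) (simp add: word_perm_def adj_def)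

lemma word_perm_permutes: "set ws \<subseteq> {1..r} \<Longrightarrow> word_perm ws permutes {1..r+1}"
proof (induction ws rule: rev_induct)
  case Nil
  show ?case by (simp only: word_perm_Nil permutes_id)
next
  case (snoc i ws)
  then show ?case by (simp only: word_perm_snoc) (intro comp_adj_permutes, auto)
qed

lemma card_inversions_word: "set ws \<subseteq> {1..r} \<Longrightarrow> card (inversions (word_perm ws)) \<le> length ws"
proof (induction ws rule: rev_induct)
  case Nil
  then show ?case by simp
next
  case (snoc i ws)
  then have p: "word_perm ws permutes {1..r+1}" and i: "i \<in> {1..r}" using word_perm_permutes[of ws r] by auto
  have "card (inversions (word_perm ws)) \<le> length ws" using snoc by auto
  then have "card (inversions (word_perm ws \<circ> adj i)) \<le> Suc (length ws)"
    using asc_or_desc[OF p, of i] card_inversions_adj[OF p, of i] card_inversions_adj_desc[OF p i] by linarith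
  then show ?case by (simp only: word_perm_snoc length_append list.size) 
qed

text \<open>Climbing from 1 gives u i >= i, and coming down from r + 1 gives u i <= i.\<close>

lemma permutes_no_descent:
  fixes u :: "nat \<Rightarrow> nat"
  assumes u: "u permutes {1..r+1}" and "\<And>i. i \<in> {1..r} \<Longrightarrow> u i < u (i + 1)"
  shows "u = id"
proof
  fix x
  have im: "u x \<in> {1..r+1}" if "x \<in> {1..r+1}" for x using permutes_in_image[OF u] that by blast
  have "i \<in> {1..r+1} \<Longrightarrow> u i \<ge> i" for i :: nat
  proof (induction i)
    case (Suc i)
    then show ?case using assms(2)[of i] im[of "Suc i"] by (cases "i = 0") force+
  qed simp
  moreover have "d \<le> r \<Longrightarrow> u (r + 1 - d) \<le> r + 1 - d" for d :: nat
  proof (induction d)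
    case 0
    then show ?case using im[of "r+1"] by simp
  next
    case (Suc d)
    then have "r - d \<in> {1..r}" by auto
    from assms(2)[OF this] show ?case using Suc by (auto simp: Suc_diff_le)
  qed
  from this[of "r + 1 - x"] have "x \<in> {1..r+1} \<Longrightarrow> u x \<le> x" by auto
  ultimately show "u x = id x" using u by (cases "x \<in> {1..r+1}") (force simp: permutes_not_in)+
qed

text \<open>Counting inversions allows reducedness to be tested one letter at a time, which
  minimality among all words does not. \<open>reduced_word_iff\<close> identifies the two: the count
  is a lower bound for the length of every word, and it is attained.\<close>

definition inv_reduced :: "nat \<Rightarrow> (nat \<Rightarrow> nat) \<Rightarrow> nat list \<Rightarrow> bool" where
  "inv_reduced r u ws \<longleftrightarrow> set ws \<subseteq> {1..r} \<and> word_perm ws = u \<and> length ws = card (inversions u)"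

lemma inv_reduced_snoc:
  assumes "inv_reduced r u ws" "i \<in> {1..r}" "u i < u (i + 1)"
  shows "inv_reduced r (u \<circ> adj i) (ws @ [i])"
  using assms card_inversions_adj[of u "r+1" i] word_perm_permutes[of ws r]
  by (auto simp: inv_reduced_def word_perm_snoc)

lemma inv_reduced_exists:
  assumes "u permutes {1..r+1}"
  shows "\<exists>ws. inv_reduced r u ws"
  using assms
proof (induction "card (inversions u)" arbitrary: u rule: less_induct)
  case less
  show ?case
  proof (cases "\<exists>i\<in>{1..r}. u (i + 1) < u i")
    case True
    then obtain i where i: "i \<in> {1..r}" "u (i + 1) < u i" by blast
    obtain ws where "inv_reduced r (u \<circ> adj i) ws"
      using less.hyps[of "u \<circ> adj i"] less.prems i card_inversions_adj_desc[of u r i] comp_adj_permutes by auto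
    from inv_reduced_snoc[OF this i(1)] i show ?thesis by auto
  next
    case False
    then have "u = id" using permutes_no_descent[OF less.prems] asc_or_desc[OF less.prems] by blast
    then have "inv_reduced r u []" by (simp add: inv_reduced_def word_perm_def)
    then show ?thesis by blast
  qed
qed

lemma reduced_word_iff:
  assumes "u permutes {1..r+1}"
  shows "reduced_word r u ws \<longleftrightarrow> inv_reduced r u ws"
proof -
  obtain ws0 where "inv_reduced r u ws0" using inv_reduced_exists[OF assms] by blast
  then show ?thesis unfolding reduced_word_def inv_reduced_def
    using card_inversions_word by (metis le_antisym)
qed

lemma inv_reduced_snocD:
  assumes "inv_reduced r u (ws @ [i])"
  shows "inv_reduced r (u \<circ> adj i) ws" "i \<in> {1..r}" "u (i + 1) < u i" "u permutes {1..r+1}"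
proof -
  have i: "i \<in> {1..r}" and ws: "set ws \<subseteq> {1..r}" and u: "u = word_perm ws \<circ> adj i"
    and l: "Suc (length ws) = card (inversions u)"
    using assms by (auto simp: inv_reduced_def word_perm_snoc)
  have p: "u permutes {1..r+1}" unfolding u by (intro comp_adj_permutes word_perm_permutes ws i)
  have w: "word_perm ws = u \<circ> adj i" unfolding u by simp
  show d: "u (i + 1) < u i"
    using asc_or_desc[OF p, of i] card_inversions_adj[OF p, of i] card_inversions_word[OF ws] l by (auto simp: w)
  show "inv_reduced r (u \<circ> adj i) ws" using w ws l card_inversions_adj_desc[OF p i d] by (auto simp: inv_reduced_def)
  show "i \<in> {1..r}" "u permutes {1..r+1}" by (fact i p)+
qed

section \<open>Matsumoto's theorem and the operators T_u\<close>

lemma adj_commute: "i + 1 < j \<Longrightarrow> u \<circ> adj i \<circ> adj j = u \<circ> adj j \<circ> adj i"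
  by (auto simp: fun_eq_iff adj_apply)

lemma adj_braid: "u \<circ> adj i \<circ> adj (i + 1) \<circ> adj i = u \<circ> adj (i + 1) \<circ> adj i \<circ> adj (i + 1)"
  by (auto simp: fun_eq_iff adj_apply)

context metaplectic_parameters
begin

definition word_op :: "nat list \<Rightarrow> laurent \<Rightarrow> laurent" where
  "word_op ws = foldr (\<lambda>i F. dlop i \<circ> F) ws id"

lemma word_op_append: "word_op (xs @ ys) p = word_op xs (word_op ys p)"
  by (induction xs) (simp_all add: word_op_def)

lemma word_op_Nil [simp]: "word_op [] p = p" and word_op_Cons: "word_op (i # ws) p = dlop i (word_op ws p)"
  by (simp_all add: word_op_def)

lemma word_op_add: "word_op ws (p + q) = word_op ws p + word_op ws q"
  by (induction ws) (simp_all add: word_op_Cons dlop_add)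

lemma word_op_diff: "word_op ws (p - q) = word_op ws p - word_op ws q"
  by (induction ws) (simp_all add: word_op_Cons dlop_diff)

lemma word_op_lconst: "word_op ws (lconst c * p) = lconst c * word_op ws p"
  by (induction ws) (simp_all add: word_op_Cons dlop_lconst)

lemma word_op_0 [simp]: "word_op ws 0 = 0"
  by (induction ws) (simp_all add: word_op_Cons)

lemma word_op_sum: "word_op ws (sum f A) = (\<Sum>a\<in>A. word_op ws (f a))"
  by (induction A rule: infinite_finite_induct) (simp_all add: word_op_add)

text \<open>Compare the last letters a and b. Both are descents of u, so if they differ, u has a
  reduced word ending in the longest element of the group generated by \<sigma>_a and \<sigma>_b. A
  commutation or braid relation in that tail links the two given words, and the prefixes agree by
  induction.\<close>

theorem matsumoto:
  assumes "inv_reduced r u ws" "inv_reduced r u ws'"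
  shows "word_op ws p = word_op ws' p"
  using assms
proof (induction "length ws" arbitrary: u ws ws' p rule: less_induct)
  case less
  show ?case
  proof (cases ws rule: rev_cases)
    case Nil
    then show ?thesis using less.prems by (simp add: inv_reduced_def)
  next
    case ws: (snoc xs a)
    then obtain ys b where ws': "ws' = ys @ [b]"
      using less.prems by (cases ws' rule: rev_cases) (auto simp: inv_reduced_def)
    have IH: "word_op xs q = word_op zs q" if "inv_reduced r (u \<circ> adj a) zs" for zs q
      using less.hyps[of xs "u \<circ> adj a" zs q] that inv_reduced_snocD[OF less.prems(1)[unfolded ws]] ws by auto
    have IH': "word_op ys q = word_op zs q" if "inv_reduced r (u \<circ> adj b) zs" for zs q
    proof -
      have "length ys < length ws" using less.prems ws' by (auto simp: inv_reduced_def)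
      then show ?thesis
        using less.hyps[of ys "u \<circ> adj b" zs q] that inv_reduced_snocD[OF less.prems(2)[unfolded ws']] by auto
    qed
    note a = inv_reduced_snocD[OF less.prems(1)[unfolded ws]]
    note b = inv_reduced_snocD[OF less.prems(2)[unfolded ws']]
    \<comment> \<open>Both induction hypotheses are premises here, so that the case a > b is the
      same fact with the roles exchanged.\<close>
    have main: "word_op (xs @ [a]) p = word_op (ys @ [b]) p"
      if "a < b" 
        and IH: "\<And>zs q. inv_reduced r (u \<circ> adj a) zs \<Longrightarrow> word_op xs q = word_op zs q"
        and IH': "\<And>zs q. inv_reduced r (u \<circ> adj b) zs \<Longrightarrow> word_op ys q = word_op zs q"
        and a: "a \<in> {1..r}" "u (a + 1) < u a"
        and b: "b \<in> {1..r}" "u (b + 1) < u b"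
      for a b xs ys
    proof (cases "b = a + 1")
      case False
      then have ab: "a + 1 < b" using \<open>a < b\<close> by auto
      have "u \<circ> adj a \<circ> adj b permutes {1..r+1}" using a b \<open>u permutes _\<close> by (intro comp_adj_permutes)
      then obtain zs where zs: "inv_reduced r (u \<circ> adj a \<circ> adj b) zs" using inv_reduced_exists by blast
      have "inv_reduced r (u \<circ> adj a \<circ> adj b \<circ> adj b) (zs @ [b])"
        by (rule inv_reduced_snoc[OF zs]) (use a b ab in \<open>auto simp: adj_apply\<close>)
      then have 1: "inv_reduced r (u \<circ> adj a) (zs @ [b])" by simp
      have "inv_reduced r (u \<circ> adj b \<circ> adj a \<circ> adj a) (zs @ [a])"
        by (rule inv_reduced_snoc[OF zs[unfolded adj_commute[OF ab]]]) (use a b ab in \<open>auto simp: adj_apply\<close>)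
      then have 2: "inv_reduced r (u \<circ> adj b) (zs @ [a])" by simp
      show ?thesis
        using dlop_commute[of a b] ab by (simp add: word_op_append word_op_Cons IH[OF 1] IH'[OF 2])
    next
      case True
      \<comment> \<open>The longest element of the type A_2 subgroup generated by \<sigma>_a and
        \<sigma>_{a+1}, divided out of u on the right.\<close>
      let ?y = "u \<circ> adj a \<circ> adj (a + 1) \<circ> adj a"
      have aa: "a + 1 \<in> {1..r}" using b True by simp
      have "?y permutes {1..r+1}" using a aa \<open>u permutes _\<close> by (intro comp_adj_permutes)
      then obtain zs where zs: "inv_reduced r ?y zs" using inv_reduced_exists by blast
      have d: "u (a + 1) < u a" "u (a + 2) < u (a + 1)" using a b True by auto
      have "inv_reduced r (?y \<circ> adj a) (zs @ [a])"
        by (rule inv_reduced_snoc[OF zs]) (use a d in \<open>auto simp: adj_apply\<close>)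
      then have "inv_reduced r (?y \<circ> adj a \<circ> adj (a + 1)) ((zs @ [a]) @ [a + 1])"
        by (rule inv_reduced_snoc) (use aa d in \<open>auto simp: adj_apply\<close>)
      then have 1: "inv_reduced r (u \<circ> adj a) (zs @ [a, a + 1])" by (simp del: One_nat_def add_Suc_right)
      have "inv_reduced r (?y \<circ> adj (a + 1)) (zs @ [a + 1])"
        by (rule inv_reduced_snoc[OF zs]) (use aa d in \<open>auto simp: adj_apply\<close>)
      then have "inv_reduced r (?y \<circ> adj (a + 1) \<circ> adj a) ((zs @ [a + 1]) @ [a])"
        by (rule inv_reduced_snoc) (use a d in \<open>auto simp: adj_apply\<close>)
      moreover have "?y \<circ> adj (a + 1) \<circ> adj a = u \<circ> adj (a + 1)"
        unfolding adj_braid by (simp del: One_nat_def add_Suc_right)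
      ultimately have 2: "inv_reduced r (u \<circ> adj b) (zs @ [a + 1, a])" by (simp add: True)
      show ?thesis
        using dlop_braid[of a p] by (simp add: word_op_append word_op_Cons IH[OF 1] IH'[OF 2] True)
    qed
    show ?thesis
    proof (cases a b rule: linorder_cases)
      case equal
      then show ?thesis using IH[of ys] b by (simp add: ws ws' word_op_append)
    next
      case less
      then show ?thesis using main[of a b xs ys, OF _ IH IH'] a b by (simp add: ws ws')
    next
      case greater
      then show ?thesis using main[of b a ys xs, OF _ IH' IH] a b by (simp add: ws ws')
    qed
  qed
qed

text \<open>The word is chosen exactly as in \<open>demazure_lusztig_perm\<close>, so that the two
  operators correspond letter by letter; \<open>perm_op_eq\<close> then allows any other reduced
  word.\<close>

definition perm_op :: "nat \<Rightarrow> (nat \<Rightarrow> nat) \<Rightarrow> laurent \<Rightarrow> laurent" where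
  "perm_op r u = word_op (SOME ws. reduced_word r u ws)"

lemma perm_op_eq:
  assumes "inv_reduced r u ws"
  shows "perm_op r u p = word_op ws p"
proof -
  have u: "u permutes {1..r+1}" using assms word_perm_permutes by (auto simp: inv_reduced_def)
  have "reduced_word r u ws" by (rule reduced_word_iff[OF u, THEN iffD2]) (rule assms)
  then have "inv_reduced r u (SOME ws. reduced_word r u ws)"
    by (intro reduced_word_iff[OF u, THEN iffD1] someI[of "reduced_word r u"])
  then show ?thesis unfolding perm_op_def by (rule matsumoto) (rule assms)
qed

lemma perm_op_adj:
  assumes u: "u permutes {1..r+1}" and "i \<in> {1..r}" "u i < u (i + 1)"
  shows "perm_op r (u \<circ> adj i) p = perm_op r u (dlop i p)"
proof -
  obtain ws where ws: "inv_reduced r u ws" using inv_reduced_exists[OF u] by blast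
  show ?thesis
    using perm_op_eq[OF ws] perm_op_eq[OF inv_reduced_snoc[OF ws assms(2,3)]] by (simp add: word_op_append word_op_Cons)
qed

section \<open>The symmetrizer and the vectors it annihilates\<close>

definition symm :: "nat \<Rightarrow> laurent \<Rightarrow> laurent" where
  "symm r p = (\<Sum>u | u permutes {1..r+1}. perm_op r u p)"

lemma symm_add: "symm r (p + q) = symm r p + symm r q"
  by (simp add: symm_def perm_op_def word_op_add sum.distrib)

lemma symm_diff: "symm r (p - q) = symm r p - symm r q"
  by (simp add: symm_def perm_op_def word_op_diff sum_subtractf)

lemma symm_lconst: "symm r (lconst c * p) = lconst c * symm r p"
  by (simp add: symm_def perm_op_def word_op_lconst sum_distrib_left)

lemma symm_0 [simp]: "symm r 0 = 0"
  by (simp add: symm_def perm_op_def)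

lemma symm_sum: "symm r (sum f A) = (\<Sum>a\<in>A. symm r (f a))"
  by (induction A rule: infinite_finite_induct) (simp_all add: symm_add)

text \<open>Pairing u with \<open>u \<circ> adj i\<close> writes the symmetrizer as a sum of T_u (1
  + T_i) over the u ascending at i. All annihilation statements come from this right factor.\<close>

lemma symm_split:
  assumes i: "i \<in> {1..r}"
  shows "symm r p = (\<Sum>u | u permutes {1..r+1} \<and> u i < u (i + 1). perm_op r u p + perm_op r u (dlop i p))"
proof -
  let ?A = "{u. u permutes {1..r+1} \<and> u i < u (i + 1)}"
  let ?D = "{u. u permutes {1..r+1} \<and> u (i + 1) < u i}"
  have fin: "finite {u. u permutes {1..r+1}}" by (rule finite_permutations) simp
  have eq: "{u. u permutes {1..r+1}} = ?A \<union> ?D" using asc_or_desc by blast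
  have finA: "finite ?A" and finD: "finite ?D" by (rule finite_subset[OF _ fin]; blast)+
  have disj: "?A \<inter> ?D = {}" by fastforce
  have "symm r p = (\<Sum>u\<in>?A. perm_op r u p) + (\<Sum>u\<in>?D. perm_op r u p)"
    unfolding symm_def eq by (rule sum.union_disjoint[OF finA finD disj])
  also have "(\<Sum>u\<in>?D. perm_op r u p) = (\<Sum>u\<in>?A. perm_op r (u \<circ> adj i) p)"
    by (rule sum.reindex_bij_witness[of _ "\<lambda>u. u \<circ> adj i" "\<lambda>u. u \<circ> adj i"])
      (use i in \<open>auto intro: comp_adj_permutes[simplified]\<close>)
  also have "\<dots> = (\<Sum>u\<in>?A. perm_op r u (dlop i p))"
    by (rule sum.cong[OF refl]) (use i in \<open>auto intro: perm_op_adj[simplified]\<close>)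
  finally show ?thesis by (simp add: sum.distrib)
qed

text \<open>By the quadratic relation (1 + T_i) T_i = v (1 + T_i). Hence every (T_i - v) p is
  killed.\<close>

lemma symm_TT:
  assumes i: "i \<in> {1..r}"
  shows "symm r (dlop i p) = lconst v * symm r p"
  unfolding symm_split[OF i] dlop_quadratic sum_distrib_left
  by (rule sum.cong[OF refl]) (simp only: perm_op_def word_op_diff word_op_lconst, simp add: lconst_diff algebra_simps)

section \<open>Minimal coset representatives and the factorization of the symmetrizer\<close>

definition coset_word :: "nat \<Rightarrow> nat \<Rightarrow> nat list" where
  "coset_word r k = rev [k..<Suc r]"

lemma coset_word_apply: "1 \<le> k \<Longrightarrow> k \<le> r + 1 \<Longrightarrow> word_perm (coset_word r k) k = r + 1"
proof (induction r)
  case 0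
  then show ?case by (cases "k = 1") (auto simp: coset_word_def word_perm_def)
next
  case (Suc r)
  show ?case
  proof (cases "k = Suc r + 1")
    case True
    then show ?thesis by (simp add: coset_word_def word_perm_def)
  next
    case False
    then have "coset_word (Suc r) k = Suc r # coset_word r k" using Suc.prems by (simp add: coset_word_def)
    then show ?thesis using Suc False by (simp add: word_perm_def adj_apply[unfolded adj_def])
  qed
qed

text \<open>Letters are appended from r down to k. Just before k is appended, position k + 1 holds
  the largest value r + 1, because the coset word carries k + 1 to r + 1 and u fixes it; so each new
  letter is an ascent.\<close>

lemma coset_word_reduced:
  assumes ws: "inv_reduced r u ws" and u: "u permutes {1..r}" and k: "1 \<le> k" "k \<le> r + 1"
  shows "inv_reduced r (u \<circ> word_perm (coset_word r k)) (ws @ coset_word r k)"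
  using k(2,1)
proof (induction k rule: inc_induct)
  case base
  then show ?case using ws by (simp add: coset_word_def word_perm_def)
next
  case (step k)
  have cs: "coset_word r k = coset_word r (Suc k) @ [k]"
    using step by (simp add: coset_word_def upt_rec[of k])
  let ?w = "u \<circ> word_perm (coset_word r (Suc k))"
  have red: "inv_reduced r ?w (ws @ coset_word r (Suc k))" using step.IH step.prems by linarith
  have p: "?w permutes {1..r+1}" 
    using red word_perm_permutes[of "ws @ coset_word r (Suc k)" r] unfolding inv_reduced_def by metis
  have "?w (k + 1) = r + 1"
    using coset_word_apply[of "Suc k" r] u step by (simp add: permutes_not_in)
  moreover have "?w k \<in> {1..r+1}" using permutes_in_image[OF p, of k] step by simp
  moreover have "?w k \<noteq> ?w (k + 1)" using injD[OF permutes_inj[OF p], of k "k + 1"] by auto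
  ultimately have "?w k < ?w (k + 1)" by auto
  moreover have "k \<in> {1..r}" using step by auto
  ultimately have "inv_reduced r (?w \<circ> adj k) ((ws @ coset_word r (Suc k)) @ [k])"
    by (intro inv_reduced_snoc[OF red])
  moreover have "u \<circ> word_perm (coset_word r k) = ?w \<circ> adj k"
    by (simp only: cs word_perm_snoc comp_assoc)
  ultimately show ?case by (simp only: cs append_assoc)
qed

text \<open>A permutation w factors uniquely as \<open>u \<circ> ?c k\<close>, where k is the
  position of the largest value of w and u fixes that value. The lengths add by
  \<open>coset_word_reduced\<close>, so the operators compose.\<close>

lemma symm_Suc: "symm (Suc r) p = symm r (\<Sum>k\<in>{1..Suc r + 1}. word_op (coset_word (Suc r) k) p)"
proof -
  let ?c = "\<lambda>k. word_perm (coset_word (Suc r) k)"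
  have c: "?c k permutes {1..Suc r + 1}" if "k \<ge> 1" for k
    by (rule word_perm_permutes) (use that in \<open>auto simp: coset_word_def\<close>)
  have term_eq: "perm_op (Suc r) (u \<circ> ?c k) p = perm_op r u (word_op (coset_word (Suc r) k) p)"
    if u: "u permutes {1..r+1}" and k: "k \<in> {1..Suc r + 1}" for u k
  proof -
    obtain ws where ws: "inv_reduced r u ws" using inv_reduced_exists[OF u] by blast
    then have ws': "inv_reduced (Suc r) u ws" by (auto simp: inv_reduced_def)
    have "inv_reduced (Suc r) (u \<circ> ?c k) (ws @ coset_word (Suc r) k)"
      by (rule coset_word_reduced) (use ws' u k in auto)
    then show ?thesis using perm_op_eq ws by (simp add: word_op_append)
  qed
  let ?j = "\<lambda>w. (w \<circ> inv_into UNIV (?c (inv_into UNIV w (Suc r + 1))), inv_into UNIV w (Suc r + 1))"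
  have "symm (Suc r) p = (\<Sum>(u, k)\<in>{u. u permutes {1..r+1}} \<times> {1..Suc r + 1}. perm_op (Suc r) (u \<circ> ?c k) p)"
    unfolding symm_def
  proof (rule sum.reindex_bij_witness[of _ "\<lambda>(u, k). u \<circ> ?c k" ?j])
    fix w assume "w \<in> {u. u permutes {1..Suc r + 1}}"
    then have w: "w permutes {1..Suc r + 1}" by simp
    define k where "k = inv_into UNIV w (Suc r + 1)"
    have k: "k \<in> {1..Suc r + 1}" unfolding k_def using permutes_in_image[OF permutes_inv[OF w], of "Suc r + 1"] by simp
    have wk: "w k = Suc r + 1" unfolding k_def by (simp add: permutes_inverses[OF w])
    have ck: "?c k permutes {1..Suc r + 1}" using c k by simp
    have ckk: "?c k k = Suc r + 1" using k by (intro coset_word_apply) auto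
    show "(case ?j w of (u, k) \<Rightarrow> u \<circ> ?c k) = w"
      unfolding k_def[symmetric] by (simp add: comp_assoc permutes_inv_o[OF ck])
    have 1: "w \<circ> inv_into UNIV (?c k) permutes {1..Suc r + 1}" by (intro permutes_compose permutes_inv ck w)
    have "inv_into UNIV (?c k) (Suc r + 1) = k" using ckk permutes_inverses(2)[OF ck] by metis
    then have "(w \<circ> inv_into UNIV (?c k)) (Suc r + 1) = Suc r + 1" using wk by simp
    moreover have "{1..Suc r + 1} = insert (Suc r + 1) {1..r + 1}" by auto
    ultimately have "w \<circ> inv_into UNIV (?c k) permutes {1..r + 1}"
      using 1 permutes_insert_lemma[of "w \<circ> inv_into UNIV (?c k)"] permutes_superset[OF 1, of "{1..r+1}"] by auto
    then show "?j w \<in> {u. u permutes {1..r+1}} \<times> {1..Suc r + 1}"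
      unfolding k_def[symmetric] using k by simp
    show "(case ?j w of (u, k) \<Rightarrow> perm_op (Suc r) (u \<circ> ?c k) p) = perm_op (Suc r) w p"
      unfolding k_def[symmetric] by (simp add: comp_assoc permutes_inv_o[OF ck])
  next
    fix x assume "x \<in> {u. u permutes {1..r+1}} \<times> {1..Suc r + 1}"
    then obtain u k where x: "x = (u, k)" "u permutes {1..r+1}" "k \<in> {1..Suc r + 1}" by auto
    have ck: "?c k permutes {1..Suc r + 1}" using c x by simp
    have ckk: "?c k k = Suc r + 1" using x by (intro coset_word_apply) auto
    have u': "u permutes {1..Suc r + 1}" by (rule permutes_subset[OF x(2)]) auto
    have p: "u \<circ> ?c k permutes {1..Suc r + 1}" by (intro permutes_compose ck u')
    have "(u \<circ> ?c k) k = Suc r + 1" using ckk x(2) by (simp add: permutes_not_in)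
    then have k: "inv_into UNIV (u \<circ> ?c k) (Suc r + 1) = k" using permutes_inverses(2)[OF p] by metis
    show "(case x of (u, k) \<Rightarrow> u \<circ> ?c k) \<in> {u. u permutes {1..Suc r + 1}}" using p x by simp
    show "?j (case x of (u, k) \<Rightarrow> u \<circ> ?c k) = x"
      unfolding x(1) prod.case k by (simp add: comp_assoc permutes_inv_o[OF ck])
  qed
  also have "\<dots> = (\<Sum>(u, k)\<in>{u. u permutes {1..r+1}} \<times> {1..Suc r + 1}. perm_op r u (word_op (coset_word (Suc r) k) p))"
    by (rule sum.cong[OF refl]) (use term_eq in auto)
  also have "\<dots> = symm r (\<Sum>k\<in>{1..Suc r + 1}. word_op (coset_word (Suc r) k) p)"
    by (simp add: symm_def perm_op_def word_op_sum sum.cartesian_product del: sum.cl_ivl_Suc)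
  finally show ?thesis .
qed

end

section \<open>Reduction to a single row\<close>

lemma sum_PiE_insert:
  assumes "x \<notin> S"
  shows "(\<Sum>b\<in>PiE (insert x S) T. F b) = (\<Sum>y\<in>T x. \<Sum>b\<in>PiE S T. F (b(x := y)))"
proof -
  have "(\<Sum>b\<in>PiE (insert x S) T. F b) = (\<Sum>(y, b)\<in>T x \<times> PiE S T. F (b(x := y)))"
    unfolding PiE_insert_eq
    by (subst sum.reindex[OF inj_combinator[OF assms]]) (simp add: case_prod_unfold comp_def)
  then show ?thesis by (simp add: sum.cartesian_product)
qed

context metaplectic_parameters
begin

definition row_weight :: "int \<Rightarrow> int \<Rightarrow> complex" where
  "row_weight E f = (if f = E then v * g E else h_flat n v f)"

text \<open>For d > 0 only the positive half of \<open>geom_sum\<close> is present, and k n with 1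
  <= k <= (d - 1) div n runs through the multiples of n strictly between 0 and d. As
  \<open>h_flat\<close> vanishes at all other f, the sum extends to every f < d.\<close>

lemma dlop_pos:
  assumes d: "\<nu> (i + 1) - \<nu> i = d" and "d > 0"
  shows "dlop i (lmon \<nu>) = (\<Sum>f\<in>{1..d}. lconst (row_weight d f) * lmon (\<nu> + apow i f))"
proof -
  have "lconst (1 - v) * geom_sum n i ((d - 1) div int n) = (\<Sum>k\<in>{1..(d - 1) div int n}. lconst (1 - v) * lmon (apow i (k * int n)))"
    using \<open>d > 0\<close> n_pos by (simp add: geom_sum_def sum_distrib_left pos_imp_zdiv_nonneg_iff)
  also have "\<dots> = (\<Sum>f\<in>{f\<in>{1..<d}. int n dvd f}. lconst (1 - v) * lmon (apow i f))"
  proof (rule sum.reindex_bij_witness[of _ "\<lambda>f. f div int n" "\<lambda>k. k * int n"])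
    fix k assume k: "k \<in> {1..(d - 1) div int n}"
    show "k * int n div int n = k" using n_pos by simp
    have "k * int n \<le> (d - 1) div int n * int n" using k by (intro mult_right_mono) auto
    also have "\<dots> \<le> d - 1" by (metis mult.commute n_pos of_nat_0_less_iff less_le_trans zero_less_one pos_mod_sign minus_mod_eq_mult_div add.commute diff_ge_0_iff_ge minus_div_mult_eq_mod)
    finally have "k * int n \<le> d - 1" .
    moreover have "1 \<le> k * int n" using k n_pos by (simp add: int_one_le_iff_zero_less)
    ultimately show "k * int n \<in> {f\<in>{1..<d}. int n dvd f}" by auto
  next
    fix f assume f: "f \<in> {f\<in>{1..<d}. int n dvd f}"
    show "f div int n * int n = f" using f by simp
    have "0 < f div int n" using f n_pos by (auto simp: pos_imp_zdiv_pos_iff zdvd_imp_le)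
    moreover have "f div int n \<le> (d - 1) div int n" using f n_pos by (intro zdiv_mono1) auto
    ultimately show "f div int n \<in> {1..(d - 1) div int n}" by auto
  qed auto
  also have "\<dots> = (\<Sum>f\<in>{1..<d}. lconst (h_flat n v f) * lmon (apow i f))"
    by (rule sum.mono_neutral_cong_left) (auto simp: h_flat_def)
  finally have *: "lconst (1 - v) * geom_sum n i ((d - 1) div int n) = (\<Sum>f\<in>{1..<d}. lconst (h_flat n v f) * lmon (apow i f))" .
  have "{1..d} = insert d {1..<d}" using \<open>d > 0\<close> by auto
  then have "(\<Sum>f\<in>{1..d}. lconst (row_weight d f) * lmon (\<nu> + apow i f))
      = lconst (v * g d) * lmon (\<nu> + apow i d) + (\<Sum>f\<in>{1..<d}. lconst (h_flat n v f) * lmon (\<nu> + apow i f))"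
    by (simp add: row_weight_def)
  then show ?thesis
    unfolding dlop_lmon dlop_monom_def d dlop_factor_def *
    by (simp add: distrib_left sum_distrib_left mult.left_commute[of "lmon \<nu>"] lmon_mult)
qed

lemma dlop_equal:
  assumes "\<nu> (i + 1) = \<nu> i"
  shows "dlop i (lmon \<nu>) = - lmon \<nu>"
proof -
  have "(-1) div int n = -1" using n_pos by (simp add: div_eq_minus1)
  then show ?thesis using assms
    by (simp add: dlop_lmon dlop_monom_def dlop_factor_def geom_sum_m1 g_0 lconst_diff lconst_uminus algebra_simps)
qed

text \<open>T_i acts on such a monomial as -1, so each pair in \<open>symm_split\<close>
  cancels.\<close>

lemma symm_equal:
  assumes "i \<in> {1..r}" "\<nu> (i + 1) = \<nu> i"
  shows "symm r (lmon \<nu>) = 0"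
proof -
  have "word_op ws (- p) = - word_op ws p" for ws p using word_op_diff[of ws 0 p] by simp
  then show ?thesis unfolding symm_split[OF assms(1)] dlop_equal[OF assms(2)] by (simp add: perm_op_def)
qed

text \<open>
  The discrepancy between one step of the operators and one step of a Gelfand--Tsetlin row: it is
  a multiple of \<open>(T\<^sub>i - v) x\<^sup>\<tau>\<close> if \<open>f < E\<close>, and of a monomial symmetric in \<open>x\<^sub>i, x\<^bsub>i+1\<^esub>\<close> if \<open>f = E\<close>.
\<close>

lemma symm_rank_two:
  assumes i: "i \<in> {1..r}" and \<tau>: "\<tau> (i + 1) - \<tau> i = E + f" and f: "1 \<le> f" "f \<le> E"
  shows "(\<Sum>e\<in>{f..E}. lconst (row_weight E e * (h_flat n v f - (if e = f then 1 else 0))) * symm r (lmon (\<tau> + apow i e))) = 0"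
proof (cases "f = E")
  case True
  have "symm r (lmon (\<tau> + apow i E)) = 0"
    by (rule symm_equal[OF i]) (use \<tau> True in \<open>simp add: apow_def\<close>)
  then show ?thesis using True by simp
next
  case False
  define p where "p = \<tau> + apow i f"
  define d where "d = E - f"
  have d: "d > 0" using f False by (simp add: d_def)
  have pd: "p (i + 1) - p i = d" using \<tau> by (simp add: p_def apow_def d_def)
  show ?thesis
  \<comment> \<open>If n does not divide f, every coefficient is zero: for e different from f
    because \<open>h_flat n v f\<close> vanishes, and at e = f because \<open>row_weight E f\<close>
    does too.\<close>
  proof (cases "int n dvd f")
    case False
    then have "h_flat n v f = 0" by (simp add: h_flat_def)
    moreover have "row_weight E f = 0" using \<open>\<not> int n dvd f\<close> \<open>f \<noteq> E\<close> by (simp add: row_weight_def h_flat_def)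
    ultimately have z: "row_weight E e * (h_flat n v f - (if e = f then 1 else 0)) = 0" for e by auto
    show ?thesis by (simp only: z lconst_0 mult_zero_left sum.neutral_const)
  next
    case True
    \<comment> \<open>Now n divides f, so subtracting f changes neither \<open>h_flat\<close> nor
      the Gauss sum: beyond f the weights are those of T_i on the monomial p, whose gap is d = E -
      f.\<close>
    have shift: "row_weight E (f + e) = row_weight d e" for e
    proof -
      have "h_flat n v (f + e) = h_flat n v e" using True by (simp add: h_flat_def dvd_add_right_iff)
      moreover have "g E = g d" by (rule g_cong) (use True in \<open>simp add: d_def cong_iff_dvd_diff\<close>)
      ultimately show ?thesis by (auto simp: row_weight_def d_def)
    qed
    have hE: "row_weight E f = 1 - v" and hf: "h_flat n v f = 1 - v" using True False by (simp_all add: row_weight_def h_flat_def)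
    \<comment> \<open>The term at e = f has coefficient (1 - v)((1 - v) - 1) = -(1 - v) v; the rest
      is (1 - v) T_i applied to p, and under the symmetrizer T_i becomes v.\<close>
    have "{f..E} = insert f {f+1..E}" using f by auto
    then have "(\<Sum>e\<in>{f..E}. lconst (row_weight E e * (h_flat n v f - (if e = f then 1 else 0))) * symm r (lmon (\<tau> + apow i e)))
       = lconst ((1 - v) * (- v)) * symm r (lmon p)
         + (\<Sum>e\<in>{f+1..E}. lconst (row_weight E e * (1 - v)) * symm r (lmon (\<tau> + apow i e)))"
      by (simp add: hE hf p_def)
    also have "(\<Sum>e\<in>{f+1..E}. lconst (row_weight E e * (1 - v)) * symm r (lmon (\<tau> + apow i e)))
       = (\<Sum>e\<in>{1..d}. lconst (row_weight d e * (1 - v)) * symm r (lmon (p + apow i e)))"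
      by (rule sum.reindex_bij_witness[of _ "\<lambda>e. f + e" "\<lambda>e. e - f"])
        (auto simp: d_def[symmetric] shift[symmetric] p_def add.assoc simp flip: apow_add, auto simp: d_def)
    also have "\<dots> = lconst (1 - v) * symm r (dlop i (lmon p))"
      unfolding dlop_pos[OF pd d] symm_sum symm_lconst sum_distrib_left by (simp add: lconst_mult ac_simps)
    also have "\<dots> = lconst ((1 - v) * v) * symm r (lmon p)"
      by (simp add: symm_TT[OF i] lconst_mult)
    finally show ?thesis by (simp add: lconst_uminus del: plus_fun_apply flip: distrib_right)
  qed
qed

text \<open>
  After \<open>k\<close> steps the exponent of \<open>x\<^bsub>k+1\<^esub>\<close> has lost \<open>e\<close>, which is the value of \<open>\<Gamma>\<close> at the \<open>k\<close>-add_char entry of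
  the row read from right to left. \<open>rowA\<close> describes the action of the operators, \<open>rowB\<close> the weights of
  a Gelfand--Tsetlin row, along which \<open>\<Gamma>\<close> cannot decrease. \<open>rowAB\<close> makes one step of the first kind
  and continues with the second.
\<close>

fun rowA :: "nat \<Rightarrow> nat \<Rightarrow> int \<Rightarrow> (nat \<Rightarrow> int) \<Rightarrow> laurent" where
  "rowA 0 k e \<mu> = lmon \<mu>"
| "rowA (Suc m) k e \<mu> = (if e = 0 then rowA m (Suc k) 0 \<mu> else 0)
    + (\<Sum>f\<in>{1..\<mu> (Suc (Suc k)) - \<mu> (Suc k)}. lconst (row_weight (\<mu> (Suc (Suc k)) - \<mu> (Suc k)) f) * rowA m (Suc k) f (\<mu> + apow (Suc k) f))"

fun rowB :: "nat \<Rightarrow> nat \<Rightarrow> int \<Rightarrow> (nat \<Rightarrow> int) \<Rightarrow> laurent" where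
  "rowB 0 k e \<mu> = lmon \<mu>"
| "rowB (Suc m) k e \<mu> = (\<Sum>f\<in>{e..\<mu> (Suc (Suc k)) - \<mu> (Suc k)}.
      lconst (if f = e then 1 else row_weight (\<mu> (Suc (Suc k)) - \<mu> (Suc k)) f) * rowB m (Suc k) f (\<mu> + apow (Suc k) f))"

fun rowAB :: "nat \<Rightarrow> nat \<Rightarrow> int \<Rightarrow> (nat \<Rightarrow> int) \<Rightarrow> laurent" where
  "rowAB 0 k e \<mu> = lmon \<mu>"
| "rowAB (Suc m) k e \<mu> = (if e = 0 then rowB m (Suc k) 0 \<mu> else 0)
    + (\<Sum>f\<in>{1..\<mu> (Suc (Suc k)) - \<mu> (Suc k)}. lconst (row_weight (\<mu> (Suc (Suc k)) - \<mu> (Suc k)) f) * rowB m (Suc k) f (\<mu> + apow (Suc k) f))"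

text \<open>Adding e back to the exponent of x_{k+1} undoes the previous step, so the condition is
  strict increase of the original exponents. It keeps the next gap larger than e, hence
  positive.\<close>

definition increasing_after :: "nat \<Rightarrow> nat \<Rightarrow> int \<Rightarrow> (nat \<Rightarrow> int) \<Rightarrow> bool" where
  "increasing_after m k e \<mu> \<longleftrightarrow> 0 \<le> e \<and> (\<forall>j\<in>{Suc k..k+m}. (if j = k + 1 then \<mu> j + e else \<mu> j) < \<mu> (j + 1))"

lemma increasing_after_Suc:
  assumes "increasing_after (Suc m) k e \<mu>" "0 \<le> f"
  shows "increasing_after m (Suc k) f (\<mu> + apow (Suc k) f)"
  unfolding increasing_after_def
proof (intro conjI ballI)
  fix j assume j: "j \<in> {Suc (Suc k)..Suc k + m}"
  then have "\<mu> j < \<mu> (j + 1)" using assms(1) by (auto simp: increasing_after_def dest!: bspec[of _ _ j])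
  then show "(if j = Suc k + 1 then (\<mu> + apow (Suc k) f) j + f else (\<mu> + apow (Suc k) f) j) < (\<mu> + apow (Suc k) f) (j + 1)"
    using j by (auto simp: apow_def)
qed (fact assms)

lemma increasing_after_gap: "increasing_after (Suc m) k e \<mu> \<Longrightarrow> e < \<mu> (Suc (Suc k)) - \<mu> (Suc k) \<and> 0 \<le> e"
  by (auto simp: increasing_after_def dest!: bspec[of _ _ "Suc k"])

lemma row_sum_TT:
  assumes "E = \<mu> (Suc i) - \<mu> i" "0 < E" and F: "\<And>f. f \<in> {1..E} \<Longrightarrow> F f = word_op ws (lmon (\<mu> + apow i f))"
  shows "(\<Sum>f\<in>{1..E}. lconst (row_weight E f) * F f) = word_op (ws @ [i]) (lmon \<mu>)"
  using assms dlop_pos[of \<mu> i E] by (simp add: word_op_append word_op_Cons word_op_sum word_op_lconst)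

text \<open>e > 0 records that the chain of operators has started: from then on every step has to
  act, since f is positive throughout and the branch for e = 0 is closed.\<close>

lemma rowA_pos:
  "increasing_after m k e \<mu> \<Longrightarrow> e > 0 \<Longrightarrow> rowA m k e \<mu> = word_op (rev [Suc k..<k+m+1]) (lmon \<mu>)"
proof (induction m arbitrary: k e \<mu>)
  case (Suc m)
  have E: "0 < \<mu> (Suc (Suc k)) - \<mu> (Suc k)" using increasing_after_gap[OF Suc.prems(1)] by simp
  have "rowA (Suc m) k e \<mu> = word_op (rev [Suc (Suc k)..<k+m+2] @ [Suc k]) (lmon \<mu>)"
    using Suc.prems(2) row_sum_TT[of "\<mu> (Suc (Suc k)) - \<mu> (Suc k)" \<mu> "Suc k", OF refl E] Suc.IH[OF increasing_after_Suc[OF Suc.prems(1)]]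
    by (simp del: upt_Suc plus_fun_apply)
  then show ?case by (simp add: upt_rec[of "Suc k"] del: upt_Suc)
qed simp

text \<open>j is the index of the first operator that acts; j = k + m + 1 gives the empty
  word.\<close>

lemma rowA_zero:
  "increasing_after m k 0 \<mu> \<Longrightarrow> rowA m k 0 \<mu> = (\<Sum>j\<in>{Suc k..k+m+1}. word_op (rev [j..<k+m+1]) (lmon \<mu>))"
proof (induction m arbitrary: k \<mu>)
  case (Suc m)
  let ?E = "\<mu> (Suc (Suc k)) - \<mu> (Suc k)"
  have E: "0 < ?E" using increasing_after_gap[OF Suc.prems(1)] by simp
  have "(\<Sum>f\<in>{1..?E}. lconst (row_weight ?E f) * rowA m (Suc k) f (\<mu> + apow (Suc k) f))
     = word_op (rev [Suc (Suc k)..<k+m+2] @ [Suc k]) (lmon \<mu>)"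
    using rowA_pos[OF increasing_after_Suc[OF Suc.prems(1)]]
    by (intro row_sum_TT[of "\<mu> (Suc (Suc k)) - \<mu> (Suc k)" \<mu> "Suc k", OF refl E]) (simp del: upt_Suc plus_fun_apply)
  also have "rev [Suc (Suc k)..<k+m+2] @ [Suc k] = rev [Suc k..<k+Suc m+1]"
    by (simp add: upt_rec[of "Suc k"] del: upt_Suc)
  finally have 1: "(\<Sum>f\<in>{1..?E}. lconst (row_weight ?E f) * rowA m (Suc k) f (\<mu> + apow (Suc k) f))
     = word_op (rev [Suc k..<k+Suc m+1]) (lmon \<mu>)" .
  have "increasing_after m (Suc k) 0 \<mu>" using increasing_after_Suc[OF Suc.prems(1), of 0] by simp
  then have 2: "rowA m (Suc k) 0 \<mu> = (\<Sum>j\<in>{Suc (Suc k)..k+Suc m+1}. word_op (rev [j..<k+Suc m+1]) (lmon \<mu>))"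
    using Suc.IH[of "Suc k" \<mu>] by simp
  have "{Suc k..k+Suc m+1} = insert (Suc k) {Suc (Suc k)..k+Suc m+1}" by auto
  then show ?case unfolding rowA.simps 1 2 by (simp add: add.commute del: upt_Suc)
qed simp

text \<open>At e = 0 steps of both kinds give f = 0 the weight 1, so all discrepancy stems from
  positive e.\<close>

lemma rowAB_zero: "increasing_after m k 0 \<mu> \<Longrightarrow> rowAB m k 0 \<mu> = rowB m k 0 \<mu>"
proof (cases m)
  case (Suc m')
  assume "increasing_after m k 0 \<mu>"
  then have "0 \<le> \<mu> (Suc (Suc k)) - \<mu> (Suc k)" using increasing_after_gap unfolding Suc by fastforce
  then have "{0..\<mu> (Suc (Suc k)) - \<mu> (Suc k)} = insert 0 {1..\<mu> (Suc (Suc k)) - \<mu> (Suc k)}" by auto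
  then show ?thesis unfolding Suc by simp
qed simp

text \<open>\<open>rowB\<close> started at k reads and changes only exponents beyond k, while the
  perturbations \<open>D e\<close> live at or before k. So a linear relation between symmetrized
  monomials that holds for all choices of the later exponents survives the continuation of the
  row.\<close>

lemma symm_rowB_spectator:
  assumes "\<And>\<tau>'. (\<forall>j\<le>k. \<tau>' j = \<tau> j) \<Longrightarrow> (\<Sum>e\<in>I. lconst (c e) * symm r (lmon (\<tau>' + D e))) = 0"
    and "\<And>e j. j > k \<Longrightarrow> D e j = 0"
  shows "(\<Sum>e\<in>I. lconst (c e) * symm r (rowB m k f (\<tau> + D e))) = 0"
  using assms
proof (induction m arbitrary: k f \<tau>)
  case 0
  then show ?case by simp
next
  case (Suc m)
  let ?E = "\<tau> (Suc (Suc k)) - \<tau> (Suc k)"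
  have D: "D e (Suc k) = 0" "D e (Suc (Suc k)) = 0" for e using Suc.prems(2) by auto
  have "(\<Sum>e\<in>I. lconst (c e) * symm r (rowB (Suc m) k f (\<tau> + D e)))
     = (\<Sum>e\<in>I. \<Sum>f'\<in>{f..?E}. lconst (if f' = f then 1 else row_weight ?E f') *
          (lconst (c e) * symm r (rowB m (Suc k) f' ((\<tau> + apow (Suc k) f') + D e))))"
    by (simp only: rowB.simps plus_fun_apply D add_0_right add_0_left symm_sum symm_lconst sum_distrib_left mult.left_commute[of "lconst (c _)"] ac_simps(1-3))
  also have "\<dots> = (\<Sum>f'\<in>{f..?E}. lconst (if f' = f then 1 else row_weight ?E f') *
          (\<Sum>e\<in>I. lconst (c e) * symm r (rowB m (Suc k) f' ((\<tau> + apow (Suc k) f') + D e))))"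
    by (subst sum.swap) (simp add: sum_distrib_left)
  also have "\<dots> = 0"
  proof (rule sum.neutral, rule ballI)
    fix f'
    have "(\<Sum>e\<in>I. lconst (c e) * symm r (rowB m (Suc k) f' ((\<tau> + apow (Suc k) f') + D e))) = 0"
    proof (rule Suc.IH)
      fix \<tau>' assume *: "\<forall>j\<le>Suc k. \<tau>' j = (\<tau> + apow (Suc k) f') j"
      have "\<forall>j\<le>k. \<tau>' j = \<tau> j" using * by (auto simp: apow_def)
      then show "(\<Sum>e\<in>I. lconst (c e) * symm r (lmon (\<tau>' + D e))) = 0" by (rule Suc.prems(1))
    qed (use Suc.prems(2) in auto)
    then show "lconst (if f' = f then 1 else row_weight ?E f') *
          (\<Sum>e\<in>I. lconst (c e) * symm r (rowB m (Suc k) f' ((\<tau> + apow (Suc k) f') + D e))) = 0" by simp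
  qed
  finally show ?case .
qed

text \<open>The two continuations agree for f > e; for f <= e they differ by
  \<open>h_flat n v f\<close>, less 1 at f = e. Exchanging the sums puts f outside. Its move raises
  the exponent of x_{k+2} by f, which turns the gap E1 into the E1 + f that
  \<open>symm_rank_two\<close> asks for. The operator concerned has index k + 1 <= r when m > 0, so
  it belongs to the smaller symmetrizer.\<close>

lemma symm_rowAB_diff:
  assumes inc: "increasing_after (Suc m) k e' \<mu>" and r: "k + m = r" and E1: "E1 = \<mu> (Suc (Suc k)) - \<mu> (Suc k)"
  shows "(\<Sum>e\<in>{1..E1}. lconst (row_weight E1 e) * symm r (rowAB m (Suc k) e (\<mu> + apow (Suc k) e)
           - rowB m (Suc k) e (\<mu> + apow (Suc k) e))) = 0"
proof (cases m)
  case 0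
  then show ?thesis by simp
next
  case (Suc m')
  define c where "c e f = row_weight E1 e * (h_flat n v f - (if e = f then 1 else 0))" for e f
  have diff: "rowAB m (Suc k) e (\<mu> + apow (Suc k) e) - rowB m (Suc k) e (\<mu> + apow (Suc k) e)
      = (\<Sum>f\<in>{1..e}. lconst (h_flat n v f - (if e = f then 1 else 0)) * rowB m' (Suc (Suc k)) f ((\<mu> + apow (Suc (Suc k)) f) + apow (Suc k) e))"
    if e: "e \<in> {1..E1}" for e
  proof -
    let ?\<nu> = "\<mu> + apow (Suc k) e"
    define E2 where "E2 = ?\<nu> (Suc (Suc (Suc k))) - ?\<nu> (Suc (Suc k))"
    define Z where "Z f = rowB m' (Suc (Suc k)) f (?\<nu> + apow (Suc (Suc k)) f)" for f
    have "e < E2" using increasing_after_gap[OF increasing_after_Suc[OF inc, of e, unfolded Suc]] e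
      by (simp add: E2_def eval_nat_numeral)
    then have split: "{1..E2} = {1..e} \<union> {e+1..E2}" "{e..E2} = insert e {e+1..E2}" using e by auto
    have "rowAB m (Suc k) e ?\<nu> = (\<Sum>f\<in>{1..E2}. lconst (row_weight E2 f) * Z f)"
      using e by (simp add: Suc Z_def E2_def eval_nat_numeral)
    also have "\<dots> = (\<Sum>f\<in>{1..e}. lconst (row_weight E2 f) * Z f) + (\<Sum>f\<in>{e+1..E2}. lconst (row_weight E2 f) * Z f)"
      unfolding split by (rule sum.union_disjoint) auto
    also have "(\<Sum>f\<in>{1..e}. lconst (row_weight E2 f) * Z f) = (\<Sum>f\<in>{1..e}. lconst (h_flat n v f) * Z f)"
      by (rule sum.cong[OF refl]) (use \<open>e < E2\<close> in \<open>auto simp: row_weight_def\<close>)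
    finally have 1: "rowAB m (Suc k) e ?\<nu> = (\<Sum>f\<in>{1..e}. lconst (h_flat n v f) * Z f) + (\<Sum>f\<in>{e+1..E2}. lconst (row_weight E2 f) * Z f)" .
    have "rowB m (Suc k) e ?\<nu> = (\<Sum>f\<in>{e..E2}. lconst (if f = e then 1 else row_weight E2 f) * Z f)"
      by (simp add: Suc Z_def E2_def eval_nat_numeral cong: if_cong)
    also have "\<dots> = Z e + (\<Sum>f\<in>{e+1..E2}. lconst (if f = e then 1 else row_weight E2 f) * Z f)"
      unfolding split by simp
    also have "(\<Sum>f\<in>{e+1..E2}. lconst (if f = e then 1 else row_weight E2 f) * Z f) = (\<Sum>f\<in>{e+1..E2}. lconst (row_weight E2 f) * Z f)"
      by (rule sum.cong) auto
    also have "Z e = (\<Sum>f\<in>{1..e}. lconst (if e = f then 1 else 0) * Z f)"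
    proof -
      have "(\<Sum>f\<in>{1..e}. lconst (if e = f then 1 else 0) * Z f) = (\<Sum>f\<in>{1..e}. if f = e then Z f else 0)"
        by (rule sum.cong) auto
      then show ?thesis using e by simp
    qed
    finally have 2: "rowB m (Suc k) e ?\<nu> = (\<Sum>f\<in>{1..e}. lconst (if e = f then 1 else 0) * Z f) + (\<Sum>f\<in>{e+1..E2}. lconst (row_weight E2 f) * Z f)" .
    show ?thesis unfolding 1 2
      by (simp add: Z_def sum_subtractf[symmetric] lconst_diff left_diff_distrib ac_simps)
  qed
  have "(\<Sum>e\<in>{1..E1}. lconst (row_weight E1 e) * symm r (rowAB m (Suc k) e (\<mu> + apow (Suc k) e)
           - rowB m (Suc k) e (\<mu> + apow (Suc k) e)))
     = (\<Sum>e\<in>{1..E1}. \<Sum>f\<in>{1..e}. lconst (c e f) * symm r (rowB m' (Suc (Suc k)) f ((\<mu> + apow (Suc (Suc k)) f) + apow (Suc k) e)))"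
    by (rule sum.cong[OF refl]) (simp only: diff symm_sum symm_lconst sum_distrib_left c_def lconst_mult mult.assoc)
  also have "\<dots> = (\<Sum>f\<in>{1..E1}. \<Sum>e\<in>{f..E1}. lconst (c e f) * symm r (rowB m' (Suc (Suc k)) f ((\<mu> + apow (Suc (Suc k)) f) + apow (Suc k) e)))"
    unfolding sum.Sigma[OF finite_atLeastAtMost_int ballI[OF finite_atLeastAtMost_int]]
    by (rule sum.reindex_bij_witness[of _ prod.swap prod.swap]) auto
  also have "\<dots> = 0"
  proof (rule sum.neutral, rule ballI, rule symm_rowB_spectator)
    fix f \<tau>' assume f: "f \<in> {1..E1}" and \<tau>': "\<forall>j\<le>Suc (Suc k). \<tau>' j = (\<mu> + apow (Suc (Suc k)) f) j"
    show "(\<Sum>e\<in>{f..E1}. lconst (c e f) * symm r (lmon (\<tau>' + apow (Suc k) e))) = 0"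
      unfolding c_def
      by (rule symm_rank_two) (use f \<tau>' r E1 Suc in \<open>auto simp: apow_def\<close>)
  qed (auto simp: apow_def)
  finally show ?thesis .
qed

text \<open>The induction hypothesis turns the tail into one with a single operator step in front,
  and \<open>symm_rowAB_diff\<close> trades that step for a pattern step.\<close>

lemma symm_rowA:
  "increasing_after m k e \<mu> \<Longrightarrow> k + m = Suc r \<Longrightarrow> symm r (rowA m k e \<mu>) = symm r (rowAB m k e \<mu>)"
proof (induction m arbitrary: k e \<mu>)
  case 0
  then show ?case by simp
next
  case (Suc m)
  define E where "E = \<mu> (Suc (Suc k)) - \<mu> (Suc k)"
  have inc0: "increasing_after m (Suc k) 0 \<mu>" using increasing_after_Suc[OF Suc.prems(1), of 0] by simp
  have "symm r (rowA m (Suc k) 0 \<mu>) = symm r (rowB m (Suc k) 0 \<mu>)"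
    using Suc.IH[OF inc0] Suc.prems(2) rowAB_zero[OF inc0] by simp
  moreover have "(\<Sum>f\<in>{1..E}. lconst (row_weight E f) * symm r (rowA m (Suc k) f (\<mu> + apow (Suc k) f)))
     = (\<Sum>f\<in>{1..E}. lconst (row_weight E f) * symm r (rowAB m (Suc k) f (\<mu> + apow (Suc k) f)))"
    by (rule sum.cong[OF refl], subst Suc.IH) (use Suc.prems(2) increasing_after_Suc[OF Suc.prems(1)] in auto)
  moreover have "\<dots> = (\<Sum>f\<in>{1..E}. lconst (row_weight E f) * symm r (rowB m (Suc k) f (\<mu> + apow (Suc k) f)))"
    using symm_rowAB_diff[OF Suc.prems(1) _ E_def] Suc.prems(2)
    by (simp add: symm_diff right_diff_distrib sum_subtractf)
  ultimately show ?case
    by (simp add: symm_add symm_sum symm_lconst E_def[symmetric] del: One_nat_def)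
qed

lemma symm_Suc_rowB:
  assumes "\<And>j. j \<in> {1..Suc r} \<Longrightarrow> \<nu> j < \<nu> (j + 1)"
  shows "symm (Suc r) (lmon \<nu>) = symm r (rowB (Suc r) 0 0 \<nu>)"
proof -
  have inc: "increasing_after (Suc r) 0 0 \<nu>" using assms by (auto simp: increasing_after_def)
  have "symm (Suc r) (lmon \<nu>) = symm r (rowA (Suc r) 0 0 \<nu>)"
    unfolding symm_Suc rowA_zero[OF inc] coset_word_def by simp
  then show ?thesis using symm_rowA[OF inc] rowAB_zero[OF inc] by simp
qed

end

section \<open>Gelfand--Tsetlin patterns\<close>

context metaplectic_parameters
begin

text \<open>e is the share of \<Gamma> due to entries to the right of column m, which are already
  fixed when a row is built from the right.\<close>

definition row_factor :: "(nat \<Rightarrow> int) \<Rightarrow> nat \<Rightarrow> int \<Rightarrow> (nat \<Rightarrow> int) \<Rightarrow> nat \<Rightarrow> complex" where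
  "row_factor \<kappa> m e b j = (let \<Gamma> = e + (\<Sum>l\<in>{j..m}. b l - \<kappa> (l + 1)) in
     if b j = \<kappa> (j + 1) then 1 else if b j = \<kappa> j then v * g \<Gamma> else h_flat n v \<Gamma>)"

text \<open>The entries of the row appear in reverse order because the exponents are read through
  w_0. The last exponent preserves the total, since every step only moves a multiple of a
  root.\<close>

definition row_exp :: "nat \<Rightarrow> nat \<Rightarrow> (nat \<Rightarrow> int) \<Rightarrow> (nat \<Rightarrow> int) \<Rightarrow> nat \<Rightarrow> int" where
  "row_exp m k b \<mu> = (\<lambda>i. if Suc k \<le> i \<and> i \<le> k + m then b (k + m + 1 - i)
     else if i = k + m + 1 then (\<Sum>i\<in>{Suc k..k+m+1}. \<mu> i) - (\<Sum>j\<in>{1..m}. b j) else \<mu> i)"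

definition rows :: "nat \<Rightarrow> (nat \<Rightarrow> int) \<Rightarrow> (nat \<Rightarrow> int) set" where
  "rows m \<kappa> = PiE {1..m} (\<lambda>j. {\<kappa> (j + 1)..\<kappa> j})"

text \<open>In a row of length m + 1 the step f = e + y - \<kappa>_{m+2} makes the exponent of
  x_{k+1} equal to y, the rightmost entry, and f is the share of \<Gamma> handed on to the remaining
  columns.\<close>

lemma rowB_expand:
  assumes "\<And>j. j \<in> {1..m} \<Longrightarrow> \<kappa> (j + 1) < \<kappa> j"
    and "\<mu> (Suc k) = \<kappa> (m + 1) - e"
    and "\<And>t. t \<in> {1..m} \<Longrightarrow> \<mu> (Suc k + t) = \<kappa> (m + 1 - t)"
  shows "rowB m k e \<mu> = (\<Sum>b\<in>rows m \<kappa>. lconst (\<Prod>j\<in>{1..m}. row_factor \<kappa> m e b j) * lmon (row_exp m k b \<mu>))"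
  using assms
proof (induction m arbitrary: k e \<mu>)
  case 0
  have "row_exp 0 k b \<mu> = \<mu>" for b by (auto simp: row_exp_def)
  then show ?case by (simp add: rows_def)
next
  case (Suc m)
  define E where "E = \<mu> (Suc (Suc k)) - \<mu> (Suc k)"
  have E: "E = \<kappa> (m + 1) - \<kappa> (m + 2) + e"
    using Suc.prems(2) Suc.prems(3)[of 1] by (simp add: E_def)
  have lt: "\<kappa> (m + 2) < \<kappa> (m + 1)" using Suc.prems(1)[of "Suc m"] by simp
  define F where "F y = e + y - \<kappa> (m + 2)" for y
  have IH: "rowB m (Suc k) f (\<mu> + apow (Suc k) f) =
      (\<Sum>b\<in>rows m \<kappa>. lconst (\<Prod>j\<in>{1..m}. row_factor \<kappa> m f b j) * lmon (row_exp m (Suc k) b (\<mu> + apow (Suc k) f)))" for f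
  proof (rule Suc.IH)
    show "(\<mu> + apow (Suc k) f) (Suc (Suc k)) = \<kappa> (m + 1) - f"
      using Suc.prems(3)[of 1] by (simp add: apow_def)
    show "(\<mu> + apow (Suc k) f) (Suc (Suc k) + t) = \<kappa> (m + 1 - t)" if "t \<in> {1..m}" for t
      using Suc.prems(3)[of "Suc t"] that by (simp add: apow_def)
  qed (use Suc.prems(1) in auto)
  have "rowB (Suc m) k e \<mu> = (\<Sum>f\<in>{e..E}. lconst (if f = e then 1 else row_weight E f) *
      (\<Sum>b\<in>rows m \<kappa>. lconst (\<Prod>j\<in>{1..m}. row_factor \<kappa> m f b j) * lmon (row_exp m (Suc k) b (\<mu> + apow (Suc k) f))))"
    unfolding rowB.simps IH E_def[symmetric] ..
  also have "\<dots> = (\<Sum>y\<in>{\<kappa> (m + 2)..\<kappa> (m + 1)}. lconst (if F y = e then 1 else row_weight E (F y)) *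
      (\<Sum>b\<in>rows m \<kappa>. lconst (\<Prod>j\<in>{1..m}. row_factor \<kappa> m (F y) b j) * lmon (row_exp m (Suc k) b (\<mu> + apow (Suc k) (F y)))))"
    by (rule sum.reindex_bij_witness[of _ F "\<lambda>f. f - e + \<kappa> (m + 2)"]) (auto simp: F_def E)
  also have "\<dots> = (\<Sum>y\<in>{\<kappa> (m + 2)..\<kappa> (m + 1)}. \<Sum>b\<in>rows m \<kappa>.
      lconst (\<Prod>j\<in>{1..Suc m}. row_factor \<kappa> (Suc m) e (b(Suc m := y)) j) * lmon (row_exp (Suc m) k (b(Suc m := y)) \<mu>))"
    unfolding sum_distrib_left
  proof (rule sum.cong[OF refl], rule sum.cong[OF refl])
    fix y b assume y: "y \<in> {\<kappa> (m + 2)..\<kappa> (m + 1)}" and b: "b \<in> rows m \<kappa>"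
    let ?b = "b(Suc m := y)"
    have "row_factor \<kappa> (Suc m) e ?b j = row_factor \<kappa> m (F y) b j" if j: "j \<in> {1..m}" for j
    proof -
      have "{j..Suc m} = insert (Suc m) {j..m}" using j by auto
      moreover have "(\<Sum>l\<in>{j..m}. ?b l - \<kappa> (l + 1)) = (\<Sum>l\<in>{j..m}. b l - \<kappa> (l + 1))"
        by (rule sum.cong) auto
      ultimately have "e + (\<Sum>l\<in>{j..Suc m}. ?b l - \<kappa> (l + 1)) = F y + (\<Sum>l\<in>{j..m}. b l - \<kappa> (l + 1))"
        by (simp add: F_def)
      then show ?thesis using j unfolding row_factor_def Let_def by (simp only:) simp
    qed
    then have "(\<Prod>j\<in>{1..Suc m}. row_factor \<kappa> (Suc m) e ?b j) =
        row_factor \<kappa> (Suc m) e ?b (Suc m) * (\<Prod>j\<in>{1..m}. row_factor \<kappa> m (F y) b j)"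
      by (simp add: mult.commute)
    moreover have "row_factor \<kappa> (Suc m) e ?b (Suc m) = (if F y = e then 1 else row_weight E (F y))"
      using lt by (auto simp: row_factor_def row_weight_def F_def E Let_def algebra_simps)
    moreover have "row_exp (Suc m) k ?b \<mu> = row_exp m (Suc k) b (\<mu> + apow (Suc k) (F y))"
    proof
      fix i
      consider "i \<le> k \<or> i > k + m + 2" | "i = Suc k" | "i = k + m + 2" | "Suc (Suc k) \<le> i" "i \<le> k + m + 1" by linarith
      then show "row_exp (Suc m) k ?b \<mu> i = row_exp m (Suc k) b (\<mu> + apow (Suc k) (F y)) i"
      proof cases
        case 1
        then have "\<not> (Suc k \<le> i \<and> i \<le> k + Suc m)" "i \<noteq> k + Suc m + 1" "\<not> (Suc (Suc k) \<le> i \<and> i \<le> Suc k + m)"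
          "i \<noteq> Suc k + m + 1" "i \<noteq> Suc k" "i \<noteq> Suc k + 1" by auto
        then show ?thesis by (simp only: row_exp_def apow_def plus_fun_apply if_False add_0_right)
      next
        case 2
        then show ?thesis using Suc.prems(2) by (simp add: row_exp_def apow_def F_def)
      next
        case 3
        let ?R = "{Suc (Suc (Suc k))..Suc (Suc (k + m))}"
        have 1: "{Suc k..Suc (Suc (k + m))} = insert (Suc k) (insert (Suc (Suc k)) ?R)"
          and 2: "{Suc (Suc k)..Suc (Suc (k + m))} = insert (Suc (Suc k)) ?R" by auto
        have "sum (\<mu> + apow (Suc k) (F y)) ?R = sum \<mu> ?R"
          by (rule sum.cong) (auto simp: apow_def)
        then have R: "sum (\<mu> + apow (Suc k) (F y)) {Suc (Suc k)..Suc (Suc (k + m))} = \<mu> (Suc (Suc k)) - F y + sum \<mu> ?R"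
          unfolding 2 by (simp add: apow_def del: plus_fun_apply) (simp add: apow_def)
        have L: "sum \<mu> {Suc k..Suc (Suc (k + m))} = \<mu> (Suc k) + (\<mu> (Suc (Suc k)) + sum \<mu> ?R)"
          unfolding 1 by simp
        have B: "sum ?b {1..Suc m} = y + sum b {1..m}" by simp
        have "row_exp (Suc m) k ?b \<mu> i = sum \<mu> {Suc k..Suc (Suc (k + m))} - sum ?b {1..Suc m}"
          using 3 by (simp add: row_exp_def del: sum.cl_ivl_Suc)
        also have "\<dots> = sum (\<mu> + apow (Suc k) (F y)) {Suc (Suc k)..Suc (Suc (k + m))} - sum b {1..m}"
          unfolding L R B using Suc.prems(2) by (simp add: F_def)
        also have "\<dots> = row_exp m (Suc k) b (\<mu> + apow (Suc k) (F y)) i"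
          using 3 by (simp add: row_exp_def del: sum.cl_ivl_Suc plus_fun_apply)
        finally show ?thesis .
      next
        case 4
        then show ?thesis by (auto simp: row_exp_def)
      qed
    qed
    ultimately show "lconst (if F y = e then 1 else row_weight E (F y)) *
        (lconst (\<Prod>j\<in>{1..m}. row_factor \<kappa> m (F y) b j) * lmon (row_exp m (Suc k) b (\<mu> + apow (Suc k) (F y)))) =
        lconst (\<Prod>j\<in>{1..Suc m}. row_factor \<kappa> (Suc m) e ?b j) * lmon (row_exp (Suc m) k ?b \<mu>)"
      by (simp only: lconst_mult mult.assoc)
  qed
  also have "\<dots> = (\<Sum>b\<in>rows (Suc m) \<kappa>. lconst (\<Prod>j\<in>{1..Suc m}. row_factor \<kappa> (Suc m) e b j) * lmon (row_exp (Suc m) k b \<mu>))"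
  proof -
    have "{1..Suc m} = insert (Suc m) {1..m}" by auto
    then have eq: "rows (Suc m) \<kappa> = PiE (insert (Suc m) {1..m}) (\<lambda>j. {\<kappa> (j + 1)..\<kappa> j})" by (simp add: rows_def)
    show ?thesis unfolding eq rows_def[of m] by (subst sum_PiE_insert) (simp_all del: prod.cl_ivl_Suc)
  qed
  finally show ?case .
qed

end

section \<open>Removing the top row of a pattern\<close>

definition gt_cons :: "nat \<Rightarrow> (nat \<Rightarrow> int) \<Rightarrow> (nat \<Rightarrow> nat \<Rightarrow> int) \<Rightarrow> nat \<Rightarrow> nat \<Rightarrow> int" where
  "gt_cons s \<kappa> a = (\<lambda>i j. case i of 0 \<Rightarrow> if j \<le> s then \<kappa> (j + 1) else 0
     | Suc i' \<Rightarrow> (case j of 0 \<Rightarrow> 0 | Suc j' \<Rightarrow> a i' j'))"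

lemma gt_cons_simps [simp]:
  "gt_cons s \<kappa> a 0 j = (if j \<le> s then \<kappa> (j + 1) else 0)"
  "gt_cons s \<kappa> a (Suc i) 0 = 0"
  "gt_cons s \<kappa> a (Suc i) (Suc j) = a i j"
  by (simp_all add: gt_cons_def)

definition gt_tail :: "(nat \<Rightarrow> nat \<Rightarrow> int) \<Rightarrow> nat \<Rightarrow> nat \<Rightarrow> int" where
  "gt_tail a = (\<lambda>i j. a (Suc i) (Suc j))"

text \<open>Restricted to 1..m so as to lie in the extensional function space \<open>rows\<close>.
  The tail pattern has this as its top row, with both array indices lowered by one.\<close>

definition gt_row :: "nat \<Rightarrow> (nat \<Rightarrow> nat \<Rightarrow> int) \<Rightarrow> nat \<Rightarrow> int" where
  "gt_row m a = (\<lambda>j\<in>{1..m}. a 1 j)"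

context metaplectic_parameters
begin

lemma gt_tail_in:
  assumes a: "a \<in> gt_patterns (Suc s) \<kappa>"
  shows "gt_row (Suc s) a \<in> rows (Suc s) \<kappa>" "gt_tail a \<in> gt_patterns s (gt_row (Suc s) a)"
    "gt_cons (Suc s) \<kappa> (gt_tail a) = a"
proof -
  have 0: "a i j = 0" if "\<not> (i \<le> j \<and> j \<le> Suc s)" for i j using a that by (simp add: gt_patterns_def)
  have 1: "a 0 j = \<kappa> (j + 1)" if "j \<le> Suc s" for j using a that by (simp add: gt_patterns_def)
  have 2: "a i j \<le> a (i - 1) (j - 1) \<and> a (i - 1) j \<le> a i j" if "1 \<le> i" "i \<le> j" "j \<le> Suc s" for i j
    using a that by (simp add: gt_patterns_def)
  show "gt_row (Suc s) a \<in> rows (Suc s) \<kappa>"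
    unfolding rows_def gt_row_def
  proof (subst restrict_PiE_iff, rule ballI)
    fix j assume j: "j \<in> {1..Suc s}"
    then show "a 1 j \<in> {\<kappa> (j + 1)..\<kappa> j}" using 2[of 1 j] 1[of j] 1[of "j - 1"] by auto
  qed
  show "gt_tail a \<in> gt_patterns s (gt_row (Suc s) a)"
    unfolding gt_patterns_def gt_tail_def
  proof (intro CollectI conjI allI impI)
    fix i j assume ij: "1 \<le> i \<and> i \<le> j \<and> j \<le> s"
    then obtain i' j' where "i = Suc i'" "j = Suc j'" by (metis Suc_le_D One_nat_def le_trans)
    with ij 2[of "Suc i" "Suc j"] show "a (Suc (i - 1)) (Suc (j - 1)) \<ge> a (Suc i) (Suc j)" "a (Suc i) (Suc j) \<ge> a (Suc (i - 1)) (Suc j)"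
      by auto
  qed (auto simp: 0 gt_row_def)
  show "gt_cons (Suc s) \<kappa> (gt_tail a) = a"
    by (intro ext) (auto simp: gt_cons_def gt_tail_def 0 1 split: nat.splits)
qed

lemma gt_cons_in:
  assumes b: "b \<in> rows (Suc s) \<kappa>" and a: "a \<in> gt_patterns s b"
  shows "gt_cons (Suc s) \<kappa> a \<in> gt_patterns (Suc s) \<kappa>" "gt_row (Suc s) (gt_cons (Suc s) \<kappa> a) = b"
    "gt_tail (gt_cons (Suc s) \<kappa> a) = a"
proof -
  have 0: "a i j = 0" if "\<not> (i \<le> j \<and> j \<le> s)" for i j using a that by (simp add: gt_patterns_def)
  have 1: "a 0 j = b (j + 1)" if "j \<le> s" for j using a that by (simp add: gt_patterns_def)
  have 2: "a i j \<le> a (i - 1) (j - 1) \<and> a (i - 1) j \<le> a i j" if "1 \<le> i" "i \<le> j" "j \<le> s" for i j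
    using a that by (simp add: gt_patterns_def)
  have 3: "\<kappa> (j + 1) \<le> b j \<and> b j \<le> \<kappa> j" if "j \<in> {1..Suc s}" for j
    using PiE_mem[OF b[unfolded rows_def] that] by simp
  show "gt_cons (Suc s) \<kappa> a \<in> gt_patterns (Suc s) \<kappa>"
    unfolding gt_patterns_def
  proof (intro CollectI conjI allI impI)
    fix i j assume "\<not> (i \<le> j \<and> j \<le> Suc s)"
    then show "gt_cons (Suc s) \<kappa> a i j = 0" using 0 by (cases i; cases j) auto
  next
    fix i j assume ij: "1 \<le> i \<and> i \<le> j \<and> j \<le> Suc s"
    then obtain i' j' where s: "i = Suc i'" "j = Suc j'" by (metis Suc_le_D One_nat_def le_trans)
    show "gt_cons (Suc s) \<kappa> a (i - 1) (j - 1) \<ge> gt_cons (Suc s) \<kappa> a i j"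
      using ij 1[of j'] 2[of i' j'] 3[of j] unfolding s by (cases i'; cases j') auto
    show "gt_cons (Suc s) \<kappa> a i j \<ge> gt_cons (Suc s) \<kappa> a (i - 1) j"
      using ij 1[of j'] 2[of i' j'] 3[of j] unfolding s by (cases i'; cases j') auto
  qed simp
  show "gt_row (Suc s) (gt_cons (Suc s) \<kappa> a) = b"
  proof
    fix j
    show "gt_row (Suc s) (gt_cons (Suc s) \<kappa> a) j = b j"
    proof (cases "j \<in> {1..Suc s}")
      case True
      then obtain j' where "j = Suc j'" by (metis atLeastAtMost_iff Suc_le_D One_nat_def)
      then show ?thesis using True 1[of j'] by (simp add: gt_row_def)
    next
      case False
      moreover have "b j = undefined" by (rule PiE_arb[OF b[unfolded rows_def] False])
      ultimately show ?thesis by (simp only: gt_row_def restrict_apply if_False)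
    qed
  qed
  show "gt_tail (gt_cons (Suc s) \<kappa> a) = a" by (simp add: gt_tail_def)
qed

lemma gt_patterns_0: "gt_patterns 0 \<kappa> = {\<lambda>i j. if i = 0 \<and> j = 0 then \<kappa> 1 else 0}"
  by (auto simp: gt_patterns_def fun_eq_iff)

lemma finite_gt_patterns: "finite (gt_patterns s \<kappa>)"
proof (induction s arbitrary: \<kappa>)
  case 0
  then show ?case by (simp add: gt_patterns_0)
next
  case (Suc s)
  have "gt_patterns (Suc s) \<kappa> \<subseteq> (\<lambda>(b, a). gt_cons (Suc s) \<kappa> a) ` (SIGMA b:rows (Suc s) \<kappa>. gt_patterns s b)"
  proof
    fix a assume a: "a \<in> gt_patterns (Suc s) \<kappa>"
    show "a \<in> (\<lambda>(b, a). gt_cons (Suc s) \<kappa> a) ` (SIGMA b:rows (Suc s) \<kappa>. gt_patterns s b)"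
      by (rule image_eqI[of _ _ "(gt_row (Suc s) a, gt_tail a)"]) (use gt_tail_in[OF a] in auto)
  qed
  moreover have "finite (rows (Suc s) \<kappa>)" unfolding rows_def by (intro finite_PiE) auto
  ultimately show ?case using Suc by (elim finite_subset) (intro finite_imageI finite_SigmaI)
qed

lemma sum_gt_patterns_Suc:
   "(\<Sum>a\<in>gt_patterns (Suc s) \<kappa>. F a) = (\<Sum>b\<in>rows (Suc s) \<kappa>. \<Sum>a\<in>gt_patterns s b. F (gt_cons (Suc s) \<kappa> a))"
proof -
  have "finite (rows (Suc s) \<kappa>)" unfolding rows_def by (intro finite_PiE) auto
  then have "(\<Sum>b\<in>rows (Suc s) \<kappa>. \<Sum>a\<in>gt_patterns s b. F (gt_cons (Suc s) \<kappa> a))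
     = (\<Sum>(b, a)\<in>(SIGMA b:rows (Suc s) \<kappa>. gt_patterns s b). F (gt_cons (Suc s) \<kappa> a))"
    by (rule sum.Sigma) (simp add: finite_gt_patterns)
  also have "\<dots> = (\<Sum>a\<in>gt_patterns (Suc s) \<kappa>. F a)"
    by (rule sum.reindex_bij_witness[of _ "\<lambda>a. (gt_row (Suc s) a, gt_tail a)" "\<lambda>(b, a). gt_cons (Suc s) \<kappa> a"])
      (auto simp: gt_tail_in gt_cons_in)
  finally show ?thesis by simp
qed

text \<open>\<Gamma>_{ij} involves only two adjacent rows, so the factors with i >= 2 are those of
  the tail. Strictness of \<kappa> matches the cases for i = 1 with those of
  \<open>row_factor\<close>: an entry cannot attain both ends of its interval.\<close>

lemma gt_coeff_cons:
  assumes b: "b \<in> rows (Suc s) \<kappa>" and a: "a \<in> gt_patterns s b" and lt: "\<And>j. j \<in> {1..Suc s} \<Longrightarrow> \<kappa> (j + 1) < \<kappa> j"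
  shows "gt_coeff n v g (Suc s) (gt_cons (Suc s) \<kappa> a) =
    (\<Prod>j\<in>{1..Suc s}. row_factor \<kappa> (Suc s) 0 b j) * gt_coeff n v g s a"
proof -
  let ?c = "gt_cons (Suc s) \<kappa> a"
  have 1: "a 0 j = b (j + 1)" if "j \<le> s" for j using a that by (simp add: gt_patterns_def)
  have 3: "\<kappa> (j + 1) \<le> b j \<and> b j \<le> \<kappa> j" if "j \<in> {1..Suc s}" for j
    using PiE_mem[OF b[unfolded rows_def] that] by simp
  have c1: "?c 1 j = b j" if "j \<in> {1..Suc s}" for j using 1[of "j - 1"] that by (cases j) auto
  have Gam: "gt_Gamma (Suc s) ?c (Suc i) (Suc j) = gt_Gamma s a i j" if "1 \<le> i" "i \<le> j" "j \<le> s" for i j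
  proof -
    have "gt_Gamma (Suc s) ?c (Suc i) (Suc j) = (\<Sum>k = j..s. ?c (Suc i) (Suc k) - ?c (Suc i - 1) (Suc k))"
      unfolding gt_Gamma_def by (subst sum.shift_bounds_cl_Suc_ivl) simp
    also have "\<dots> = gt_Gamma s a i j"
      unfolding gt_Gamma_def by (rule sum.cong[OF refl]) (use that in \<open>cases i; simp\<close>)
    finally show ?thesis .
  qed
  have fac: "gt_factor n v g (Suc s) ?c (Suc i) (Suc j) = gt_factor n v g s a i j" if ij: "1 \<le> i" "i \<le> j" "j \<le> s" for i j
  proof -
    obtain i' j' where s: "i = Suc i'" "j = Suc j'" using ij by (metis Suc_le_D One_nat_def le_trans)
    show ?thesis unfolding gt_factor_def Gam[OF ij] by (simp add: s)
  qed
  have fac1: "gt_factor n v g (Suc s) ?c 1 j = row_factor \<kappa> (Suc s) 0 b j" if j: "j \<in> {1..Suc s}" for j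
  proof -
    have "gt_Gamma (Suc s) ?c 1 j = (\<Sum>l\<in>{j..Suc s}. b l - \<kappa> (l + 1))"
      unfolding gt_Gamma_def by (rule sum.cong[OF refl]) (use j c1 in auto)
    moreover have "?c 0 (j - 1) = \<kappa> j" "?c 0 j = \<kappa> (j + 1)" using j by auto
    ultimately show ?thesis using lt[OF j] 3[OF j]
      by (auto simp: gt_factor_def row_factor_def c1[OF j] g_flat_def Let_def simp del: One_nat_def)
  qed
  have "gt_coeff n v g (Suc s) ?c = (\<Prod>j\<in>{1..Suc s}. gt_factor n v g (Suc s) ?c 1 j * (\<Prod>i\<in>{2..j}. gt_factor n v g (Suc s) ?c i j))"
    unfolding gt_coeff_def
  proof (rule prod.cong[OF refl])
    fix j assume "j \<in> {1..Suc s}"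
    then have "{1..j} = insert 1 {2..j}" by auto
    then show "(\<Prod>i\<in>{1..j}. gt_factor n v g (Suc s) ?c i j) = gt_factor n v g (Suc s) ?c 1 j * (\<Prod>i\<in>{2..j}. gt_factor n v g (Suc s) ?c i j)"
      by simp
  qed
  also have "\<dots> = (\<Prod>j\<in>{1..Suc s}. gt_factor n v g (Suc s) ?c 1 j) * (\<Prod>j\<in>{1..Suc s}. \<Prod>i\<in>{2..j}. gt_factor n v g (Suc s) ?c i j)"
    by (rule prod.distrib)
  also have "(\<Prod>j\<in>{1..Suc s}. gt_factor n v g (Suc s) ?c 1 j) = (\<Prod>j\<in>{1..Suc s}. row_factor \<kappa> (Suc s) 0 b j)"
    by (rule prod.cong[OF refl fac1])
  also have "(\<Prod>j\<in>{1..Suc s}. \<Prod>i\<in>{2..j}. gt_factor n v g (Suc s) ?c i j) = (\<Prod>j\<in>{0..s}. \<Prod>i\<in>{2..Suc j}. gt_factor n v g (Suc s) ?c i (Suc j))"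
    using prod.shift_bounds_cl_Suc_ivl[of "\<lambda>j. \<Prod>i\<in>{2..j}. gt_factor n v g (Suc s) ?c i j" 0 s] by simp
  \<comment> \<open>The shifted column 0 contributes the empty product over {2..1}.\<close>
  also have "\<dots> = (\<Prod>j\<in>{1..s}. \<Prod>i\<in>{2..Suc j}. gt_factor n v g (Suc s) ?c i (Suc j))"
  proof -
    have "{0..s} = insert 0 {1..s}" by auto
    then show ?thesis by simp
  qed
  also have "\<dots> = gt_coeff n v g s a"
    unfolding gt_coeff_def
  proof (rule prod.cong[OF refl])
    fix j assume j: "j \<in> {1..s}"
    have "(\<Prod>i\<in>{2..Suc j}. gt_factor n v g (Suc s) ?c i (Suc j)) = (\<Prod>i\<in>{1..j}. gt_factor n v g (Suc s) ?c (Suc i) (Suc j))"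
      using prod.shift_bounds_cl_Suc_ivl[of "\<lambda>i. gt_factor n v g (Suc s) ?c i (Suc j)" 1 j] by (simp add: numeral_2_eq_2)
    also have "\<dots> = (\<Prod>i\<in>{1..j}. gt_factor n v g s a i j)"
      by (rule prod.cong[OF refl]) (use j fac in auto)
    finally show "(\<Prod>i\<in>{2..Suc j}. gt_factor n v g (Suc s) ?c i (Suc j)) = (\<Prod>i\<in>{1..j}. gt_factor n v g s a i j)" .
  qed
  finally show ?thesis .
qed

text \<open>At a tie the entry below is pinned between equal neighbours, which is the vanishing case
  of the factor. This is the counterpart of \<open>symm_equal\<close>.\<close>

lemma gt_coeff_equal:
  assumes a: "a \<in> gt_patterns s \<kappa>" and j: "j \<in> {1..s}" "\<kappa> (j + 1) = \<kappa> j"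
  shows "gt_coeff n v g s a = 0"
proof -
  have "a 0 j = \<kappa> (j + 1)" "a 0 (j - 1) = \<kappa> j" using a j by (auto simp: gt_patterns_def)
  moreover have "a 1 j \<le> a 0 (j - 1) \<and> a 0 j \<le> a 1 j" 
  proof -
    have "1 \<le> (1::nat) \<and> 1 \<le> j \<and> j \<le> s" using j by auto
    then have "a 1 j \<le> a (1 - 1) (j - 1) \<and> a (1 - 1) j \<le> a 1 j" using a unfolding gt_patterns_def by blast
    then show ?thesis by simp
  qed
  ultimately have "gt_factor n v g s a 1 j = 0" using j(2) by (simp add: gt_factor_def)
  then have "(\<Prod>i = 1..j. gt_factor n v g s a i j) = 0" using j by (intro prod_zero) auto
  then show ?thesis unfolding gt_coeff_def using j by (intro prod_zero) auto
qed

text \<open>Beyond the first s + 1 variables the exponents of \<nu> are kept, because the induction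
  applies the statement of rank s to monomials in more variables.\<close>

definition gt_exp :: "nat \<Rightarrow> (nat \<Rightarrow> nat \<Rightarrow> int) \<Rightarrow> (nat \<Rightarrow> int) \<Rightarrow> nat \<Rightarrow> int" where
  "gt_exp s a \<nu> = (\<lambda>i. if i \<in> {1..s + 1} then gt_weight s a i else \<nu> i)"

lemma gt_exp_cons:
  assumes b: "b \<in> rows (Suc s) \<kappa>" and a: "a \<in> gt_patterns s b"
    and \<nu>: "\<And>i. i \<in> {1..s+2} \<Longrightarrow> \<nu> i = \<kappa> (s + 3 - i)"
  shows "gt_exp (Suc s) (gt_cons (Suc s) \<kappa> a) \<nu> = gt_exp s a (row_exp (Suc s) 0 b \<nu>)"
proof
  fix i
  let ?c = "gt_cons (Suc s) \<kappa> a"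
  have rowsum: "gt_rowsum (Suc s) ?c (Suc i) = gt_rowsum s a i" for i
    unfolding gt_rowsum_def by (subst sum.shift_bounds_cl_Suc_ivl) simp
  consider "i \<in> {1..s+1}" | "i = s + 2" | "i = 0 \<or> i > s + 2" by force
  then show "gt_exp (Suc s) ?c \<nu> i = gt_exp s a (row_exp (Suc s) 0 b \<nu>) i"
  proof cases
    case 1
    then have "Suc s + 1 - i = Suc (s + 1 - i)" "Suc s + 2 - i = Suc (s + 2 - i)" by auto
    then show ?thesis using 1 by (simp add: gt_exp_def gt_weight_def rowsum del: One_nat_def Suc_eq_plus1)
  next
    case 2
    have "gt_rowsum (Suc s) ?c 0 = (\<Sum>j = 0..Suc s. \<kappa> (j + 1))" by (simp add: gt_rowsum_def)
    also have "\<dots> = (\<Sum>i\<in>{1..s+2}. \<nu> i)"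
      by (rule sum.reindex_bij_witness[of _ "\<lambda>i. s + 2 - i" "\<lambda>j. s + 2 - j"]) (auto simp: \<nu> Suc_diff_le eval_nat_numeral)
    finally have "gt_rowsum (Suc s) ?c 0 = (\<Sum>i\<in>{1..s+2}. \<nu> i)" .
    moreover have "gt_rowsum s a 0 = (\<Sum>j = 0..s. b (Suc j))"
      unfolding gt_rowsum_def by (rule sum.cong[OF refl]) (use a in \<open>auto simp: gt_patterns_def\<close>)
    then have "gt_rowsum (Suc s) ?c 1 = (\<Sum>j\<in>{1..Suc s}. b j)"
      using rowsum[of 0] sum.shift_bounds_cl_Suc_ivl[of b 0 s] by simp
    ultimately show ?thesis using 2 by (simp add: gt_exp_def gt_weight_def row_exp_def)
  next
    case 3
    then show ?thesis by (auto simp: gt_exp_def row_exp_def)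
  qed
qed

text \<open>The hypothesis on \<kappa> is weak, as it must hold again for each second row. Without
  ties \<open>symm_Suc_rowB\<close> splits off one row; a tie makes both sides zero.\<close>

theorem symm_gt_patterns:
  assumes "\<And>j. j \<in> {1..s} \<Longrightarrow> \<kappa> (j + 1) \<le> \<kappa> j"
    and "\<And>i. i \<in> {1..s+1} \<Longrightarrow> \<nu> i = \<kappa> (s + 2 - i)"
  shows "symm s (lmon \<nu>) = (\<Sum>a\<in>gt_patterns s \<kappa>. lconst (gt_coeff n v g s a) * lmon (gt_exp s a \<nu>))"
  using assms
proof (induction s arbitrary: \<kappa> \<nu>)
  case 0
  have "{u. u permutes {1..0 + (1::nat)}} = {id}" by simp
  moreover have "inv_reduced 0 id []" by (simp add: inv_reduced_def)
  ultimately have "symm 0 (lmon \<nu>) = lmon \<nu>" by (simp add: symm_def perm_op_eq del: id_apply)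
  moreover have "gt_exp 0 (\<lambda>i j. if i = 0 \<and> j = 0 then \<kappa> 1 else 0) \<nu> = \<nu>"
    using 0(2)[of 1] by (auto simp: gt_exp_def gt_weight_def gt_rowsum_def fun_eq_iff)
  ultimately show ?case by (simp add: gt_patterns_0 gt_coeff_def)
next
  case (Suc s)
  show ?case
  proof (cases "\<exists>j\<in>{1..Suc s}. \<kappa> (j + 1) = \<kappa> j")
    case True
    then obtain j where j: "j \<in> {1..Suc s}" "\<kappa> (j + 1) = \<kappa> j" by blast
    have "symm (Suc s) (lmon \<nu>) = 0"
    proof (rule symm_equal)
      \<comment> \<open>\<nu> is \<kappa> reversed, so the tie at j, j + 1 sits at the positions s +
        2 - j and s + 3 - j.\<close>
      show "Suc s + 1 - j \<in> {1..Suc s}" using j by auto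
      have "s + 3 - (Suc s + 1 - j) = j + 1" "s + 3 - (Suc s + 1 - j + 1) = j" using j by auto
      then show "\<nu> (Suc s + 1 - j + 1) = \<nu> (Suc s + 1 - j)"
        using Suc.prems(2)[of "Suc s + 1 - j"] Suc.prems(2)[of "Suc s + 1 - j + 1"] j by auto
    qed
    moreover have "gt_coeff n v g (Suc s) a = 0" if "a \<in> gt_patterns (Suc s) \<kappa>" for a
      by (rule gt_coeff_equal[OF that j])
    ultimately show ?thesis by simp
  next
    case False
    have lt: "\<kappa> (j + 1) < \<kappa> j" if "j \<in> {1..Suc s}" for j
    proof -
      have "\<kappa> (j + 1) \<noteq> \<kappa> j" using False that by blast
      then show ?thesis using Suc.prems(1)[OF that] by linarith
    qed
    have \<nu>: "\<nu> i = \<kappa> (s + 3 - i)" if "i \<in> {1..s+2}" for i using Suc.prems(2)[of i] that by (simp add: eval_nat_numeral)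
    have "\<nu> i < \<nu> (i + 1)" if "i \<in> {1..Suc s}" for i
    proof -
      have "s + 3 - i = (s + 2 - i) + 1" "s + 3 - (i + 1) = s + 2 - i" "s + 2 - i \<in> {1..Suc s}"
        "i \<in> {1..s+2}" "i + 1 \<in> {1..s+2}" using that by auto
      then show ?thesis using lt[of "s + 2 - i"] \<nu>[of i] \<nu>[of "i+1"] by metis
    qed
    then have "symm (Suc s) (lmon \<nu>) = symm s (rowB (Suc s) 0 0 \<nu>)" by (rule symm_Suc_rowB)
    also have "rowB (Suc s) 0 0 \<nu> = (\<Sum>b\<in>rows (Suc s) \<kappa>. lconst (\<Prod>j\<in>{1..Suc s}. row_factor \<kappa> (Suc s) 0 b j) * lmon (row_exp (Suc s) 0 b \<nu>))"
    proof (rule rowB_expand)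
      show "\<nu> (Suc 0) = \<kappa> (Suc s + 1) - 0" using \<nu>[of 1] by (simp add: eval_nat_numeral)
      show "\<nu> (Suc 0 + t) = \<kappa> (Suc s + 1 - t)" if "t \<in> {1..Suc s}" for t
        using \<nu>[of "Suc t"] that by (simp add: eval_nat_numeral)
    qed (rule lt)
    also have "symm s \<dots> = (\<Sum>b\<in>rows (Suc s) \<kappa>. \<Sum>a\<in>gt_patterns s b.
        lconst (gt_coeff n v g (Suc s) (gt_cons (Suc s) \<kappa> a)) * lmon (gt_exp (Suc s) (gt_cons (Suc s) \<kappa> a) \<nu>))"
      unfolding symm_sum symm_lconst
    proof (rule sum.cong[OF refl])
      fix b assume b: "b \<in> rows (Suc s) \<kappa>"
      have 3: "\<kappa> (j + 1) \<le> b j \<and> b j \<le> \<kappa> j" if "j \<in> {1..Suc s}" for j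
        using PiE_mem[OF b[unfolded rows_def] that] by simp
      have "symm s (lmon (row_exp (Suc s) 0 b \<nu>)) =
          (\<Sum>a\<in>gt_patterns s b. lconst (gt_coeff n v g s a) * lmon (gt_exp s a (row_exp (Suc s) 0 b \<nu>)))"
      proof (rule Suc.IH)
        show "b (j + 1) \<le> b j" if "j \<in> {1..s}" for j using 3[of j] 3[of "j+1"] that by auto
        show "row_exp (Suc s) 0 b \<nu> i = b (s + 2 - i)" if "i \<in> {1..s+1}" for i
          using that by (auto simp: row_exp_def)
      qed
      then show "lconst (\<Prod>j\<in>{1..Suc s}. row_factor \<kappa> (Suc s) 0 b j) * symm s (lmon (row_exp (Suc s) 0 b \<nu>)) =
        (\<Sum>a\<in>gt_patterns s b. lconst (gt_coeff n v g (Suc s) (gt_cons (Suc s) \<kappa> a)) * lmon (gt_exp (Suc s) (gt_cons (Suc s) \<kappa> a) \<nu>))"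
      proof (simp only: sum_distrib_left, intro sum.cong[OF refl])
        fix a assume a: "a \<in> gt_patterns s b"
        have 1: "gt_coeff n v g (Suc s) (gt_cons (Suc s) \<kappa> a) =
            (\<Prod>j\<in>{1..Suc s}. row_factor \<kappa> (Suc s) 0 b j) * gt_coeff n v g s a"
          by (rule gt_coeff_cons[OF b a]) (rule lt)
        have 2: "gt_exp (Suc s) (gt_cons (Suc s) \<kappa> a) \<nu> = gt_exp s a (row_exp (Suc s) 0 b \<nu>)"
          by (rule gt_exp_cons[OF b a]) (rule \<nu>)
        show "lconst (\<Prod>j\<in>{1..Suc s}. row_factor \<kappa> (Suc s) 0 b j) * (lconst (gt_coeff n v g s a) * lmon (gt_exp s a (row_exp (Suc s) 0 b \<nu>)))
            = lconst (gt_coeff n v g (Suc s) (gt_cons (Suc s) \<kappa> a)) * lmon (gt_exp (Suc s) (gt_cons (Suc s) \<kappa> a) \<nu>)"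
          by (simp only: 1 2 lconst_mult mult.assoc)
      qed
    qed
    also have "\<dots> = (\<Sum>a\<in>gt_patterns (Suc s) \<kappa>. lconst (gt_coeff n v g (Suc s) a) * lmon (gt_exp (Suc s) a \<nu>))"
      by (rule sum_gt_patterns_Suc[symmetric])
    finally show ?thesis .
  qed
qed

end

section \<open>Automorphisms of the field of rational functions\<close>

definition mon_eval :: "(nat \<Rightarrow> 'b::comm_monoid_mult) \<Rightarrow> (nat \<Rightarrow>\<^sub>0 nat) \<Rightarrow> 'b" where
  "mon_eval s m = (\<Prod>i\<in>Poly_Mapping.keys m. s i ^ Poly_Mapping.lookup m i)"

lemma mon_eval_superset:
  assumes "finite K" "Poly_Mapping.keys m \<subseteq> K"
  shows "mon_eval s m = (\<Prod>i\<in>K. s i ^ Poly_Mapping.lookup m i)"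
  unfolding mon_eval_def using assms by (intro prod.mono_neutral_left) (auto simp: in_keys_iff)

lemma mon_eval_add: "mon_eval s (m + m') = mon_eval s m * mon_eval s m'"
proof -
  let ?K = "Poly_Mapping.keys m \<union> Poly_Mapping.keys m'"
  have K: "finite ?K" "Poly_Mapping.keys (m + m') \<subseteq> ?K" "Poly_Mapping.keys m \<subseteq> ?K" "Poly_Mapping.keys m' \<subseteq> ?K"
    using Poly_Mapping.keys_add[of m m'] by auto
  show ?thesis
    unfolding mon_eval_superset[OF K(1,2)] mon_eval_superset[OF K(1,3)] mon_eval_superset[OF K(1,4)]
    by (simp add: lookup_add power_add prod.distrib)
qed

lemma mon_eval_single: "mon_eval s (Poly_Mapping.single i k) = s i ^ k"
  by (cases "k = 0") (simp_all add: mon_eval_def)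

abbreviation pconst :: "complex \<Rightarrow> cpoly" where "pconst c \<equiv> Poly_Mapping.single 0 c"
abbreviation pvar :: "nat \<Rightarrow> cpoly" where "pvar i \<equiv> Poly_Mapping.single (Poly_Mapping.single i 1) 1"

text \<open>The coefficient map \<kappa> lets one evaluation serve both polynomial values
  (\<open>pconst\<close>) and values in the field of fractions (\<open>rconst\<close>).\<close>

definition peval :: "(complex \<Rightarrow> 'b::comm_ring_1) \<Rightarrow> (nat \<Rightarrow> 'b) \<Rightarrow> cpoly \<Rightarrow> 'b" where
  "peval \<kappa> s a = (\<Sum>m\<in>Poly_Mapping.keys a. \<kappa> (Poly_Mapping.lookup a m) * mon_eval s m)"

locale complex_hom =
  fixes \<kappa> :: "complex \<Rightarrow> 'b::comm_ring_1"
  assumes hom_add: "\<kappa> (a + b) = \<kappa> a + \<kappa> b" and hom_mult: "\<kappa> (a * b) = \<kappa> a * \<kappa> b" and hom_1: "\<kappa> 1 = 1"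
begin

lemma hom_0: "\<kappa> 0 = 0"
  using hom_add[of 0 0] by simp

lemma peval_single: "peval \<kappa> s (Poly_Mapping.single m c) = \<kappa> c * mon_eval s m"
  by (cases "c = 0") (simp_all add: peval_def hom_0)

lemma peval_add: "peval \<kappa> s (a + b) = peval \<kappa> s a + peval \<kappa> s b"
  unfolding peval_def by (rule setsum_keys_plus_distrib) (simp_all add: hom_0 hom_add distrib_right)

lemma peval_mult: "peval \<kappa> s (a * b) = peval \<kappa> s a * peval \<kappa> s b"
proof (induction a rule: poly_mapping_single_induct)
  case (single m c)
  show ?case
    by (induction b rule: poly_mapping_single_induct)
      (simp_all add: mult_single peval_single hom_mult mon_eval_add distrib_left peval_add)
qed (simp add: distrib_right peval_add)

lemma peval_pconst: "peval \<kappa> s (pconst c) = \<kappa> c"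
  by (simp add: peval_single mon_eval_def)

lemma peval_pvar: "peval \<kappa> s (pvar i) = s i"
  by (simp add: peval_single hom_1 mon_eval_single)

end

lemma cpoly_hom_unique:
  fixes F G :: "cpoly \<Rightarrow> 'b::comm_ring_1"
  assumes F: "\<And>a b. F (a + b) = F a + F b" "\<And>a b. F (a * b) = F a * F b"
    and G: "\<And>a b. G (a + b) = G a + G b" "\<And>a b. G (a * b) = G a * G b"
    and c: "\<And>c. F (pconst c) = G (pconst c)" and x: "\<And>i. F (pvar i) = G (pvar i)"
  shows "F a = G a"
proof (induction a rule: poly_mapping_single_induct)
  case (single m c)
  have one: "F 1 = G 1" using c[of 1] by simp
  have "F (Poly_Mapping.single m 1) = G (Poly_Mapping.single m 1)"
  proof (induction m rule: poly_mapping_single_induct)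
    case (single i k)
    show ?case
    proof (induction k)
      case 0
      then show ?case using one by simp
    next
      case (Suc k)
      have "Poly_Mapping.single (Poly_Mapping.single i (Suc k)) 1 = pvar i * Poly_Mapping.single (Poly_Mapping.single i k) (1::complex)"
        by (simp add: mult_single flip: single_add)
      then show ?case using Suc x F(2) G(2) by simp
    qed
  next
    case (add p q)
    have "Poly_Mapping.single (p + q) 1 = Poly_Mapping.single p 1 * Poly_Mapping.single q (1::complex)"
      by (simp add: mult_single)
    then show ?case using add F(2) G(2) by simp
  qed
  moreover have "Poly_Mapping.single m c = pconst c * Poly_Mapping.single m 1" by (simp add: mult_single)
  ultimately show ?case using c F(2) G(2) by simp
qed (simp add: F G)

definition to_fract :: "'a::idom \<Rightarrow> 'a fract" where "to_fract a = Fraction_Field.Fract a 1"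

lemma rconst_to_fract: "rconst c = to_fract (pconst c)" and rvar_to_fract: "rvar i = to_fract (pvar i)"
  by (simp_all add: to_fract_def rconst_def rvar_def)

lemma to_fract_add: "to_fract (a + b) = to_fract a + to_fract b"
  and to_fract_mult: "to_fract (a * b) = to_fract a * to_fract b"
  and to_fract_0: "to_fract 0 = 0" and to_fract_1: "to_fract 1 = 1"
  and to_fract_eq_0: "to_fract a = 0 \<longleftrightarrow> a = 0"
  by (simp_all add: to_fract_def Zero_fract_def One_fract_def eq_fract)

lemma Fract_to_fract: "Fraction_Field.Fract a b = to_fract a / to_fract b"
  by (cases "b = 0") (simp_all add: to_fract_def fract_collapse)

lemma single_eq_zero_iff: "Poly_Mapping.single m a = 0 \<longleftrightarrow> a = 0"
  by (metis lookup_single_eq lookup_zero single_zero)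

lemma rconst_add: "rconst (a + b) = rconst a + rconst b"
  and rconst_mult: "rconst (a * b) = rconst a * rconst b"
  and rconst_1 [simp]: "rconst 1 = 1" and rconst_0 [simp]: "rconst 0 = 0"
  and rconst_eq_0 [simp]: "rconst a = 0 \<longleftrightarrow> a = 0"
  by (simp_all add: rconst_to_fract single_add single_eq_zero_iff to_fract_0 to_fract_1 to_fract_eq_0 mult_single flip: to_fract_add to_fract_mult)

lemma rconst_uminus: "rconst (- a) = - rconst a"
  using rconst_add[of a "-a"] by (simp add: add_eq_0_iff)

lemma rconst_diff: "rconst (a - b) = rconst a - rconst b"
  using rconst_add[of a "-b"] by (simp add: rconst_uminus)

lemma rconst_power: "rconst (a ^ k) = rconst a ^ k"
  by (induction k) (simp_all add: rconst_mult)

lemma rconst_inverse: "rconst (inverse a) = inverse (rconst a)"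
  by (cases "a = 0") (simp_all add: rconst_mult[symmetric] inverse_unique[symmetric])

lemma rconst_powi: "rconst (a powi k) = rconst a powi k"
  by (simp add: power_int_def rconst_power rconst_inverse)

lemma rconst_sum: "rconst (sum f A) = (\<Sum>a\<in>A. rconst (f a))"
  by (induction A rule: infinite_finite_induct) (simp_all add: rconst_add)

lemma rconst_prod: "rconst (prod f A) = (\<Prod>a\<in>A. rconst (f a))"
  by (induction A rule: infinite_finite_induct) (simp_all add: rconst_mult)

lemma rvar_nz [simp]: "rvar i \<noteq> 0"
  by (simp add: rvar_to_fract to_fract_eq_0 single_eq_zero_iff)

text \<open>Field endomorphisms over the complex numbers. They are determined by the images of the
  variables, so identities between the actions are checked on \<open>rvar\<close>.\<close>

definition rat_hom :: "(ratfun \<Rightarrow> ratfun) \<Rightarrow> bool" where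
  "rat_hom \<phi> \<longleftrightarrow> (\<forall>f h. \<phi> (f + h) = \<phi> f + \<phi> h) \<and> (\<forall>f h. \<phi> (f * h) = \<phi> f * \<phi> h) \<and> (\<forall>c. \<phi> (rconst c) = rconst c)"

lemma rat_homD:
  assumes "rat_hom \<phi>"
  shows "\<phi> (f + h) = \<phi> f + \<phi> h" "\<phi> (f * h) = \<phi> f * \<phi> h" "\<phi> (rconst c) = rconst c" "\<phi> 0 = 0" "\<phi> 1 = 1"
    "\<phi> (inverse f) = inverse (\<phi> f)" "\<phi> (f / h) = \<phi> f / \<phi> h"
proof -
  show a: "\<phi> (f + h) = \<phi> f + \<phi> h" "\<phi> (f * h) = \<phi> f * \<phi> h" "\<phi> (rconst c) = rconst c" for f h c
    using assms by (auto simp: rat_hom_def)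
  show b: "\<phi> 0 = 0" "\<phi> 1 = 1" using a(3)[of 0] a(3)[of 1] by simp_all
  show c: "\<phi> (inverse f) = inverse (\<phi> f)" for f
  proof (cases "f = 0")
    case False
    then have "\<phi> f * \<phi> (inverse f) = 1" using a(2)[of f "inverse f"] b by simp
    then show ?thesis by (rule inverse_unique[symmetric])
  qed (simp add: b)
  show "\<phi> (f / h) = \<phi> f / \<phi> h" by (simp add: divide_inverse a c)
qed

lemma rat_hom_power: "rat_hom \<phi> \<Longrightarrow> \<phi> (f ^ k) = \<phi> f ^ k"
  by (induction k) (simp_all add: rat_homD)

lemma rat_hom_powi: "rat_hom \<phi> \<Longrightarrow> \<phi> (f powi k) = \<phi> f powi k"
  by (simp add: power_int_def rat_hom_power rat_homD)

lemma rat_hom_sum: "rat_hom \<phi> \<Longrightarrow> \<phi> (sum f A) = (\<Sum>a\<in>A. \<phi> (f a))"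
  by (induction A rule: infinite_finite_induct) (simp_all add: rat_homD)

lemma rat_hom_prod: "rat_hom \<phi> \<Longrightarrow> \<phi> (prod f A) = (\<Prod>a\<in>A. \<phi> (f a))"
  by (induction A rule: infinite_finite_induct) (simp_all add: rat_homD)

lemma rat_hom_id: "rat_hom id" and rat_hom_comp: "rat_hom \<phi> \<Longrightarrow> rat_hom \<chi> \<Longrightarrow> rat_hom (\<phi> \<circ> \<chi>)"
  by (simp_all add: rat_hom_def)

lemma rat_hom_funpow: "rat_hom \<phi> \<Longrightarrow> rat_hom (\<phi> ^^ k)"
  by (induction k) (simp_all add: rat_hom_id rat_hom_comp)

lemma rat_hom_unique:
  assumes "rat_hom \<phi>" "rat_hom \<chi>" "\<And>i. \<phi> (rvar i) = \<chi> (rvar i)"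
  shows "\<phi> = \<chi>"
proof
  fix f
  note P = rat_homD[OF assms(1)] and X = rat_homD[OF assms(2)]
  have eq: "\<phi> (to_fract a) = \<chi> (to_fract a)" for a
  proof (rule cpoly_hom_unique[of "\<lambda>a. \<phi> (to_fract a)" "\<lambda>a. \<chi> (to_fract a)"])
    show "\<phi> (to_fract (pconst c)) = \<chi> (to_fract (pconst c))" for c
      using P(3)[of c] X(3)[of c] by (simp only: rconst_to_fract)
    show "\<phi> (to_fract (pvar i)) = \<chi> (to_fract (pvar i))" for i
      using assms(3)[of i] by (simp only: rvar_to_fract)
  qed (simp_all only: to_fract_add to_fract_mult P(1,2) X(1,2))
  show "\<phi> f = \<chi> f"
    by (cases f) (simp only: Fract_to_fract P(7) X(7) eq)
qed

text \<open>Permutations of the variables and twists by characters are both of the form x_i to c_i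
  x_{w i}.\<close>

definition scale_perm :: "(nat \<Rightarrow> complex) \<Rightarrow> (nat \<Rightarrow> nat) \<Rightarrow> ratfun \<Rightarrow> ratfun" where
  "scale_perm c w = ratfun_subst (\<lambda>i. rconst (c i) * rvar (w i))"

definition pscale_perm :: "(nat \<Rightarrow> complex) \<Rightarrow> (nat \<Rightarrow> nat) \<Rightarrow> cpoly \<Rightarrow> cpoly" where
  "pscale_perm c w = peval pconst (\<lambda>i. pconst (c i) * pvar (w i))"

interpretation pconst: complex_hom pconst
  by unfold_locales (simp_all add: single_add mult_single)

interpretation rconst: complex_hom rconst
  by unfold_locales (simp_all add: rconst_add rconst_mult)

text \<open>The inverse substitution shows that nonzero denominators stay nonzero, which is what
  makes \<open>ratfun_subst\<close> well defined on fractions.\<close>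

lemma pscale_perm_inverse:
  assumes "\<And>i. c i \<noteq> 0" "bij w"
  shows "pscale_perm (\<lambda>i. 1 / c (inv_into UNIV w i)) (inv_into UNIV w) (pscale_perm c w a) = a"
proof (rule cpoly_hom_unique[of _ "\<lambda>a. a"])
  note ev = pscale_perm_def pconst.peval_add pconst.peval_mult pconst.peval_pconst pconst.peval_pvar
  show "pscale_perm (\<lambda>i. 1 / c (inv_into UNIV w i)) (inv_into UNIV w) (pscale_perm c w (pvar i)) = pvar i" for i
    unfolding ev using assms by (simp add: bij_is_inj mult_single)
qed (simp_all only: pscale_perm_def pconst.peval_add pconst.peval_mult pconst.peval_pconst)

lemma poly_subst_scale_perm:
  "poly_subst (\<lambda>i. rconst (c i) * rvar (w i)) a = to_fract (pscale_perm c w a)"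
proof -
  have "poly_subst (\<lambda>i. rconst (c i) * rvar (w i)) a = peval rconst (\<lambda>i. rconst (c i) * rvar (w i)) a"
    by (simp add: poly_subst_def peval_def mon_eval_def)
  also have "\<dots> = to_fract (pscale_perm c w a)"
    by (rule cpoly_hom_unique[of _ "\<lambda>a. to_fract (pscale_perm c w a)"])
      (simp_all only: pscale_perm_def rconst.peval_add rconst.peval_mult rconst.peval_pconst rconst.peval_pvar
        pconst.peval_add pconst.peval_mult pconst.peval_pconst pconst.peval_pvar to_fract_add to_fract_mult, simp_all add: rconst_to_fract rvar_to_fract)
  finally show ?thesis .
qed

lemma scale_perm_Fract:
  assumes "\<And>i. c i \<noteq> 0" "bij w" "b \<noteq> 0"
  shows "scale_perm c w (Fraction_Field.Fract a b) = to_fract (pscale_perm c w a) / to_fract (pscale_perm c w b)"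
    and "pscale_perm c w b \<noteq> 0"
proof -
  have add: "pscale_perm c w (a + b) = pscale_perm c w a + pscale_perm c w b"
    and mult: "pscale_perm c w (a * b) = pscale_perm c w a * pscale_perm c w b" for a b
    by (simp_all add: pscale_perm_def pconst.peval_add pconst.peval_mult)
  have z: "pscale_perm c w 0 = 0" for c w by (simp add: pscale_perm_def peval_def)
  have nz: "pscale_perm c w b \<noteq> 0 \<longleftrightarrow> b \<noteq> 0" for b
  proof -
    have "b = 0" if "pscale_perm c w b = 0"
    proof -
      have "pscale_perm (\<lambda>i. 1 / c (inv_into UNIV w i)) (inv_into UNIV w) (pscale_perm c w b) = b"
        by (rule pscale_perm_inverse[OF assms(1,2)])
      then show "b = 0" unfolding that z by simp
    qed
    then show ?thesis using z[of c w] by auto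
  qed
  show "pscale_perm c w b \<noteq> 0" using assms nz by simp
  show "scale_perm c w (Fraction_Field.Fract a b) = to_fract (pscale_perm c w a) / to_fract (pscale_perm c w b)"
    unfolding scale_perm_def ratfun_subst_def poly_subst_scale_perm
  proof (rule the_equality)
    show "\<exists>a' b'. Fraction_Field.Fract a b = Fraction_Field.Fract a' b' \<and> to_fract (pscale_perm c w b') \<noteq> 0 \<and>
        to_fract (pscale_perm c w a) / to_fract (pscale_perm c w b) = to_fract (pscale_perm c w a') / to_fract (pscale_perm c w b')"
      using nz assms(3) by (auto simp: to_fract_eq_0)
  next
    fix h assume "\<exists>a' b'. Fraction_Field.Fract a b = Fraction_Field.Fract a' b' \<and> to_fract (pscale_perm c w b') \<noteq> 0 \<and>
        h = to_fract (pscale_perm c w a') / to_fract (pscale_perm c w b')"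
    then obtain a' b' where *: "Fraction_Field.Fract a b = Fraction_Field.Fract a' b'" "b' \<noteq> 0"
      "h = to_fract (pscale_perm c w a') / to_fract (pscale_perm c w b')" using nz by (auto simp: to_fract_eq_0)
    then have "a * b' = a' * b" using assms(3) by (simp add: eq_fract)
    then have "pscale_perm c w a * pscale_perm c w b' = pscale_perm c w a' * pscale_perm c w b" by (simp flip: mult)
    then show "h = to_fract (pscale_perm c w a) / to_fract (pscale_perm c w b)"
      unfolding *(3) using nz[of b] nz[of b'] assms(3) *(2) by (simp add: eq_fract flip: Fract_to_fract)
  qed
qed

lemma rat_hom_scale_perm:
  assumes "\<And>i. c i \<noteq> 0" "bij w"
  shows "rat_hom (scale_perm c w)" and "scale_perm c w (rvar i) = rconst (c i) * rvar (w i)"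
proof -
  have add: "pscale_perm c w (a + b) = pscale_perm c w a + pscale_perm c w b"
    and mult: "pscale_perm c w (a * b) = pscale_perm c w a * pscale_perm c w b" for a b
    by (simp_all add: pscale_perm_def pconst.peval_add pconst.peval_mult)
  have const: "pscale_perm c w (pconst d) = pconst d" for d
    by (simp add: pscale_perm_def pconst.peval_pconst)
  have one: "pscale_perm c w 1 = 1" using const[of 1] by simp
  have Fr1: "scale_perm c w (Fraction_Field.Fract a b) = to_fract (pscale_perm c w a) / to_fract (pscale_perm c w b)"
    and Fr2: "pscale_perm c w b \<noteq> 0" if "b \<noteq> 0" for a b
    using scale_perm_Fract(1)[of c w b a] scale_perm_Fract(2)[of c w b] assms that by auto
  have "scale_perm c w (f + h) = scale_perm c w f + scale_perm c w h" for f h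
  proof (cases f, cases h)
    fix a b a' b' assume "f = Fraction_Field.Fract a b" "b \<noteq> 0" "h = Fraction_Field.Fract a' b'" "b' \<noteq> 0"
    then show ?thesis using Fr2[of b] Fr2[of b']
      by (simp add: Fr1 add mult to_fract_add to_fract_mult to_fract_eq_0 field_simps)
  qed
  moreover have "scale_perm c w (f * h) = scale_perm c w f * scale_perm c w h" for f h
  proof (cases f, cases h)
    fix a b a' b' assume "f = Fraction_Field.Fract a b" "b \<noteq> 0" "h = Fraction_Field.Fract a' b'" "b' \<noteq> 0"
    then show ?thesis using Fr2[of b] Fr2[of b']
      by (simp add: Fr1 mult to_fract_mult to_fract_eq_0 field_simps)
  qed
  moreover have "scale_perm c w (rconst d) = rconst d" for d
    using Fr1[of 1 "pconst d"] by (simp add: rconst_to_fract const one to_fract_1 flip: to_fract_def)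
  ultimately show "rat_hom (scale_perm c w)" by (simp add: rat_hom_def)
  show "scale_perm c w (rvar i) = rconst (c i) * rvar (w i)"
  proof -
    have p: "pscale_perm c w (pvar i) = pconst (c i) * pvar (w i)"
      by (simp only: pscale_perm_def pconst.peval_pvar)
    show ?thesis
      using Fr1[of 1 "pvar i", OF one_neq_zero]
      by (simp only: rvar_to_fract to_fract_def[symmetric] one p to_fract_1 div_by_1 rconst_to_fract to_fract_mult)
  qed
qed

lemma perm_act_scale_perm: "perm_act w = scale_perm (\<lambda>_. 1) w"
  by (simp add: perm_act_def scale_perm_def)

lemma char_act_scale_perm: "char_act r \<xi> = scale_perm (\<lambda>i. if i \<in> {1..r+1} then \<xi> (unit_weight i) else 1) id"
  unfolding char_act_def scale_perm_def by (rule arg_cong[where f = ratfun_subst]) auto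

section \<open>Rational functions in x_1, ..., x_{r+1} and diagonal scalings\<close>

definition poly_field :: "nat \<Rightarrow> cpoly set" where
  "poly_field r = {a. poly_vars a \<subseteq> {1..r+1}}"

lemma poly_field_add: "a \<in> poly_field r \<Longrightarrow> b \<in> poly_field r \<Longrightarrow> a + b \<in> poly_field r"
  using Poly_Mapping.keys_add[of a b] by (fastforce simp: poly_field_def poly_vars_def)

lemma poly_field_mult:
  assumes "a \<in> poly_field r" "b \<in> poly_field r"
  shows "a * b \<in> poly_field r"
  unfolding poly_field_def poly_vars_def
proof (rule CollectI, rule UN_least)
  fix m assume "m \<in> Poly_Mapping.keys (a * b)"
  then obtain p q where m: "m = p + q" "p \<in> Poly_Mapping.keys a" "q \<in> Poly_Mapping.keys b"
    using keys_mult[of a b] by auto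
  then show "Poly_Mapping.keys m \<subseteq> {1..r+1}"
    using assms Poly_Mapping.keys_add[of p q] by (fastforce simp: poly_field_def poly_vars_def)
qed

lemma poly_field_pconst: "pconst c \<in> poly_field r"
  and poly_field_pvar: "i \<in> {1..r+1} \<Longrightarrow> pvar i \<in> poly_field r"
  by (auto simp: poly_field_def poly_vars_def)

lemma poly_field_1: "1 \<in> poly_field r"
  using poly_field_pconst[of 1 r] by simp

lemma poly_field_power: "a \<in> poly_field r \<Longrightarrow> a ^ k \<in> poly_field r"
  by (induction k) (simp_all add: poly_field_1 poly_field_mult)

lemma poly_field_sum: "(\<And>x. x \<in> A \<Longrightarrow> f x \<in> poly_field r) \<Longrightarrow> sum f A \<in> poly_field r"
  by (induction A rule: infinite_finite_induct) (simp_all add: poly_field_add, simp_all add: poly_field_def poly_vars_def)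

lemma poly_field_prod: "(\<And>x. x \<in> A \<Longrightarrow> f x \<in> poly_field r) \<Longrightarrow> prod f A \<in> poly_field r"
  by (induction A rule: infinite_finite_induct) (simp_all add: poly_field_mult poly_field_1)

lemma poly_field_pscale:
  assumes "a \<in> poly_field r"
  shows "pscale_perm c id a \<in> poly_field r"
  unfolding pscale_perm_def peval_def mon_eval_def
  by (intro poly_field_sum poly_field_mult poly_field_prod poly_field_power poly_field_pconst)
    (use assms in \<open>force simp: poly_field_def poly_vars_def\<close>)

lemma ratfun_field_iff: "f \<in> ratfun_field r \<longleftrightarrow> (\<exists>a\<in>poly_field r. \<exists>b\<in>poly_field r. b \<noteq> 0 \<and> f = to_fract a / to_fract b)"
  by (auto simp: ratfun_field_def poly_field_def Fract_to_fract)

lemma ratfun_field_add: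
  assumes "f \<in> ratfun_field r" "h \<in> ratfun_field r" shows "f + h \<in> ratfun_field r"
proof -
  obtain a b a' b' where "a \<in> poly_field r" "b \<in> poly_field r" "b \<noteq> 0" "f = to_fract a / to_fract b"
    "a' \<in> poly_field r" "b' \<in> poly_field r" "b' \<noteq> 0" "h = to_fract a' / to_fract b'"
    using assms by (auto simp: ratfun_field_iff)
  then have "f + h = to_fract (a * b' + a' * b) / to_fract (b * b')"
    by (simp add: to_fract_add to_fract_mult to_fract_eq_0 field_simps)
  then show ?thesis unfolding ratfun_field_iff
    by (intro bexI[of _ "a * b' + a' * b"] bexI[of _ "b * b'"])
      (use \<open>a \<in> _\<close> \<open>a' \<in> _\<close> \<open>b \<in> _\<close> \<open>b' \<in> _\<close> \<open>b \<noteq> 0\<close> \<open>b' \<noteq> 0\<close> in \<open>auto intro!: poly_field_mult poly_field_add\<close>)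
qed

lemma ratfun_field_mult:
  assumes "f \<in> ratfun_field r" "h \<in> ratfun_field r" shows "f * h \<in> ratfun_field r"
proof -
  obtain a b a' b' where "a \<in> poly_field r" "b \<in> poly_field r" "b \<noteq> 0" "f = to_fract a / to_fract b"
    "a' \<in> poly_field r" "b' \<in> poly_field r" "b' \<noteq> 0" "h = to_fract a' / to_fract b'"
    using assms by (auto simp: ratfun_field_iff)
  then have "f * h = to_fract (a * a') / to_fract (b * b')"
    by (simp add: to_fract_mult)
  then show ?thesis unfolding ratfun_field_iff
    by (intro bexI[of _ "a * a'"] bexI[of _ "b * b'"])
      (use \<open>a \<in> _\<close> \<open>a' \<in> _\<close> \<open>b \<in> _\<close> \<open>b' \<in> _\<close> \<open>b \<noteq> 0\<close> \<open>b' \<noteq> 0\<close> in \<open>auto intro!: poly_field_mult poly_field_add\<close>)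
qed

lemma ratfun_field_rconst: "rconst c \<in> ratfun_field r"
  unfolding ratfun_field_iff
  by (intro bexI[of _ "pconst c"] bexI[of _ 1]) (simp_all add: rconst_to_fract to_fract_1 poly_field_pconst poly_field_1)

lemma ratfun_field_rvar: "i \<in> {1..r+1} \<Longrightarrow> rvar i \<in> ratfun_field r"
  unfolding ratfun_field_iff
  by (intro bexI[of _ "pvar i"] bexI[of _ 1]) (simp_all add: rvar_to_fract to_fract_1 poly_field_pvar[unfolded One_nat_def] poly_field_1)

lemma ratfun_field_inverse:
  assumes "f \<in> ratfun_field r" shows "inverse f \<in> ratfun_field r"
proof (cases "f = 0")
  case True
  then show ?thesis using ratfun_field_rconst[of 0 r] by simp
next
  case False
  obtain a b where ab: "a \<in> poly_field r" "b \<in> poly_field r" "b \<noteq> 0" "f = to_fract a / to_fract b"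
    using assms by (auto simp: ratfun_field_iff)
  then have "a \<noteq> 0" using False by (auto simp: to_fract_0)
  with ab show ?thesis unfolding ratfun_field_iff by (intro bexI[of _ a] bexI[of _ b]) auto
qed

lemma ratfun_field_power: "f \<in> ratfun_field r \<Longrightarrow> f ^ k \<in> ratfun_field r"
  using ratfun_field_rconst[of 1 r] by (induction k) (simp_all add: ratfun_field_mult)

lemma ratfun_field_powi: "f \<in> ratfun_field r \<Longrightarrow> f powi k \<in> ratfun_field r"
  by (simp add: power_int_def ratfun_field_power ratfun_field_inverse)

lemma ratfun_field_sum: "(\<And>x. x \<in> A \<Longrightarrow> f x \<in> ratfun_field r) \<Longrightarrow> sum f A \<in> ratfun_field r"
  using ratfun_field_rconst[of 0 r] by (induction A rule: infinite_finite_induct) (simp_all add: ratfun_field_add)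

lemma ratfun_field_prod: "(\<And>x. x \<in> A \<Longrightarrow> f x \<in> ratfun_field r) \<Longrightarrow> prod f A \<in> ratfun_field r"
  using ratfun_field_rconst[of 1 r] by (induction A rule: infinite_finite_induct) (simp_all add: ratfun_field_mult)

lemma ratfun_field_rmonom: "rmonom r \<mu> \<in> ratfun_field r"
  unfolding rmonom_def by (intro ratfun_field_prod ratfun_field_powi ratfun_field_rvar)

lemma ratfun_field_scale:
  assumes "\<And>i. c i \<noteq> 0" "f \<in> ratfun_field r"
  shows "scale_perm c id f \<in> ratfun_field r"
proof -
  obtain a b where f: "a \<in> poly_field r" "b \<in> poly_field r" "b \<noteq> 0" "f = to_fract a / to_fract b"
    using assms(2) by (auto simp: ratfun_field_iff)
  show ?thesis unfolding ratfun_field_iff f(4) Fract_to_fract[symmetric]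
    using poly_field_pscale f(1,2) scale_perm_Fract(1)[of c id b a, OF assms(1) bij_id f(3)] scale_perm_Fract(2)[of c id b, OF assms(1) bij_id f(3)]
    by (intro bexI[of _ "pscale_perm c id a"] bexI[of _ "pscale_perm c id b"]) (simp_all add: Fract_to_fract)
qed

lemma rat_hom_scale: "(\<And>i. c i \<noteq> 0) \<Longrightarrow> rat_hom (scale_perm c id)"
  by (rule rat_hom_scale_perm(1)[OF _ bij_id])

lemma scale_rvar: "(\<And>i. c i \<noteq> 0) \<Longrightarrow> scale_perm c id (rvar i) = rconst (c i) * rvar i"
  using rat_hom_scale_perm(2)[of c id i] by simp

lemma scale_comp:
  assumes "\<And>i. c i \<noteq> 0" "\<And>i. d i \<noteq> 0"
  shows "scale_perm c id \<circ> scale_perm d id = scale_perm (\<lambda>i. c i * d i) id"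
proof (rule rat_hom_unique)
  fix i
  note h = rat_hom_scale[of c, OF assms(1)]
  show "(scale_perm c id \<circ> scale_perm d id) (rvar i) = scale_perm (\<lambda>i. c i * d i) id (rvar i)"
    using assms by (simp add: scale_rvar rat_homD[OF h] rconst_mult mult.commute mult.left_commute)
qed (use assms in \<open>auto intro!: rat_hom_comp rat_hom_scale\<close>)

lemma scale_one: "scale_perm (\<lambda>_. 1) id = id"
  by (rule rat_hom_unique) (auto intro!: rat_hom_scale rat_hom_id simp: scale_rvar)

lemma scale_funpow: "(\<And>i. c i \<noteq> 0) \<Longrightarrow> scale_perm c id ^^ k = scale_perm (\<lambda>i. c i ^ k) id"
proof (induction k)
  case (Suc k)
  have "scale_perm c id ^^ Suc k = scale_perm c id \<circ> scale_perm (\<lambda>i. c i ^ k) id"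
    by (simp only: funpow.simps Suc.IH[OF Suc.prems])
  also have "\<dots> = scale_perm (\<lambda>i. c i ^ Suc k) id"
    unfolding power_Suc by (rule scale_comp) (use Suc.prems in auto)
  finally show ?case .
qed (simp add: scale_one)

section \<open>Roots of unity and projections to eigenspaces\<close>

definition zeta :: "nat \<Rightarrow> complex" where "zeta n = cis (2 * pi / real n)"

lemma zeta_nz [simp]: "zeta n \<noteq> 0"
  by (simp add: zeta_def)

lemma zeta_power: "zeta n ^ k = cis (2 * pi * real k / real n)"
  by (simp add: zeta_def Complex.DeMoivre mult.commute)

lemma zeta_power_n: "n \<ge> 1 \<Longrightarrow> zeta n ^ n = 1"
  by (simp add: zeta_power)

lemma root_of_unity_zeta:
  assumes "n \<ge> 1" "z ^ n = 1"
  shows "\<exists>k. z = zeta n ^ k"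
  using bij_betw_roots_unity[of n] assms unfolding zeta_power bij_betw_def by fastforce

lemma zeta_powi_cong:
  assumes "n \<ge> 1" "[a = b] (mod int n)"
  shows "zeta n powi a = zeta n powi b"
proof -
  obtain k where "a = b + int n * k" using assms(2) by (metis cong_iff_lin cong_sym)
  then have "zeta n powi a = zeta n powi b * (zeta n powi int n) powi k"
    by (simp add: power_int_add power_int_mult)
  then show ?thesis using zeta_power_n[OF assms(1)] by simp
qed

lemma zeta_powi_eq_1:
  assumes "n \<ge> 1" "zeta n powi a = 1"
  shows "int n dvd a"
proof -
  define m where "m = nat (a mod int n)"
  have m: "int m = a mod int n" "m < n" using assms(1) by (auto simp: m_def nat_less_iff)
  have "zeta n powi int m = 1" using zeta_powi_cong[OF assms(1), of "int m" a] assms(2) m by (simp add: cong_def)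
  then have "cis (2 * pi * real m / real n) = cis (2 * pi * real 0 / real n)" by (simp add: zeta_power)
  then have "m = 0"
    using bij_betw_roots_unity[of n] assms(1) m(2) inj_onD[of "\<lambda>k. cis (2 * pi * real k / real n)" "{..<n}" m 0]
    unfolding bij_betw_def by auto
  then show ?thesis using m by (simp add: cong_def dvd_eq_mod_eq_0)
qed

lemma sum_zeta:
  assumes "n \<ge> 1"
  shows "(\<Sum>k<n. (zeta n powi a) ^ k) = (if int n dvd a then of_nat n else 0)"
proof (cases "int n dvd a")
  case True
  then have "zeta n powi a = 1" using zeta_powi_cong[OF assms, of a 0] by (simp add: cong_0_iff)
  then show ?thesis using True by simp
next
  case False
  then have ne: "zeta n powi a \<noteq> 1" using zeta_powi_eq_1[OF assms] by blast
  have "(zeta n powi a) ^ n = (zeta n powi (int n)) powi a"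
    by (simp only: power_int_of_nat[symmetric] power_int_mult[symmetric] mult.commute)
  also have "\<dots> = 1" using zeta_power_n[OF assms] by simp
  finally show ?thesis using False geometric_sum[OF ne, of n] by simp
qed

text \<open>For an automorphism s with s^n = 1 this is the projection to its \<zeta>^d-eigenspace,
  an average over the cyclic group of order n.\<close>

definition eproj :: "nat \<Rightarrow> (ratfun \<Rightarrow> ratfun) \<Rightarrow> int \<Rightarrow> ratfun \<Rightarrow> ratfun" where
  "eproj n s d f = (\<Sum>k<n. rconst ((zeta n powi (- d)) ^ k / of_nat n) * (s ^^ k) f)"

lemma eproj_linear:
  assumes s: "rat_hom s"
  shows "eproj n s d (f + h) = eproj n s d f + eproj n s d h"
    and "eproj n s d (rconst c * f) = rconst c * eproj n s d f"
  by (simp_all add: eproj_def rat_homD[OF rat_hom_funpow[OF s]] distrib_left sum.distrib sum_distrib_left mult.left_commute)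

lemma eproj_eigen:
  assumes n: "n \<ge> 1" and s: "rat_hom s" and f: "s f = rconst (zeta n powi m) * f"
  shows "eproj n s d f = (if [m = d] (mod int n) then f else 0)"
proof -
  have "(s ^^ k) f = rconst ((zeta n powi m) ^ k) * f" for k
    by (induction k) (simp_all add: f rat_homD[OF s] rconst_mult mult.left_commute)
  then have "eproj n s d f = (\<Sum>k<n. rconst ((zeta n powi (m - d)) ^ k / of_nat n) * f)"
    unfolding eproj_def
    by (intro sum.cong[OF refl]) (simp add: rconst_mult[symmetric] mult.assoc[symmetric] power_mult_distrib[symmetric] power_int_add[symmetric])
  also have "\<dots> = rconst ((\<Sum>k<n. (zeta n powi (m - d)) ^ k) / of_nat n) * f"
    by (simp add: sum_distrib_right rconst_sum sum_divide_distrib)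
  also have "\<dots> = (if [m = d] (mod int n) then f else 0)"
    unfolding sum_zeta[OF n] using n by (simp add: cong_iff_dvd_diff)
  finally show ?thesis .
qed

lemma eproj_sum:
  assumes n: "n \<ge> 1"
  shows "(\<Sum>d<n. eproj n s (int d) f) = f"
proof -
  have "(\<Sum>d<n. eproj n s (int d) f) = (\<Sum>k<n. \<Sum>d<n. rconst ((zeta n powi (- int d)) ^ k / of_nat n) * (s ^^ k) f)"
    unfolding eproj_def by (rule sum.swap)
  also have "\<dots> = (\<Sum>k<n. rconst ((\<Sum>d<n. (zeta n powi (- int k)) ^ d) / of_nat n) * (s ^^ k) f)"
  proof (rule sum.cong[OF refl])
    fix k
    have "(zeta n powi (- int d)) ^ k = (zeta n powi (- int k)) ^ d" for d
      by (simp add: power_int_minus power_inverse[symmetric] power_mult[symmetric] mult.commute)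
    then show "(\<Sum>d<n. rconst ((zeta n powi (- int d)) ^ k / of_nat n) * (s ^^ k) f) = rconst ((\<Sum>d<n. (zeta n powi (- int k)) ^ d) / of_nat n) * (s ^^ k) f"
      by (simp add: sum_distrib_right rconst_sum sum_divide_distrib)
  qed
  also have "\<dots> = (\<Sum>k<n. if k = 0 then f else 0)"
    unfolding sum_zeta[OF n]
    by (rule sum.cong[OF refl]) (use n in \<open>auto dest!: zdvd_imp_le\<close>)
  also have "\<dots> = f" using n by simp
  finally show ?thesis .
qed

lemma eproj_eigenvector:
  assumes n: "n \<ge> 1" and s: "rat_hom s" and sn: "s ^^ n = id"
  shows "s (eproj n s d f) = rconst (zeta n powi d) * eproj n s d f"
proof -
  let ?w = "zeta n powi (- d)"
  define a where "a k = rconst (?w ^ k / of_nat n) * (s ^^ k) f" for k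
  have inv: "zeta n powi d * ?w = 1" by (simp add: power_int_minus)
  have wn: "?w ^ n = 1"
  proof -
    have "?w ^ n = (zeta n powi (int n)) powi (- d)"
      by (simp only: power_int_of_nat[symmetric] power_int_mult[symmetric] mult.commute)
    then show ?thesis using zeta_power_n[OF n] by simp
  qed
  have step: "s (a k) = rconst (zeta n powi d) * a (Suc k)" for k
  proof -
    have "rconst (zeta n powi d) * a (Suc k) = rconst (zeta n powi d * ?w * (?w ^ k / of_nat n)) * (s ^^ Suc k) f"
      by (simp only: a_def rconst_mult power_Suc mult.assoc times_divide_eq_right[symmetric])
    also have "\<dots> = s (a k)"
      by (simp only: inv mult_1_left a_def rat_homD[OF s] funpow.simps o_apply)
    finally show ?thesis by simp
  qed
  have "s (eproj n s d f) = (\<Sum>k<n. rconst (zeta n powi d) * a (Suc k))"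
    by (simp add: eproj_def rat_hom_sum[OF s] step a_def[symmetric])
  also have "\<dots> = rconst (zeta n powi d) * (\<Sum>k<n. a (Suc k))" by (simp add: sum_distrib_left)
  also have "(\<Sum>k<n. a (Suc k)) = (\<Sum>k<n. a k)"
  proof -
    have "a n = a 0" using sn wn by (simp add: a_def)
    then show ?thesis using sum.lessThan_Suc_shift[of a n] sum.lessThan_Suc[of a n] by simp
  qed
  finally show ?thesis by (simp add: eproj_def a_def)
qed

text \<open>Splitting by one automorphism does not spoil the eigenvectors of another that commutes
  with it.\<close>

lemma eproj_other:
  assumes s: "rat_hom s" and t: "rat_hom t" and comm: "t \<circ> s = s \<circ> t" and f: "t f = rconst c * f"
  shows "t (eproj n s d f) = rconst c * eproj n s d f"
proof -
  have "t ((s ^^ k) f) = rconst c * (s ^^ k) f" for k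
  proof (induction k)
    case (Suc k)
    then show ?case using fun_cong[OF comm, of "(s ^^ k) f"] by (simp add: rat_homD[OF s])
  qed (simp add: f)
  then show ?thesis by (simp add: eproj_def rat_hom_sum[OF t] rat_homD[OF t] sum_distrib_left mult.left_commute)
qed

lemma eproj_field:
  assumes "\<And>f. f \<in> ratfun_field r \<Longrightarrow> s f \<in> ratfun_field r" "f \<in> ratfun_field r"
  shows "eproj n s d f \<in> ratfun_field r"
proof -
  have "(s ^^ k) f \<in> ratfun_field r" for k by (induction k) (simp_all add: assms)
  then show ?thesis unfolding eproj_def by (intro ratfun_field_sum ratfun_field_mult ratfun_field_rconst)
qed

section \<open>Characters of the weight lattice modulo \<Lambda>_0\<close>

lemma weight_expand:
  assumes "\<mu> \<in> weight_lattice r"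
  shows "\<mu> = (\<lambda>i. \<Sum>j\<in>{1..r+1}. \<mu> j * unit_weight j i)"
proof
  fix i
  show "\<mu> i = (\<Sum>j\<in>{1..r+1}. \<mu> j * unit_weight j i)"
    using assms by (cases "i \<in> {1..r+1}") (auto simp: unit_weight_def weight_lattice_def if_distrib cong: if_cong)
qed

text \<open>n e_j lies in \<Lambda>_0, so the values at the unit weights are n-th roots of unity,
  and they determine the character.\<close>

lemma quotient_char_unit:
  assumes \<xi>: "\<xi> \<in> quotient_chars n r"
  shows "j \<in> {1..r+1} \<Longrightarrow> \<xi> (\<lambda>i. k * unit_weight j i) = \<xi> (unit_weight j) powi k"
    and "j \<in> {1..r+1} \<Longrightarrow> \<xi> (unit_weight j) ^ n = 1"
    and "\<mu> \<in> weight_lattice r \<Longrightarrow> \<xi> \<mu> = (\<Prod>j\<in>{1..r+1}. \<xi> (unit_weight j) powi \<mu> j)"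
    and "j \<in> {1..r+1} \<Longrightarrow> \<xi> (unit_weight j) \<noteq> 0"
proof -
  have add: "\<xi> (\<lambda>i. \<mu> i + \<nu> i) = \<xi> \<mu> * \<xi> \<nu>" if "\<mu> \<in> weight_lattice r" "\<nu> \<in> weight_lattice r" for \<mu> \<nu>
    using \<xi> that by (simp add: quotient_chars_def)
  have one: "\<xi> (\<lambda>i. 0) = 1" using \<xi> by (auto simp: quotient_chars_def lattice0_def weight_lattice_def)
  have wl: "(\<lambda>i. k * unit_weight j i) \<in> weight_lattice r" if "j \<in> {1..r+1}" for j k
    using that by (auto simp: weight_lattice_def unit_weight_def)
  have nz: "\<xi> (unit_weight j) \<noteq> 0" if j: "j \<in> {1..r+1}" for j
  proof
    assume "\<xi> (unit_weight j) = 0"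
    moreover have "\<xi> (\<lambda>i. 1 * unit_weight j i + (-1) * unit_weight j i) = \<xi> (\<lambda>i. 1 * unit_weight j i) * \<xi> (\<lambda>i. (-1) * unit_weight j i)"
      by (rule add) (rule wl[OF j])+
    ultimately show False using one by simp
  qed
  show unit: "\<xi> (\<lambda>i. k * unit_weight j i) = \<xi> (unit_weight j) powi k" if j: "j \<in> {1..r+1}" for j k
  proof (induction k rule: int_induct[where k = 0])
    case base
    then show ?case by (simp add: one)
  next
    case (step1 k)
    have "\<xi> (\<lambda>i. k * unit_weight j i + 1 * unit_weight j i) = \<xi> (\<lambda>i. k * unit_weight j i) * \<xi> (\<lambda>i. 1 * unit_weight j i)"
      by (rule add) (rule wl[OF j])+
    then show ?case using step1 nz[OF j] by (simp add: distrib_right power_int_add)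
  next
    case (step2 k)
    have "\<xi> (\<lambda>i. (k - 1) * unit_weight j i + 1 * unit_weight j i) = \<xi> (\<lambda>i. (k - 1) * unit_weight j i) * \<xi> (\<lambda>i. 1 * unit_weight j i)"
      by (rule add) (rule wl[OF j])+
    then have "\<xi> (\<lambda>i. k * unit_weight j i) = \<xi> (\<lambda>i. (k - 1) * unit_weight j i) * \<xi> (unit_weight j)"
      by (simp add: left_diff_distrib)
    then show ?case using step2 nz[OF j] by (simp add: power_int_diff field_simps)
  qed
  show "\<xi> (unit_weight j) ^ n = 1" if j: "j \<in> {1..r+1}" for j
  proof -
    have "(\<lambda>i. int n * unit_weight j i) \<in> lattice0 n r"
      using wl[OF j] by (auto simp: lattice0_def cong_def unit_weight_def)
    then have "\<xi> (\<lambda>i. int n * unit_weight j i) = 1" using \<xi> by (simp add: quotient_chars_def)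
    then show ?thesis using unit[OF j, of "int n"] by simp
  qed
  show "\<xi> \<mu> = (\<Prod>j\<in>{1..r+1}. \<xi> (unit_weight j) powi \<mu> j)" if "\<mu> \<in> weight_lattice r" for \<mu>
  proof -
    have "A \<subseteq> {1..r+1} \<Longrightarrow> \<xi> (\<lambda>i. \<Sum>j\<in>A. \<mu> j * unit_weight j i) = (\<Prod>j\<in>A. \<xi> (unit_weight j) powi \<mu> j)" if "finite A" for A
      using that
    proof (induction A)
      case empty
      then show ?case by (simp add: one)
    next
      case (insert j A)
      have "\<xi> (\<lambda>i. \<mu> j * unit_weight j i + (\<Sum>j\<in>A. \<mu> j * unit_weight j i)) = \<xi> (\<lambda>i. \<mu> j * unit_weight j i) * \<xi> (\<lambda>i. \<Sum>j\<in>A. \<mu> j * unit_weight j i)"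
        using insert wl[of j] by (intro add) (auto simp: weight_lattice_def unit_weight_def intro!: sum.neutral)
      then show ?case using insert unit[of j] by simp
    qed
    from this[of "{1..r+1}"] show ?thesis using weight_expand[OF that] by simp
  qed
  show "\<xi> (unit_weight j) \<noteq> 0" if "j \<in> {1..r+1}" using nz[OF that] .
qed

section \<open>The Chinta--Gunnells action\<close>

lemma rat_hom_perm_adj: "rat_hom (perm_act (Transposition.transpose i (i + 1)))"
  and perm_adj_rvar: "perm_act (Transposition.transpose i (i + 1)) (rvar j) = rvar (adj i j)"
  using rat_hom_scale_perm[of "\<lambda>_. 1" "Transposition.transpose i (i + 1)"] by (simp_all add: perm_act_scale_perm adj_def)

lemma cg_formula_linear:
  "cg_formula n v g i \<mu> (f + h) = cg_formula n v g i \<mu> f + cg_formula n v g i \<mu> h"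
  "cg_formula n v g i \<mu> (rconst c * f) = rconst c * cg_formula n v g i \<mu> f"
  using rat_homD[OF rat_hom_perm_adj[of i]] by (simp_all add: cg_formula_def add_divide_distrib distrib_right)

definition cg_spec ::
  "nat \<Rightarrow> nat \<Rightarrow> complex \<Rightarrow> (int \<Rightarrow> complex) \<Rightarrow> nat \<Rightarrow> (ratfun \<Rightarrow> ratfun) \<Rightarrow> bool" where
  "cg_spec n r v g i \<phi> \<longleftrightarrow> \<phi> \<in> extensional (ratfun_field r) \<and>
        (\<forall>f \<in> ratfun_field r. \<forall>h \<in> ratfun_field r. \<phi> (f + h) = \<phi> f + \<phi> h) \<and>
        (\<forall>c. \<forall>f \<in> ratfun_field r. \<phi> (rconst c * f) = rconst c * \<phi> f) \<and>
        (\<forall>\<mu> \<in> weight_lattice r. \<forall>f \<in> eigenspace_K n r \<mu>. \<phi> f = cg_formula n v g i \<mu> f)"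

lemma cg_act_spec: "cg_act n r v g i = (THE \<phi>. cg_spec n r v g i \<phi>)"
  by (simp add: cg_act_def cg_spec_def)

text \<open>Scaling one variable by \<zeta> need not come from a character trivial on \<Lambda>_0,
  which contains (1,...,1). Conversely, every such character acts as a product of powers of these
  scalings, so their simultaneous eigenvectors refine the decomposition into the spaces K.\<close>

lemma eigenspaceI:
  assumes n: "n \<ge> 1" and f: "f \<in> ratfun_field r" and \<mu>: "\<mu> \<in> weight_lattice r"
    and eig: "\<And>j. j \<in> {1..r+1} \<Longrightarrow> scale_perm (\<lambda>i. if i = j then zeta n else 1) id f = rconst (zeta n powi \<mu> j) * f"
  shows "f \<in> eigenspace_K n r \<mu>"
  unfolding eigenspace_K_def
proof (intro CollectI conjI ballI f)
  fix \<xi> assume \<xi>: "\<xi> \<in> quotient_chars n r"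
  note q = quotient_char_unit[OF \<xi>]
  obtain k where k: "\<And>j. j \<in> {1..r+1} \<Longrightarrow> \<xi> (unit_weight j) = zeta n ^ k j"
    using root_of_unity_zeta[OF n q(2)] by metis
  have "m \<le> r + 1 \<Longrightarrow> scale_perm (\<lambda>i. if i \<in> {1..m} then \<xi> (unit_weight i) else 1) id f
      = rconst (\<Prod>j\<in>{1..m}. \<xi> (unit_weight j) powi \<mu> j) * f" for m
  proof (induction m)
    case 0
    then show ?case by (simp add: scale_one[unfolded id_def] id_def)
  next
    case (Suc m)
    let ?j = "Suc m"
    let ?c = "\<lambda>i. if i \<in> {1..m} then \<xi> (unit_weight i) else 1"
    let ?d = "\<lambda>i. if i = ?j then zeta n else 1"
    have j: "?j \<in> {1..r+1}" using Suc.prems by auto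
    have c: "?c i \<noteq> 0" for i using q(4) Suc.prems by auto
    have d: "?d i \<noteq> 0" for i by simp
    have fn: "(\<lambda>i. if i \<in> {1..Suc m} then \<xi> (unit_weight i) else 1) = (\<lambda>i. (?d i) ^ k ?j * ?c i)"
      using k[OF j] by (auto simp: fun_eq_iff le_Suc_eq)
    have e1: "scale_perm (\<lambda>i. if i \<in> {1..Suc m} then \<xi> (unit_weight i) else 1) id
        = (scale_perm ?d id ^^ k ?j) \<circ> scale_perm ?c id"
      unfolding fn scale_funpow[of ?d, OF d] by (rule scale_comp[symmetric]) (use c in auto)
    have e2: "(scale_perm ?d id ^^ l) f = rconst ((zeta n powi \<mu> ?j) ^ l) * f" for l
      using eig[OF j] rat_homD[OF rat_hom_scale[of ?d, OF d]]
      by (induction l) (simp_all add: rconst_mult ac_simps)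
    have e3: "(zeta n powi \<mu> ?j) ^ k ?j = \<xi> (unit_weight ?j) powi \<mu> ?j"
      unfolding k[OF j] by (simp only: power_int_of_nat[symmetric] power_int_mult[symmetric] mult.commute)
    let ?P = "\<Prod>j\<in>{1..m}. \<xi> (unit_weight j) powi \<mu> j"
    have h: "rat_hom (scale_perm ?d id ^^ k ?j)" by (rule rat_hom_funpow, rule rat_hom_scale, rule d)
    have IH: "scale_perm ?c id f = rconst ?P * f"
      by (rule Suc.IH) (use Suc.prems in simp)
    have "scale_perm (\<lambda>i. if i \<in> {1..Suc m} then \<xi> (unit_weight i) else 1) id f = rconst ?P * (rconst (\<xi> (unit_weight ?j) powi \<mu> ?j) * f)"
      by (simp only: e1 o_apply IH rat_homD(2,3)[OF h] e2 e3)
    also have "\<dots> = rconst (\<Prod>j\<in>{1..Suc m}. \<xi> (unit_weight j) powi \<mu> j) * f"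
      by (simp add: rconst_mult mult.assoc)
    finally show ?case .
  qed
  from this[of "r+1"] show "char_act r \<xi> f = rconst (\<xi> \<mu>) * f"
    unfolding char_act_scale_perm q(3)[OF \<mu>] by simp
qed

text \<open>Every f is a sum of simultaneous eigenvectors of the r + 1 scalings, which commute and
  have n-th power 1. In \<open>main\<close>, k counts the scalings already diagonal on f; one more
  splits f by \<open>eproj\<close>, and at k = r + 1 both maps are given by
  \<open>cg_formula\<close>.\<close>

lemma cg_spec_unique:
  assumes n: "n \<ge> 1" and 1: "cg_spec n r v g i \<phi>" and 2: "cg_spec n r v g i \<chi>"
  shows "\<phi> = \<chi>"
proof (rule extensionalityI[where A = "ratfun_field r"])
  let ?t = "\<lambda>j. scale_perm (\<lambda>i. if i = j then zeta n else 1) id"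
  have add_char: "rat_hom (?t j)" for j by (rule rat_hom_scale) simp
  have tf: "f \<in> ratfun_field r \<Longrightarrow> ?t j f \<in> ratfun_field r" for j f by (rule ratfun_field_scale) simp
  have tn: "?t j ^^ n = id" for j
  proof -
    have fn: "(\<lambda>i. (if i = j then zeta n else 1) ^ n) = (\<lambda>_. 1)" using zeta_power_n[OF n] by auto
    have "?t j ^^ n = scale_perm (\<lambda>i. (if i = j then zeta n else 1) ^ n) id" by (rule scale_funpow) simp
    also have "\<dots> = id" unfolding fn by (rule scale_one)
    finally show ?thesis .
  qed
  have tc: "?t j \<circ> ?t k = ?t k \<circ> ?t j" for j k
    by (subst (1 2) scale_comp) (auto simp: mult.commute)
  have main: "k \<le> r + 1 \<Longrightarrow> f \<in> ratfun_field r \<Longrightarrow> (\<And>j. j \<in> {1..k} \<Longrightarrow> \<exists>m. ?t j f = rconst (zeta n powi m) * f)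
      \<Longrightarrow> \<phi> f = \<chi> f" for k f
  proof (induction k arbitrary: f rule: inc_induct)
    case base
    then have "\<forall>j\<in>{1..r+1}. \<exists>m. ?t j f = rconst (zeta n powi m) * f" by blast
    then obtain m where m: "\<And>j. j \<in> {1..r+1} \<Longrightarrow> ?t j f = rconst (zeta n powi m j) * f" by metis
    define \<mu> where "\<mu> = (\<lambda>j. if j \<in> {1..r+1} then m j else 0)"
    have \<mu>: "\<mu> \<in> weight_lattice r" by (auto simp: \<mu>_def weight_lattice_def)
    have "f \<in> eigenspace_K n r \<mu>" by (rule eigenspaceI[OF n base(1) \<mu>]) (use m in \<open>auto simp: \<mu>_def\<close>)
    then show ?case using 1 2 \<mu> unfolding cg_spec_def by metis
  next
    case (step k)
    let ?p = "\<lambda>d. eproj n (?t (Suc k)) (int d) f"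
    have pf: "?p d \<in> ratfun_field r" for d by (rule eproj_field) (use tf step in auto)
    have eq: "\<phi> (?p d) = \<chi> (?p d)" for d
    proof (rule step.IH[OF pf])
      fix j assume j: "j \<in> {1..Suc k}"
      show "\<exists>m. ?t j (?p d) = rconst (zeta n powi m) * ?p d"
      proof (cases "j = Suc k")
        case True
        then show ?thesis using eproj_eigenvector[OF n add_char tn] by blast
      next
        case False
        then have "j \<in> {1..k}" using j by auto
        from step.prems(2)[OF this] obtain m where "?t j f = rconst (zeta n powi m) * f" by blast
        then show ?thesis using eproj_other[OF add_char add_char tc] by blast
      qed
    qed
    have add: "\<psi> (sum p A) = (\<Sum>d\<in>A. \<psi> (p d))" if "cg_spec n r v g i \<psi>" "\<And>d. p d \<in> ratfun_field r" for \<psi> and p :: "nat \<Rightarrow> ratfun" and A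
    proof (induction A rule: infinite_finite_induct)
      case (insert x F)
      then show ?case using that ratfun_field_sum[of F p r] unfolding cg_spec_def by simp
    next
      case empty
      have "\<psi> (rconst 0 * rconst 0) = rconst 0 * \<psi> (rconst 0)" using that(1) ratfun_field_rconst[of 0 r] unfolding cg_spec_def by blast
      then show ?case by simp
    next
      case (infinite A)
      have "\<psi> (rconst 0 * rconst 0) = rconst 0 * \<psi> (rconst 0)" using that(1) ratfun_field_rconst[of 0 r] unfolding cg_spec_def by blast
      then show ?case using infinite by simp
    qed
    show ?case
      using add[OF 1, of ?p "{..<n}"] add[OF 2, of ?p "{..<n}"] pf eq
      unfolding eproj_sum[OF n] by simp
  qed
  show "\<phi> f = \<chi> f" if "f \<in> ratfun_field r" for f
    by (rule main[of 0]) (use that in auto)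
qed (use 1 2 in \<open>auto simp: cg_spec_def\<close>)

context metaplectic_parameters
begin

lemma cg_formula_cong:
  assumes "[\<mu> (i + 1) - \<mu> i = \<nu> (i + 1) - \<nu> i] (mod int n)"
  shows "cg_formula n v g i \<mu> f = cg_formula n v g i \<nu> f"
proof -
  have "g (1 + \<mu> (i + 1) - \<mu> i) = g (1 + \<nu> (i + 1) - \<nu> i)"
    by (rule g_cong) (use cong_add[OF cong_refl assms, of 1] in \<open>simp add: algebra_simps\<close>)
  then show ?thesis using assms unfolding cg_formula_def cong_def by simp
qed

text \<open>The formula depends on \<mu> only through \<mu>_{i+1} - \<mu>_i mod n, so the single
  character reading off that residue suffices. The map is the sum over residues d of the formula for
  the lift d e_{i+1}, applied to the projection of f; linearity is then built in.\<close>

lemma cg_spec_exists: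
  assumes i: "i \<in> {1..r}"
  shows "\<exists>\<phi>. cg_spec n r v g i \<phi>"
proof -
  define \<xi> where "\<xi> = (\<lambda>\<mu>::nat \<Rightarrow> int. zeta n powi (\<mu> (i + 1) - \<mu> i))"
  define s where "s = char_act r \<xi>"
  define c where "c = (\<lambda>j. if j \<in> {1..r+1} then \<xi> (unit_weight j) else 1)"
  have c: "c j \<noteq> 0" for j by (simp add: c_def \<xi>_def)
  have s_def': "s = scale_perm c id" by (simp add: s_def c_def char_act_scale_perm)
  have s: "rat_hom s" unfolding s_def' by (rule rat_hom_scale[OF c])
  have \<xi>: "\<xi> \<in> quotient_chars n r"
    unfolding quotient_chars_def
  proof (intro CollectI conjI ballI)
    fix \<mu> assume "\<mu> \<in> lattice0 n r"
    then have "[\<mu> (i + 1) = \<mu> i] (mod int n)" using i by (auto simp: lattice0_def)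
    then have "[\<mu> (i + 1) - \<mu> i = 0] (mod int n)" by (simp add: cong_diff_iff_cong_0)
    then show "\<xi> \<mu> = 1" unfolding \<xi>_def using zeta_powi_cong[OF n_pos] by fastforce
  qed (simp add: \<xi>_def flip: power_int_add, simp add: algebra_simps)
  let ?w = "\<lambda>d::nat. \<lambda>j. if j = i + 1 then int d else 0"
  define \<phi>0 where "\<phi>0 f = (\<Sum>d<n. cg_formula n v g i (?w d) (eproj n s (int d) f))" for f
  have "cg_spec n r v g i (restrict \<phi>0 (ratfun_field r))"
    unfolding cg_spec_def
  proof (intro conjI ballI allI)
    fix f h assume "f \<in> ratfun_field r" "h \<in> ratfun_field r"
    then show "restrict \<phi>0 (ratfun_field r) (f + h) = restrict \<phi>0 (ratfun_field r) f + restrict \<phi>0 (ratfun_field r) h"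
      by (simp add: ratfun_field_add \<phi>0_def eproj_linear[OF s] cg_formula_linear sum.distrib)
  next
    fix c f assume "f \<in> ratfun_field r"
    then show "restrict \<phi>0 (ratfun_field r) (rconst c * f) = rconst c * restrict \<phi>0 (ratfun_field r) f"
      by (simp add: ratfun_field_mult ratfun_field_rconst \<phi>0_def eproj_linear[OF s] cg_formula_linear sum_distrib_left)
  next
    fix \<mu> f assume \<mu>: "\<mu> \<in> weight_lattice r" and f: "f \<in> eigenspace_K n r \<mu>"
    then have ff: "f \<in> ratfun_field r" and sf: "s f = rconst (zeta n powi (\<mu> (i + 1) - \<mu> i)) * f"
      using \<xi> unfolding eigenspace_K_def s_def by (auto simp: \<xi>_def)
    define d0 where "d0 = nat ((\<mu> (i + 1) - \<mu> i) mod int n)"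
    have d0: "int d0 = (\<mu> (i + 1) - \<mu> i) mod int n" "d0 < n" using n_pos by (auto simp: d0_def nat_less_iff)
    have z: "cg_formula n v g i \<nu> 0 = 0" for \<nu>
      using cg_formula_linear(2)[of n v g i \<nu> 0 0] by simp
    have "cg_formula n v g i (?w d) (eproj n s (int d) f) = (if d = d0 then cg_formula n v g i \<mu> f else 0)" if "d < n" for d
    proof (cases "d = d0")
      case True
      then show ?thesis using eproj_eigen[OF n_pos s sf, of d] d0 cg_formula_cong[of "?w d" i \<mu> f] by (simp add: cong_def)
    next
      case False
      then have "\<not> [\<mu> (i + 1) - \<mu> i = int d] (mod int n)" using that d0 by (auto simp: cong_def)
      then show ?thesis using eproj_eigen[OF n_pos s sf, of d] False z by simp
    qed
    then have "\<phi>0 f = (\<Sum>d<n. if d = d0 then cg_formula n v g i \<mu> f else 0)"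
      unfolding \<phi>0_def by (intro sum.cong[OF refl]) auto
    then show "restrict \<phi>0 (ratfun_field r) f = cg_formula n v g i \<mu> f" using ff d0(2) by simp
  qed simp
  then show ?thesis by blast
qed

lemma cg_spec_cg_act:
  assumes i: "i \<in> {1..r}"
  shows "cg_spec n r v g i (cg_act n r v g i)"
  unfolding cg_act_spec
proof (rule theI'[of "cg_spec n r v g i"])
  show "\<exists>!\<phi>. cg_spec n r v g i \<phi>"
    using cg_spec_exists[OF i] cg_spec_unique[OF n_pos] by blast
qed

end

section \<open>The operators on monomials\<close>

lemma rmonom_add: "rmonom r (a + b) = rmonom r a * rmonom r b"
  by (simp add: rmonom_def power_int_add prod.distrib)

lemma rmonom_0: "rmonom r 0 = 1"
  by (simp add: rmonom_def)

lemma rmonom_nz [simp]: "rmonom r a \<noteq> 0"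
  by (simp add: rmonom_def)

lemma root_monom_rmonom:
  assumes "i \<in> {1..r}"
  shows "root_monom i k = rmonom r (apow i k)"
proof -
  have "rmonom r (apow i k) = (\<Prod>j\<in>{i, i + 1}. rvar j powi apow i k j)"
    unfolding rmonom_def by (rule prod.mono_neutral_right) (use assms in \<open>auto simp: apow_def\<close>)
  also have "\<dots> = root_monom i k"
    by (simp add: apow_def root_monom_def power_int_mult_distrib power_int_inverse power_int_minus divide_inverse)
  finally show ?thesis by simp
qed

lemma perm_adj_rmonom:
  assumes "i \<in> {1..r}"
  shows "perm_act (Transposition.transpose i (i + 1)) (rmonom r \<mu>) = rmonom r (\<mu> + apow i (\<mu> (i + 1) - \<mu> i))"
proof -
  have "perm_act (Transposition.transpose i (i + 1)) (rmonom r \<mu>) = (\<Prod>j\<in>{1..r+1}. rvar (adj i j) powi \<mu> j)"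
    unfolding rmonom_def by (simp only: rat_hom_prod[OF rat_hom_perm_adj] rat_hom_powi[OF rat_hom_perm_adj] perm_adj_rvar)
  also have "\<dots> = (\<Prod>j\<in>{1..r+1}. rvar j powi \<mu> (adj i j))"
    by (subst prod.permute[OF adj_permutes[OF assms]]) (simp add: comp_def)
  also have "(\<lambda>j. \<mu> (adj i j)) = \<mu> + apow i (\<mu> (i + 1) - \<mu> i)"
    by (rule ext) (simp add: apow_def adj_apply)
  finally show ?thesis by (simp add: rmonom_def)
qed

lemma rmonom_eigen:
  assumes \<mu>: "\<mu> \<in> weight_lattice r"
  shows "rconst c * rmonom r \<mu> \<in> eigenspace_K n r \<mu>"
  unfolding eigenspace_K_def
proof (intro CollectI conjI ballI)
  show "rconst c * rmonom r \<mu> \<in> ratfun_field r"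
    by (intro ratfun_field_mult ratfun_field_rconst ratfun_field_rmonom)
  fix \<xi> assume \<xi>: "\<xi> \<in> quotient_chars n r"
  note q = quotient_char_unit[OF \<xi>]
  let ?c = "\<lambda>i. if i \<in> {1..r+1} then \<xi> (unit_weight i) else 1"
  have c: "?c i \<noteq> 0" for i using q(4) by auto
  have h: "rat_hom (scale_perm ?c id)" by (rule rat_hom_scale[of ?c, OF c])
  have "scale_perm ?c id (rmonom r \<mu>) = (\<Prod>j\<in>{1..r+1}. (rconst (?c j) * rvar j) powi \<mu> j)"
    unfolding rmonom_def by (simp only: rat_hom_prod[OF h] rat_hom_powi[OF h] scale_rvar[of ?c, OF c])
  also have "\<dots> = (\<Prod>j\<in>{1..r+1}. rconst (\<xi> (unit_weight j) powi \<mu> j)) * rmonom r \<mu>"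
    unfolding rmonom_def prod.distrib[symmetric] by (rule prod.cong[OF refl]) (simp add: power_int_mult_distrib rconst_powi)
  also have "\<dots> = rconst (\<xi> \<mu>) * rmonom r \<mu>" unfolding q(3)[OF \<mu>] rconst_prod ..
  finally show "char_act r \<xi> (rconst c * rmonom r \<mu>) = rconst (\<xi> \<mu>) * (rconst c * rmonom r \<mu>)"
    unfolding char_act_scale_perm by (simp only: rat_homD(2,3)[OF h] mult.left_commute)
qed

lemma rmonom_restrict: "rmonom r \<mu> = rmonom r (\<lambda>i. if i \<in> {1..r+1} then \<mu> i else 0)"
  by (simp add: rmonom_def)

text \<open>Guards the denominators 1 - x^{n\<alpha>} and 1 - v x^{n\<alpha>}; the constant is
  arbitrary because v is.\<close>

lemma root_monom_not_const:
  assumes "n \<ge> 1"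
  shows "root_monom i (int n) \<noteq> rconst c"
proof
  assume "root_monom i (int n) = rconst c"
  then have "rvar i ^ n = rconst c * rvar (i + 1) ^ n"
    by (simp add: root_monom_def power_divide divide_eq_eq)
  moreover have "rvar j ^ n = to_fract (Poly_Mapping.single (Poly_Mapping.single j n) 1)" for j n
  proof (induction n)
    case (Suc n)
    have "rvar j ^ Suc n = to_fract (pvar j * Poly_Mapping.single (Poly_Mapping.single j n) 1)"
      by (simp only: power_Suc Suc to_fract_mult) (simp only: rvar_to_fract)
    then show ?case by (simp add: mult_single flip: single_add)
  qed (simp add: to_fract_1)
  ultimately have "to_fract (Poly_Mapping.single (Poly_Mapping.single i n) 1) =
      to_fract (pconst c * Poly_Mapping.single (Poly_Mapping.single (i + 1) n) 1)"
    by (simp only: rconst_to_fract to_fract_mult)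
  then have "Poly_Mapping.single (Poly_Mapping.single i n) (1::complex) = Poly_Mapping.single (Poly_Mapping.single (i + 1) n) c"
    by (simp add: to_fract_def eq_fract mult_single)
  then have "Poly_Mapping.lookup (Poly_Mapping.single (Poly_Mapping.single i n) (1::complex)) (Poly_Mapping.single i n)
      = Poly_Mapping.lookup (Poly_Mapping.single (Poly_Mapping.single (i + 1) n) c) (Poly_Mapping.single i n)" by simp
  then have "Poly_Mapping.single (i + 1) n = Poly_Mapping.single i n"
    by (simp add: lookup_single when_def split: if_splits)
  then have "Poly_Mapping.lookup (Poly_Mapping.single (i + 1) n) i = Poly_Mapping.lookup (Poly_Mapping.single i n) i" by simp
  then show False using assms by (simp add: lookup_single when_def)
qed

section \<open>From Laurent polynomials back to rational functions\<close>

definition laurent_eval :: "nat \<Rightarrow> laurent \<Rightarrow> ratfun" where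
  "laurent_eval r p = (\<Sum>\<nu>\<in>Poly_Mapping.keys p. rconst (Poly_Mapping.lookup p \<nu>) * rmonom r \<nu>)"

lemma laurent_eval_add: "laurent_eval r (p + q) = laurent_eval r p + laurent_eval r q"
  unfolding laurent_eval_def by (rule setsum_keys_plus_distrib) (simp_all add: rconst_add distrib_right)

lemma laurent_eval_mon: "laurent_eval r (lconst c * lmon \<nu>) = rconst c * rmonom r \<nu>"
  by (cases "c = 0") (simp_all add: laurent_eval_def lconst_lmon)

lemma laurent_eval_lmon: "laurent_eval r (lmon \<nu>) = rmonom r \<nu>"
  using laurent_eval_mon[of r 1 \<nu>] by simp

lemma laurent_eval_lconst: "laurent_eval r (lconst c) = rconst c"
  using laurent_eval_mon[of r c 0] by (simp add: rmonom_0)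

lemma laurent_eval_0 [simp]: "laurent_eval r 0 = 0"
  by (simp add: laurent_eval_def)

lemma laurent_eval_mult: "laurent_eval r (p * q) = laurent_eval r p * laurent_eval r q"
proof (induction p rule: laurent_induct)
  case (mon c \<nu>)
  show ?case
  proof (induction q rule: laurent_induct)
    case (mon d \<mu>)
    have "lconst c * lmon \<nu> * (lconst d * lmon \<mu>) = lconst (c * d) * lmon (\<nu> + \<mu>)"
      by (simp add: lconst_mult lmon_mult[symmetric] ac_simps)
    then show ?case by (simp only: laurent_eval_mon rconst_mult rmonom_add ac_simps)
  qed (simp add: distrib_left laurent_eval_add)
qed (simp add: distrib_right laurent_eval_add)

lemma laurent_eval_uminus: "laurent_eval r (- p) = - laurent_eval r p"
  using laurent_eval_add[of r p "- p"] by (simp add: add_eq_0_iff)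

lemma laurent_eval_diff: "laurent_eval r (p - q) = laurent_eval r p - laurent_eval r q"
  using laurent_eval_add[of r p "- q"] by (simp add: laurent_eval_uminus)

lemma laurent_eval_sum: "laurent_eval r (sum f A) = (\<Sum>a\<in>A. laurent_eval r (f a))"
  by (induction A rule: infinite_finite_induct) (simp_all add: laurent_eval_add)

lemma laurent_eval_field: "laurent_eval r p \<in> ratfun_field r"
  unfolding laurent_eval_def by (intro ratfun_field_sum ratfun_field_mult ratfun_field_rconst ratfun_field_rmonom)

text \<open>On 1..r+1 this is 1 - i. Consecutive exponents differ by -1, which absorbs the 1 in the
  index of the Gauss sum.\<close>

definition rho_shift :: "nat \<Rightarrow> nat \<Rightarrow> int" where
  "rho_shift r = (\<lambda>i. - w0_act r (rho r) i)"

lemma rho_shift_diff: "i \<in> {1..r} \<Longrightarrow> rho_shift r (i + 1) - rho_shift r i = -1"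
  by (auto simp: rho_shift_def w0_act_def rho_def)

definition shifted_eval :: "nat \<Rightarrow> laurent \<Rightarrow> ratfun" where
  "shifted_eval r p = rmonom r (rho_shift r) * laurent_eval r p"

lemma shifted_eval_field: "shifted_eval r p \<in> ratfun_field r"
  unfolding shifted_eval_def by (intro ratfun_field_mult ratfun_field_rmonom laurent_eval_field)

lemma shifted_eval_add: "shifted_eval r (p + q) = shifted_eval r p + shifted_eval r q"
  by (simp add: shifted_eval_def laurent_eval_add distrib_left)

text \<open>In the application Y is x^{n\<alpha>}, and with \<delta> = \<mu>_{i+1} - \<mu>_i the
  letters a, c, b, e are x to the powers \<delta>\<alpha>, -r_n(\<delta>)\<alpha>, (\<delta> -
  r_n(\<delta>))\<alpha> and (\<delta> + 1)\<alpha>. The factor 1 - vY cancels the denominator of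
  \<sigma>_i, and what remains is divisible by 1 - Y.\<close>

lemma demazure_lusztig_algebra:
  fixes f Y :: "'a::field"
  assumes "1 - Y \<noteq> 0" "1 - v * Y \<noteq> 0" "(1 - Y) * S = Y - Y * b" "cg = f * a / (1 - v * Y) * (c * (1 - v) - v * g * d * (1 - Y))"
    and "a * c = b" "Y * (a * d) = e"
  shows "(1 - v * Y) * ((f - Y * cg) / (1 - Y)) - f = f * ((1 - v) * S + v * g * e)"
proof -
  have "(1 - v * Y) * (f - Y * cg) - f * (1 - Y) = f * ((1 - v) * (Y - Y * b) + v * g * e * (1 - Y))"
    unfolding assms(5,6)[symmetric] assms(4) using assms(2) by (simp add: field_simps)
  also have "\<dots> = (f * ((1 - v) * S + v * g * e)) * (1 - Y)"
    unfolding assms(3)[symmetric] by (simp add: algebra_simps)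
  finally have "((1 - v * Y) * (f - Y * cg) - f * (1 - Y)) / (1 - Y) = f * ((1 - v) * S + v * g * e)"
    using assms(1) by simp
  moreover have "(1 - v * Y) * ((f - Y * cg) / (1 - Y)) - f = ((1 - v * Y) * (f - Y * cg) - f * (1 - Y)) / (1 - Y)"
    using assms(1) by (simp only: diff_divide_distrib[of _ "f * (1 - Y)"] times_divide_eq_right nonzero_mult_div_cancel_right not_False_eq_True)
  ultimately show ?thesis by simp
qed

context metaplectic_parameters
begin

lemma demazure_lusztig_add:
  assumes i: "i \<in> {1..r}" and "f \<in> ratfun_field r" "h \<in> ratfun_field r"
  shows "demazure_lusztig n r v g i (f + h) = demazure_lusztig n r v g i f + demazure_lusztig n r v g i h"
proof -
  have "cg_act n r v g i (f + h) = cg_act n r v g i f + cg_act n r v g i h"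
    using cg_spec_cg_act[OF i] assms(2,3) unfolding cg_spec_def by blast
  then show ?thesis
    by (simp add: demazure_lusztig_def demazure_def distrib_left add_divide_distrib diff_divide_distrib right_diff_distrib)
qed

lemma demazure_lusztig_mon:
  assumes i: "i \<in> {1..r}"
  shows "demazure_lusztig n r v g i (shifted_eval r (lconst c * lmon \<nu>)) = shifted_eval r (dlop i (lconst c * lmon \<nu>))"
proof -
  \<comment> \<open>Exponents outside 1..r+1 are cut off to make \<mu> a weight;
    \<open>rmonom\<close> does not see them.\<close>
  define \<mu> where "\<mu> = (\<lambda>j. if j \<in> {1..r+1} then \<nu> j + rho_shift r j else 0)"
  have \<mu>: "\<mu> \<in> weight_lattice r" by (auto simp: \<mu>_def weight_lattice_def)
  define f where "f = rconst c * rmonom r \<mu>"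
  have "rmonom r \<mu> = rmonom r (rho_shift r + \<nu>)"
    unfolding \<mu>_def by (subst rmonom_restrict[of r "rho_shift r + \<nu>"]) (simp add: add.commute cong: if_cong)
  then have f: "shifted_eval r (lconst c * lmon \<nu>) = f"
    by (simp add: shifted_eval_def f_def laurent_eval_mon rmonom_add ac_simps)
  define d where "d = \<mu> (i + 1) - \<mu> i"
  have dd: "\<nu> (i + 1) - \<nu> i = d + 1" using i rho_shift_diff[OF i] by (simp add: d_def \<mu>_def)
  define y where "y = (\<lambda>k. rmonom r (apow i k))"
  have ym: "root_monom i k = y k" for k unfolding y_def by (rule root_monom_rmonom[OF i])
  have y_add: "y a * y b = y (a + b)" for a b by (simp add: y_def apow_add rmonom_add)
  have cg: "cg_act n r v g i f = cg_formula n v g i \<mu> f"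
    using cg_spec_cg_act[OF i] rmonom_eigen[OF \<mu>, of c n] \<mu> unfolding cg_spec_def f_def by blast
  have perm: "perm_act (Transposition.transpose i (i + 1)) f = f * y d"
    unfolding f_def rat_homD(2,3)[OF rat_hom_perm_adj] perm_adj_rmonom[OF i]
    by (simp add: d_def y_def rmonom_add)
  have 1: "1 - y (int n) \<noteq> 0"
    using root_monom_not_const[OF n_pos, of i 1] ym by auto
  have 2: "1 - rconst v * y (int n) \<noteq> 0"
  proof
    assume "1 - rconst v * y (int n) = 0"
    then have e: "rconst v * y (int n) = 1" by simp
    then have "v \<noteq> 0" by auto
    then have "rconst (1 / v) * rconst v = 1" by (simp flip: rconst_mult)
    then have "y (int n) = rconst (1 / v) * (rconst v * y (int n))" by (simp flip: mult.assoc)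
    then show False using root_monom_not_const[OF n_pos, of i "1 / v"] by (simp add: e ym)
  qed
  \<comment> \<open>d is one less than the gap of \<nu>, so d div n is the index of
    \<open>geom_sum\<close> in \<open>dlop_factor\<close>.\<close>
  define S where "S = laurent_eval r (geom_sum n i (d div int n))"
  have S: "(1 - y (int n)) * S = y (int n) - y (int n) * y (d - d mod int n)"
  proof -
    have "laurent_eval r ((1 - lmon (apow i (int n))) * geom_sum n i (d div int n)) = y (int n) - y ((d div int n + 1) * int n)"
      unfolding geom_sum_closed by (simp add: laurent_eval_diff laurent_eval_lmon y_def)
    moreover have "laurent_eval r (1 - lmon (apow i (int n))) = 1 - y (int n)"
      using laurent_eval_lconst[of r 1] by (simp add: laurent_eval_diff laurent_eval_lmon y_def)
    moreover have "(d div int n + 1) * int n = int n + (d - d mod int n)"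
      by (simp add: distrib_right minus_mod_eq_div_mult)
    ultimately show ?thesis by (simp add: laurent_eval_mult S_def y_add)
  qed
  have cg': "cg_act n r v g i f = f * y d / (1 - rconst v * y (int n)) *
      (y (- (d mod int n)) * (1 - rconst v) - rconst v * rconst (g (1 + d)) * y (1 - int n) * (1 - y (int n)))"
  proof -
    have "1 + \<mu> (i + 1) - \<mu> i = 1 + d" by (simp add: d_def)
    then show ?thesis unfolding cg cg_formula_def perm ym d_def[symmetric] by (simp only:)
  qed
  have "demazure_lusztig n r v g i f = f * ((1 - rconst v) * S + rconst v * rconst (g (1 + d)) * y (d + 1))"
    unfolding demazure_lusztig_def demazure_def ym
    by (rule demazure_lusztig_algebra[OF 1 2 S cg']) (simp_all add: y_add)
  also have "\<dots> = shifted_eval r (dlop i (lconst c * lmon \<nu>))"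
  proof -
    have "laurent_eval r (dlop_factor i (d + 1)) = (1 - rconst v) * S + rconst v * rconst (g (1 + d)) * y (d + 1)"
      by (simp add: dlop_factor_def laurent_eval_add laurent_eval_mult laurent_eval_lconst laurent_eval_lmon S_def y_def rconst_diff rconst_mult add.commute)
    moreover have "dlop i (lconst c * lmon \<nu>) = (lconst c * lmon \<nu>) * dlop_factor i (d + 1)"
      by (simp only: dlop_single dlop_monom_def dd mult.assoc)
    ultimately show ?thesis unfolding f[symmetric] shifted_eval_def by (simp only: laurent_eval_mult mult.assoc)
  qed
  finally show ?thesis by (simp only: f)
qed

lemma demazure_lusztig_evr:
  assumes i: "i \<in> {1..r}"
  shows "demazure_lusztig n r v g i (shifted_eval r p) = shifted_eval r (dlop i p)"
  by (induction p rule: laurent_induct)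
    (simp_all only: demazure_lusztig_mon[OF i] shifted_eval_add demazure_lusztig_add[OF i shifted_eval_field shifted_eval_field] dlop_add)

lemma demazure_lusztig_perm_evr:
  assumes u: "u permutes {1..r+1}"
  shows "demazure_lusztig_perm n r v g u (shifted_eval r p) = shifted_eval r (perm_op r u p)"
proof -
  obtain ws where "inv_reduced r u ws" using inv_reduced_exists[OF u] by blast
  then have "reduced_word r u ws" by (rule reduced_word_iff[OF u, THEN iffD2])
  then have "reduced_word r u (SOME ws. reduced_word r u ws)" by (rule someI)
  then have "set (SOME ws. reduced_word r u ws) \<subseteq> {1..r}" by (simp only: reduced_word_def)
  moreover have "set ws \<subseteq> {1..r} \<Longrightarrow> foldr (\<lambda>i F. demazure_lusztig n r v g i \<circ> F) ws id (shifted_eval r p) = shifted_eval r (word_op ws p)" for ws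
    by (induction ws) (auto simp: word_op_Cons demazure_lusztig_evr)
  ultimately show ?thesis unfolding demazure_lusztig_perm_def perm_op_def by blast
qed

theorem sum_demazure_lusztig:
  assumes "\<forall>i \<in> {1..r}. lam i \<ge> lam (i + 1)"
  shows "(\<Sum>u \<in> {u. u permutes {1..r+1}}. demazure_lusztig_perm n r v g u (rmonom r (w0_act r lam))) =
         rmonom r (\<lambda>i. - w0_act r (rho r) i) *
         (\<Sum>a \<in> gt_patterns r (\<lambda>i. lam i + rho r i). rconst (gt_coeff n v g r a) * rmonom r (gt_weight r a))"
proof -
  define \<kappa> where "\<kappa> = (\<lambda>i. lam i + rho r i)"
  define \<nu> where "\<nu> = w0_act r \<kappa>"
  have "rmonom r (w0_act r lam) = shifted_eval r (lmon \<nu>)"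
    by (simp add: shifted_eval_def laurent_eval_lmon flip: rmonom_add) (simp add: rho_shift_def \<nu>_def \<kappa>_def w0_act_def plus_fun_def)
  then have "(\<Sum>u \<in> {u. u permutes {1..r+1}}. demazure_lusztig_perm n r v g u (rmonom r (w0_act r lam)))
      = (\<Sum>u \<in> {u. u permutes {1..r+1}}. shifted_eval r (perm_op r u (lmon \<nu>)))"
    by (intro sum.cong[OF refl]) (simp only: mem_Collect_eq demazure_lusztig_perm_evr)
  also have "\<dots> = shifted_eval r (symm r (lmon \<nu>))"
    by (simp add: shifted_eval_def symm_def laurent_eval_sum sum_distrib_left)
  also have "symm r (lmon \<nu>) = (\<Sum>a\<in>gt_patterns r \<kappa>. lconst (gt_coeff n v g r a) * lmon (gt_exp r a \<nu>))"
  proof (rule symm_gt_patterns)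
    show "\<kappa> (j + 1) \<le> \<kappa> j" if "j \<in> {1..r}" for j using assms that by (fastforce simp: \<kappa>_def rho_def)
    show "\<nu> i = \<kappa> (r + 2 - i)" if "i \<in> {1..r+1}" for i by (simp add: \<nu>_def w0_act_def)
  qed
  also have "shifted_eval r \<dots> = rmonom r (rho_shift r) * (\<Sum>a\<in>gt_patterns r \<kappa>. rconst (gt_coeff n v g r a) * rmonom r (gt_weight r a))"
  proof -
    have "rmonom r (gt_exp r a \<nu>) = rmonom r (gt_weight r a)" for a
      by (simp add: rmonom_def gt_exp_def)
    then show ?thesis by (simp only: shifted_eval_def laurent_eval_sum laurent_eval_mon)
  qed
  finally show ?thesis by (simp only: rho_shift_def \<kappa>_def)
qed

end

section \<open>Gauss sums\<close>

text \<open>Translation by y multiplies the sum over the whole field by \<theta>(y), which is not 1,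
  so that sum is 0; the units miss only the term at zero.\<close>

lemma (in field) sum_additive_char:
  fixes \<theta> :: "'a \<Rightarrow> complex"
  assumes fin: "finite (carrier R)"
    and add: "\<And>x y. x \<in> carrier R \<Longrightarrow> y \<in> carrier R \<Longrightarrow> \<theta> (x \<oplus> y) = \<theta> x * \<theta> y"
    and one: "\<theta> \<zero> = 1" and nontriv: "\<exists>x\<in>carrier R. \<theta> x \<noteq> 1"
  shows "(\<Sum>x\<in>Units R. \<theta> x) = -1"
proof -
  obtain y where y: "y \<in> carrier R" "\<theta> y \<noteq> 1" using nontriv by blast
  have "(\<Sum>x\<in>carrier R. \<theta> x) = (\<Sum>x\<in>carrier R. \<theta> (x \<oplus> y))"
    by (rule sum.reindex_bij_witness[of _ "\<lambda>x. x \<oplus> y" "\<lambda>x. x \<ominus> y"])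
      (use y in \<open>auto simp: a_minus_def a_assoc l_neg r_neg\<close>)
  also have "\<dots> = (\<Sum>x\<in>carrier R. \<theta> x) * \<theta> y"
    using y by (simp add: add sum_distrib_right)
  finally have "(\<Sum>x\<in>carrier R. \<theta> x) = 0" using y(2) by (simp add: mult_cancel_left1)
  moreover have "(\<Sum>x\<in>carrier R. \<theta> x) = \<theta> \<zero> + (\<Sum>x\<in>carrier R - {\<zero>}. \<theta> x)"
    using fin by (intro sum.remove) auto
  ultimately show ?thesis by (simp add: one field_Units add_eq_0_iff)
qed

text \<open>Substituting x y for x turns the product into the sum of \<chi>(x) times the sum of
  \<theta>((x + 1) y) over y, and the inner sum is -1 except at x = -1. In general the result
  carries a factor \<chi>(-1), which is 1 here.\<close>

lemma (in field) gauss_sum_product: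
  fixes \<chi> \<theta> :: "'a \<Rightarrow> complex"
  assumes fin: "finite (carrier R)"
    and mult: "\<And>x y. x \<in> Units R \<Longrightarrow> y \<in> Units R \<Longrightarrow> \<chi> (x \<otimes> y) = \<chi> x * \<chi> y"
    and nz: "\<And>x. x \<in> Units R \<Longrightarrow> \<chi> x \<noteq> 0"
    and nontriv': "\<exists>x\<in>Units R. \<chi> x \<noteq> 1" and minus: "\<chi> (\<ominus> \<one>) = 1"
    and add: "\<And>x y. x \<in> carrier R \<Longrightarrow> y \<in> carrier R \<Longrightarrow> \<theta> (x \<oplus> y) = \<theta> x * \<theta> y"
    and one: "\<theta> \<zero> = 1" and nontriv: "\<exists>x\<in>carrier R. \<theta> x \<noteq> 1"
  shows "(\<Sum>x\<in>Units R. \<chi> x * \<theta> x) * (\<Sum>x\<in>Units R. inverse (\<chi> x) * \<theta> x) = of_nat (card (carrier R))"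
proof -
  let ?U = "Units R"
  have finU: "finite ?U" using fin by (simp add: field_Units)
  have UC: "x \<in> carrier R" if "x \<in> ?U" for x using that by auto
  have reindex: "(\<Sum>x\<in>?U. F (x \<otimes> y)) = (\<Sum>x\<in>?U. F x)" if y: "y \<in> ?U" for y and F :: "'a \<Rightarrow> complex"
    by (rule sum.reindex_bij_witness[of _ "\<lambda>x. x \<otimes> inv y" "\<lambda>x. x \<otimes> y"])
      (use y in \<open>auto simp: m_assoc UC\<close>)
  obtain y where y: "y \<in> ?U" "\<chi> y \<noteq> 1" using nontriv' by blast
  have "(\<Sum>x\<in>?U. \<chi> x) = (\<Sum>x\<in>?U. \<chi> x) * \<chi> y"
    using reindex[OF y(1), of \<chi>] y(1) by (simp add: mult sum_distrib_right)
  then have sum\<chi>: "(\<Sum>x\<in>?U. \<chi> x) = 0" using y(2) by (simp add: mult_cancel_left1)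
  have minus_U: "\<ominus> \<one> \<in> ?U" by (simp add: Units_minus_one_closed)
  have inner: "(\<Sum>y\<in>?U. \<theta> ((x \<oplus> \<one>) \<otimes> y)) = (if x = \<ominus> \<one> then of_nat (card ?U) else -1)" if x: "x \<in> ?U" for x
  proof (cases "x = \<ominus> \<one>")
    case True
    then have "x \<oplus> \<one> = \<zero>" by (simp add: l_neg)
    moreover have "(\<Sum>y\<in>?U. \<theta> (\<zero> \<otimes> y)) = (\<Sum>y\<in>?U. 1)"
      by (rule sum.cong[OF refl]) (simp add: UC one)
    ultimately show ?thesis using True by simp
  next
    case False
    have "x \<oplus> \<one> \<noteq> \<zero>"
    proof
      assume "x \<oplus> \<one> = \<zero>"
      then have "x = \<ominus> \<one>" using x by (metis UC minus_equality one_closed a_comm minus_minus)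
      then show False using False by simp
    qed
    then have u: "x \<oplus> \<one> \<in> ?U" using x by (simp add: field_Units)
    have "(\<Sum>y\<in>?U. \<theta> ((x \<oplus> \<one>) \<otimes> y)) = (\<Sum>y\<in>?U. \<theta> (y \<otimes> (x \<oplus> \<one>)))"
      by (rule sum.cong[OF refl]) (use x in \<open>simp add: m_comm UC\<close>)
    also have "\<dots> = -1" unfolding reindex[OF u] by (rule sum_additive_char[OF fin add one nontriv])
    finally show ?thesis using False by simp
  qed
  have "(\<Sum>x\<in>?U. \<chi> x * \<theta> x) * (\<Sum>x\<in>?U. inverse (\<chi> x) * \<theta> x)
     = (\<Sum>y\<in>?U. \<Sum>x\<in>?U. \<chi> x * \<theta> x * (inverse (\<chi> y) * \<theta> y))"
    by (simp add: sum_product) (rule sum.swap)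
  also have "\<dots> = (\<Sum>y\<in>?U. \<Sum>x\<in>?U. \<chi> (x \<otimes> y) * \<theta> (x \<otimes> y) * (inverse (\<chi> y) * \<theta> y))"
    by (rule sum.cong[OF refl], rule reindex[symmetric])
  also have "\<dots> = (\<Sum>y\<in>?U. \<Sum>x\<in>?U. \<chi> x * \<theta> ((x \<oplus> \<one>) \<otimes> y))"
  proof (intro sum.cong[OF refl])
    fix y x assume xy: "y \<in> ?U" "x \<in> ?U"
    have "\<theta> ((x \<oplus> \<one>) \<otimes> y) = \<theta> (x \<otimes> y) * \<theta> y" using xy by (simp add: l_distr add UC)
    then show "\<chi> (x \<otimes> y) * \<theta> (x \<otimes> y) * (inverse (\<chi> y) * \<theta> y) = \<chi> x * \<theta> ((x \<oplus> \<one>) \<otimes> y)"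
      using xy nz[of y] by (simp add: mult)
  qed
  also have "\<dots> = (\<Sum>x\<in>?U. \<chi> x * (\<Sum>y\<in>?U. \<theta> ((x \<oplus> \<one>) \<otimes> y)))"
    by (subst sum.swap) (simp add: sum_distrib_left)
  also have "\<dots> = (\<Sum>x\<in>?U. - \<chi> x + (if x = \<ominus> \<one> then of_nat (card ?U + 1) else 0))"
    by (rule sum.cong[OF refl]) (auto simp: inner minus algebra_simps)
  also have "\<dots> = of_nat (card ?U + 1)"
    unfolding sum.distrib sum_negf sum\<chi> using minus_U finU by simp
  also have "card ?U + 1 = card (carrier R)"
    using fin by (simp add: field_Units card_Diff_singleton) (metis card_Suc_Diff1 zero_closed Suc_pred card_gt_0_iff empty_iff)
  finally show ?thesis .
qed

lemma algebraic_int_root_of_unity: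
  fixes z :: "'f::field_char_0"
  assumes "n \<ge> 1" "z ^ n = 1"
  shows "algebraic_int z"
  by (rule algebraic_int_root[of 1 "Polynomial.monom 1 n"])
    (use assms in \<open>auto simp: Polynomial.poly_monom Polynomial.degree_monom_eq\<close>)

section \<open>The residue field at p\<close>

context metaplectic_data
begin

definition "oS = S_integers S"
definition "oS_ring = subring_of (S_integers S)"
definition "p_ideal = cgenideal oS_ring p"
definition "resF = residue_ring_at S p"
definition "\<pi> x = a_r_coset oS_ring p_ideal x"
definition "q = residue_card S p"

lemma oS_ring_simps [simp]: "carrier oS_ring = oS" "x \<otimes>\<^bsub>oS_ring\<^esub> y = x * y" "x \<oplus>\<^bsub>oS_ring\<^esub> y = x + y" "\<one>\<^bsub>oS_ring\<^esub> = 1" "\<zero>\<^bsub>oS_ring\<^esub> = 0"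
  by (simp_all add: oS_ring_def oS_def subring_of_def)

lemma pid: "principal_domain oS_ring"
  using S_pid by (simp add: oS_ring_def)

interpretation oS_ring: principal_domain oS_ring
  by (rule pid)

lemma oS_ring_minus: "x \<in> oS \<Longrightarrow> \<ominus>\<^bsub>oS_ring\<^esub> x = - x"
  using oS_ring.minus_equality[of "\<ominus>\<^bsub>oS_ring\<^esub> x" "x"] oS_ring.l_neg[of x] by (simp add: add_eq_0_iff2)

lemma oS_closed: "x \<in> oS \<Longrightarrow> y \<in> oS \<Longrightarrow> x + y \<in> oS" "x \<in> oS \<Longrightarrow> y \<in> oS \<Longrightarrow> x * y \<in> oS"
  "1 \<in> oS" "0 \<in> oS" "x \<in> oS \<Longrightarrow> - x \<in> oS" "x \<in> oS \<Longrightarrow> y \<in> oS \<Longrightarrow> x - y \<in> oS"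
proof -
  show a: "x \<in> oS \<Longrightarrow> y \<in> oS \<Longrightarrow> x + y \<in> oS" "x \<in> oS \<Longrightarrow> y \<in> oS \<Longrightarrow> x * y \<in> oS" "1 \<in> oS" "0 \<in> oS" for x y
    using oS_ring.a_closed[of x y] oS_ring.m_closed[of x y] oS_ring.one_closed oS_ring.zero_closed by simp_all
  show b: "x \<in> oS \<Longrightarrow> - x \<in> oS" for x using oS_ring.a_inv_closed[of x] oS_ring_minus[of x] by simp
  show "x \<in> oS \<Longrightarrow> y \<in> oS \<Longrightarrow> x - y \<in> oS" using a(1)[of x "-y"] b[of y] by simp
qed

lemma p_oS: "p \<in> oS"
  using p_carrier by (simp add: oS_def)

lemma p_nz: "p \<noteq> 0"
  using p_prime by (simp add: ring_prime_def subring_of_def)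

lemma p_ideal_iff: "x \<in> p_ideal \<longleftrightarrow> (\<exists>a\<in>oS. x = a * p)"
  by (auto simp: p_ideal_def cgenideal_def)

lemma p_ideal_eq: "p_ideal = cgenideal (subring_of (S_integers S)) p"
  by (simp add: p_ideal_def oS_ring_def)

lemma ideal_IP: "ideal p_ideal oS_ring"
  unfolding p_ideal_def by (rule oS_ring.cgenideal_ideal) (simp add: p_oS)

lemma resF_eq: "resF = oS_ring Quot p_ideal"
  by (simp add: resF_def residue_ring_at_def oS_ring_def p_ideal_def)

lemma field_KP: "field resF"
proof -
  have "p \<in> carrier oS_ring - {\<zero>\<^bsub>oS_ring\<^esub>}" using p_oS p_nz by simp
  from oS_ring.field_iff_prime[OF this] show ?thesis
    unfolding resF_eq p_ideal_def using p_prime by (simp only: oS_ring_def)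
qed

interpretation resF: field resF
  by (rule field_KP)

interpretation pi: ring_hom_ring oS_ring resF \<pi>
  using ideal.rcos_ring_hom_ring[OF ideal_IP] unfolding resF_eq \<pi>_def[abs_def] .

lemma p_ideal_closed: "x \<in> p_ideal \<Longrightarrow> y \<in> p_ideal \<Longrightarrow> x + y \<in> p_ideal" "x \<in> p_ideal \<Longrightarrow> - x \<in> p_ideal" "0 \<in> p_ideal"
  "x \<in> p_ideal \<Longrightarrow> y \<in> oS \<Longrightarrow> x * y \<in> p_ideal" "x \<in> p_ideal \<Longrightarrow> x \<in> oS"
proof -
  show "x \<in> p_ideal \<Longrightarrow> y \<in> p_ideal \<Longrightarrow> x + y \<in> p_ideal"
    unfolding p_ideal_iff by (metis distrib_right oS_closed(1))
  show "x \<in> p_ideal \<Longrightarrow> - x \<in> p_ideal"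
    unfolding p_ideal_iff by (metis mult_minus_left oS_closed(5))
  show "0 \<in> p_ideal" unfolding p_ideal_iff using oS_closed(4) by force
  show "x \<in> p_ideal \<Longrightarrow> y \<in> oS \<Longrightarrow> x * y \<in> p_ideal"
    unfolding p_ideal_iff by (metis mult.assoc mult.commute oS_closed(2))
  show "x \<in> p_ideal \<Longrightarrow> x \<in> oS" unfolding p_ideal_iff using p_oS oS_closed(2) by blast
qed

lemma pi_image: "\<pi> x = (\<lambda>i. i + x) ` p_ideal"
  by (auto simp: \<pi>_def a_r_coset_def')

lemma in_pi_iff: "y \<in> \<pi> x \<longleftrightarrow> y - x \<in> p_ideal"
  unfolding pi_image by (force simp: image_iff)

lemma pi_eq_iff: "\<pi> x = \<pi> y \<longleftrightarrow> x - y \<in> p_ideal"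
proof
  assume "\<pi> x = \<pi> y"
  moreover have "x \<in> \<pi> x" by (simp add: in_pi_iff p_ideal_closed(3))
  ultimately show "x - y \<in> p_ideal" using in_pi_iff by blast
next
  assume xy: "x - y \<in> p_ideal"
  have "z - x \<in> p_ideal \<longleftrightarrow> z - y \<in> p_ideal" for z
    using p_ideal_closed(1)[of "z - x" "x - y"] p_ideal_closed(1)[of "z - y" "- (x - y)"] p_ideal_closed(2)[OF xy] xy by auto
  then show "\<pi> x = \<pi> y" by (auto simp: in_pi_iff)
qed

lemma resF_carrier: "carrier resF = \<pi> ` oS"
  unfolding resF_eq FactRing_def A_RCOSETS_def' \<pi>_def by auto

lemma rep:
  assumes "B \<in> carrier resF"
  shows "(SOME b. b \<in> B) \<in> oS" "\<pi> (SOME b. b \<in> B) = B"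
proof -
  obtain x where x: "x \<in> oS" "B = \<pi> x" using assms unfolding resF_carrier by blast
  have "x \<in> B" unfolding x(2) by (simp add: in_pi_iff p_ideal_closed(3))
  then have "(SOME b. b \<in> B) \<in> B" by (rule someI)
  then have b: "(SOME b. b \<in> B) - x \<in> p_ideal" unfolding x(2) in_pi_iff .
  then show "\<pi> (SOME b. b \<in> B) = B" unfolding x(2) pi_eq_iff .
  show "(SOME b. b \<in> B) \<in> oS" using oS_closed(1)[OF p_ideal_closed(5)[OF b] x(1)] by simp
qed

lemma pi_pow: "x \<in> oS \<Longrightarrow> \<pi> (x ^ k) = \<pi> x [^]\<^bsub>resF\<^esub> k"
proof (induction k)
  case 0
  then show ?case using pi.hom_one by simp
next
  case (Suc k)
  have "x ^ k \<in> oS" using Suc.prems by (induction k) (simp_all add: oS_closed)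
  then show ?case using Suc pi.hom_mult[of "x ^ k" x] by (simp add: mult.commute)
qed

lemma q_card: "card (carrier resF) = q"
  by (simp add: q_def residue_card_def resF_def)

text \<open>An infinite residue ring would have \<open>card\<close> 0, which the congruence modulo
  2n excludes; finiteness in \<open>fin_KP\<close> comes from here.\<close>

lemma q_dvd: "2 * n dvd q - 1" and q_pos: "q \<ge> 1"
proof -
  show "q \<ge> 1"
  proof (rule ccontr)
    assume "\<not> q \<ge> 1"
    then have "[0 = 1] (mod (2 * n))" using q_cong by (cases "residue_card S p") (simp_all add: q_def)
    then show False using n_pos by (simp add: cong_def mod_eq_self_iff_div_eq_0)
  qed
  then show "2 * n dvd q - 1"
    using q_cong cong_altdef_nat[of 1 q "2 * n"] by (simp add: q_def)
qed

lemma fin_KP: "finite (carrier resF)"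
  using q_pos q_card by (metis card.infinite not_one_le_zero)


section \<open>Roots of unity modulo p and the power residue symbol\<close>

definition "\<mu>n = {z::'f. z ^ n = 1}"

text \<open>Roots of unity are algebraic integers, hence integral at every place with denominator
  1.\<close>

lemma mu_oS: "z \<in> \<mu>n \<Longrightarrow> z \<in> oS"
  unfolding oS_def S_integers_def
proof (intro CollectI ballI)
  fix P :: "'f set" assume z: "z \<in> \<mu>n" and P: "P \<in> finite_places - S"
  have prime: "primeideal P (subring_of integers_of_field)" using P by (simp add: finite_places_def)
  have "1 \<notin> P"
  proof
    assume "1 \<in> P"
    then have "\<one>\<^bsub>subring_of integers_of_field\<^esub> \<in> P" by (simp add: subring_of_def)
    then show False using ideal.one_imp_carrier[OF primeideal.axioms(1)[OF prime]] primeideal.I_notcarr[OF prime] by blast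
  qed
  moreover have "z \<in> integers_of_field" "1 \<in> integers_of_field"
    using algebraic_int_root_of_unity[OF n_pos, of z] z by (simp_all add: integers_of_field_def \<mu>n_def)
  ultimately show "\<exists>a \<in> integers_of_field. \<exists>b \<in> integers_of_field - P. z = a / b" by (metis DiffI div_by_1)
qed

text \<open>Squaring maps the 2n-th roots of unity into the n-th ones with fibres of at most two
  elements, which gives the lower bound.\<close>

lemma mu_finite: "finite \<mu>n" and mu_card: "card \<mu>n \<ge> n"
proof -
  let ?M = "{z::'f. z ^ (2 * n) = 1}"
  have finM: "finite ?M" using roots_of_unity n_pos card.infinite[of ?M] by fastforce
  have "\<mu>n \<subseteq> ?M" by (auto simp: \<mu>n_def mult.commute[of 2] power_mult)
  then show "finite \<mu>n" using finM by (rule finite_subset)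
  have sq: "(\<lambda>z. z ^ 2) ` ?M \<subseteq> \<mu>n" by (auto simp: \<mu>n_def power_mult)
  have fib: "card {z \<in> ?M. z ^ 2 = w} \<le> 2" for w
  proof (cases "\<exists>z. z ^ 2 = w")
    case True
    then obtain z where z: "z ^ 2 = w" by blast
    have "{z \<in> ?M. z ^ 2 = w} \<subseteq> {z, - z}" using z by (auto simp: power2_eq_iff)
    then have "card {z \<in> ?M. z ^ 2 = w} \<le> card {z, - z}" by (intro card_mono) auto
    also have "\<dots> \<le> 2" by (simp add: card_insert_if)
    finally show ?thesis .
  qed (simp add: Collect_conv_if)
  have "card ?M = (\<Sum>w\<in>(\<lambda>z. z ^ 2) ` ?M. card {z \<in> ?M. z ^ 2 = w})"
    using sum.image_gen[OF finM, of "\<lambda>_. 1::nat" "\<lambda>z. z ^ 2"] by simp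
  also have "\<dots> \<le> (\<Sum>w\<in>(\<lambda>z. z ^ 2) ` ?M. 2)" by (rule sum_mono[OF fib])
  also have "\<dots> = 2 * card ((\<lambda>z. z ^ 2) ` ?M)" by simp
  also have "\<dots> \<le> 2 * card \<mu>n" using card_mono[OF \<open>finite \<mu>n\<close> sq] by simp
  finally show "card \<mu>n \<ge> n" using roots_of_unity by simp
qed

lemma of_nat_oS: "of_nat k \<in> oS"
  by (induction k) (simp_all add: oS_closed)

lemma one_notin_IP: "1 \<notin> p_ideal"
proof
  assume "1 \<in> p_ideal"
  then have "\<pi> 1 = \<pi> 0" by (simp add: pi_eq_iff)
  then show False using pi.hom_one pi.hom_zero resF.one_not_zero by simp
qed

lemma q_IP: "of_nat q \<in> p_ideal"
proof -
  have "\<pi> (of_nat k) = [k] \<cdot>\<^bsub>resF\<^esub> \<one>\<^bsub>resF\<^esub>" for k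
    by (induction k) (use pi.hom_add[OF of_nat_oS[unfolded oS_ring_simps(1)[symmetric]], of 1] pi.hom_one pi.hom_zero oS_closed(3) resF.add.m_comm in
        \<open>simp_all add: of_nat_oS add.commute[of 1]\<close>)
  moreover have "[q] \<cdot>\<^bsub>resF\<^esub> \<one>\<^bsub>resF\<^esub> = \<zero>\<^bsub>resF\<^esub>"
    using resF.add.pow_order_eq_1[of "\<one>\<^bsub>resF\<^esub>"] q_card by (simp add: order_def)
  ultimately have "\<pi> (of_nat q) = \<pi> 0" using pi.hom_zero by simp
  then show ?thesis by (simp add: pi_eq_iff)
qed

text \<open>If w = x / y differs from 1 but is congruent to 1 modulo p, then 0 = 1 + w + ... +
  w^{n-1} is congruent to n. So n lies in (p), and so does q; as q = 1 mod n, also 1 would lie in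
  (p).\<close>

lemma mu_inj: "inj_on \<pi> \<mu>n"
proof (rule inj_onI)
  fix x y assume xy: "x \<in> \<mu>n" "y \<in> \<mu>n" "\<pi> x = \<pi> y"
  have ynz: "y \<noteq> 0" using xy(2) n_pos by (auto simp: \<mu>n_def power_0_left)
  have iy: "inverse y \<in> \<mu>n" using xy(2) by (simp add: \<mu>n_def power_inverse)
  define w where "w = x * inverse y"
  have w: "w \<in> \<mu>n" using xy(1) iy by (simp add: w_def \<mu>n_def power_mult_distrib)
  have "w - 1 = (x - y) * inverse y" using ynz by (simp add: w_def left_diff_distrib)
  then have w1: "w - 1 \<in> p_ideal" using xy(3) p_ideal_closed(4) mu_oS[OF iy] by (simp add: pi_eq_iff)
  have "w = 1"
  proof (rule ccontr)
    assume ne: "w \<noteq> 1"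
    have "(\<Sum>k<n. w ^ k) = 0" using geometric_sum[OF ne, of n] w by (simp add: \<mu>n_def)
    moreover have "w ^ k - 1 \<in> p_ideal" for k
    proof -
      have "\<pi> (w ^ k) = \<pi> 1 [^]\<^bsub>resF\<^esub> k" using w1 pi_pow[OF mu_oS[OF w]] by (simp add: pi_eq_iff[symmetric])
      also have "\<dots> = \<pi> 1" using pi_pow[OF oS_closed(3), of k] by simp
      finally show ?thesis by (simp add: pi_eq_iff)
    qed
    then have "(\<Sum>k<m. w ^ k - 1) \<in> p_ideal" for m by (induction m) (simp_all add: p_ideal_closed)
    then have "(\<Sum>k<n. w ^ k) - of_nat n \<in> p_ideal" by (simp add: sum_subtractf)
    ultimately have nI: "of_nat n \<in> p_ideal" using p_ideal_closed(2)[of "- of_nat n"] by simp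
    obtain t where t: "q - 1 = 2 * n * t" using q_dvd by (auto elim: dvdE)
    have "q = n * (2 * t) + 1" using t q_pos by simp
    then have "(of_nat q :: 'f) = of_nat n * of_nat (2 * t) + 1" by (metis of_nat_1 of_nat_add of_nat_mult)
    then have "(1::'f) = of_nat q + - (of_nat n * of_nat (2 * t))" by simp
    also have "\<dots> \<in> p_ideal" by (intro p_ideal_closed(1)[OF q_IP] p_ideal_closed(2) p_ideal_closed(4)[OF nI] of_nat_oS)
    finally show False using one_notin_IP by simp
  qed
  then show "x = y" using ynz by (simp add: w_def field_simps)
qed

text \<open>The exponent in the power residue symbol. It is even because q = 1 mod 2n, and this
  makes the symbol of -1 trivial.\<close>

definition "N = (q - 1) div n"

lemma N_props: "N * n = q - 1" "even N" "N \<ge> 1"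
proof -
  obtain t where t: "q - 1 = 2 * n * t" using q_dvd by (auto elim: dvdE)
  then have N: "N = 2 * t" using n_pos by (simp add: N_def)
  then show "N * n = q - 1" "even N" using t by (simp_all add: mult.commute)
  have "card {\<zero>\<^bsub>resF\<^esub>, \<one>\<^bsub>resF\<^esub>} \<le> card (carrier resF)" by (rule card_mono[OF fin_KP]) simp
  then have "q \<ge> 2" using q_card resF.one_not_zero by (simp add: card_insert_if)
  then have "t \<noteq> 0" using t by (cases t) auto
  then show "N \<ge> 1" using N by simp
qed

lemma Units_pow: "B \<in> Units resF \<Longrightarrow> B [^]\<^bsub>resF\<^esub> (q - 1) = \<one>\<^bsub>resF\<^esub>"
  using group.pow_order_eq_1[OF resF.field_mult_group, of B] resF.order_mult_of[OF fin_KP] q_card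
  by (simp add: resF.field_Units Multiplicative_Group.nat_pow_mult_of order_def)

text \<open>By counting: reduction is injective on the n-th roots of unity of F, which number at
  least n, while X^n - 1 has at most n roots in the residue field. So every root lifts.\<close>

lemma mu_image: "\<pi> ` \<mu>n = {x \<in> carrier resF. x [^]\<^bsub>resF\<^esub> n = \<one>\<^bsub>resF\<^esub>}"
proof (rule card_seteq)
  show "finite {x \<in> carrier resF. x [^]\<^bsub>resF\<^esub> n = \<one>\<^bsub>resF\<^esub>}" using fin_KP by simp
  show "\<pi> ` \<mu>n \<subseteq> {x \<in> carrier resF. x [^]\<^bsub>resF\<^esub> n = \<one>\<^bsub>resF\<^esub>}"
    using mu_oS pi_pow[of _ n] pi.hom_one resF_carrier by (force simp: \<mu>n_def)
  show "card {x \<in> carrier resF. x [^]\<^bsub>resF\<^esub> n = \<one>\<^bsub>resF\<^esub>} \<le> card (\<pi> ` \<mu>n)"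
    using resF.num_roots_le_deg[OF fin_KP, of n] n_pos mu_card by (simp add: card_image[OF mu_inj])
qed

definition "residue_symbol B = power_residue n S p (SOME b. b \<in> B)"

lemma residue_symbol_eqI:
  assumes B: "B \<in> Units resF" and z: "z \<in> \<mu>n" "\<pi> z = B [^]\<^bsub>resF\<^esub> N"
  shows "residue_symbol B = z"
proof -
  let ?b = "SOME b. b \<in> B"
  have b: "?b \<in> oS" "\<pi> ?b = B" using rep[of B] B by auto
  have iff: "x - ?b ^ N \<in> p_ideal \<longleftrightarrow> \<pi> x = B [^]\<^bsub>resF\<^esub> N" for x
    using pi_pow[OF b(1), of N] b(2) by (simp add: pi_eq_iff[symmetric])
  show ?thesis unfolding residue_symbol_def power_residue_def p_ideal_eq[symmetric] q_def[symmetric] N_def[symmetric]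
  proof (rule the_equality)
    show "z ^ n = 1 \<and> z - ?b ^ N \<in> p_ideal" using z iff by (simp add: \<mu>n_def)
    show "x = z" if "x ^ n = 1 \<and> x - ?b ^ N \<in> p_ideal" for x
      using inj_onD[OF mu_inj, of x z] that z iff by (simp add: \<mu>n_def)
  qed
qed

lemma residue_symbol: 
  assumes B: "B \<in> Units resF"
  shows "residue_symbol B \<in> \<mu>n" "\<pi> (residue_symbol B) = B [^]\<^bsub>resF\<^esub> N"
proof -
  have "(B [^]\<^bsub>resF\<^esub> N) [^]\<^bsub>resF\<^esub> n = \<one>\<^bsub>resF\<^esub>"
    using B Units_pow[OF B] by (simp add: resF.nat_pow_pow N_props resF.Units_closed)
  then have "B [^]\<^bsub>resF\<^esub> N \<in> \<pi> ` \<mu>n" unfolding mu_image using B by (simp add: resF.Units_closed)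
  then obtain z where "z \<in> \<mu>n" "\<pi> z = B [^]\<^bsub>resF\<^esub> N" by force
  then show "residue_symbol B \<in> \<mu>n" "\<pi> (residue_symbol B) = B [^]\<^bsub>resF\<^esub> N" using residue_symbol_eqI[OF B] by auto
qed

lemma residue_symbol_mult:
  assumes B: "B \<in> Units resF" and C: "C \<in> Units resF"
  shows "residue_symbol (B \<otimes>\<^bsub>resF\<^esub> C) = residue_symbol B * residue_symbol C"
proof (rule residue_symbol_eqI)
  show "B \<otimes>\<^bsub>resF\<^esub> C \<in> Units resF" using B C by simp
  show "residue_symbol B * residue_symbol C \<in> \<mu>n" using residue_symbol(1)[OF B] residue_symbol(1)[OF C] by (simp add: \<mu>n_def power_mult_distrib)
  show "\<pi> (residue_symbol B * residue_symbol C) = (B \<otimes>\<^bsub>resF\<^esub> C) [^]\<^bsub>resF\<^esub> N"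
    using pi.hom_mult[of "residue_symbol B" "residue_symbol C"] mu_oS residue_symbol[OF B] residue_symbol[OF C] B C
    by (simp add: resF.nat_pow_distrib resF.Units_closed)
qed

lemma eps_pow: "z \<in> \<mu>n \<Longrightarrow> \<epsilon> (z ^ k) = \<epsilon> z ^ k"
proof (induction k)
  case (Suc k)
  have "(z ^ k) ^ n = (z ^ n) ^ k" by (simp only: power_mult[symmetric] mult.commute)
  then have "(z ^ k) ^ n = 1" using Suc.prems by (simp add: \<mu>n_def)
  then show ?case using Suc eps_mult[of z "z ^ k"] by (simp add: \<mu>n_def)
qed (simp add: eps_one)

lemma eps_root: "z \<in> \<mu>n \<Longrightarrow> \<epsilon> z ^ n = 1"
  using eps_pow[of z n] eps_one by (simp add: \<mu>n_def)

lemma eps_nz: "z \<in> \<mu>n \<Longrightarrow> \<epsilon> z \<noteq> 0"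
  using eps_root[of z] n_pos by (auto simp: power_0_left)

lemma eps_powi_cong: 
  assumes "z \<in> \<mu>n" "[a = b] (mod int n)"
  shows "\<epsilon> z powi a = \<epsilon> z powi b"
proof -
  obtain k where "a = b + int n * k" using assms(2) by (metis cong_iff_lin cong_sym)
  then have "\<epsilon> z powi a = \<epsilon> z powi b * (\<epsilon> z powi int n) powi k"
    using eps_nz[OF assms(1)] by (simp add: power_int_add power_int_mult)
  then show ?thesis using eps_root[OF assms(1)] by simp
qed

section \<open>The additive character and the Gauss sums\<close>

definition "add_char B = \<psi> ((SOME b. b \<in> B) / p)"

lemma gauss_sum_eq: "gauss_sum n S \<psi> \<epsilon> p j = (\<Sum>B\<in>Units resF. \<epsilon> (residue_symbol B) powi j * add_char B)"
  by (simp add: gauss_sum_def resF_def residue_symbol_def add_char_def Let_def)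

lemma psi_oS: "x \<in> oS \<Longrightarrow> \<psi> x = 1"
  using psi_conductor oS_closed(3) unfolding oS_def by force

lemma psi_cong: "x - y \<in> p_ideal \<Longrightarrow> \<psi> (x / p) = \<psi> (y / p)"
proof -
  assume "x - y \<in> p_ideal"
  then obtain a where a: "a \<in> oS" "x - y = a * p" by (auto simp: p_ideal_iff)
  then have "x / p = a + y / p" using p_nz by (simp add: field_simps)
  then show ?thesis using psi_add[of a "y / p"] psi_oS[OF a(1)] by simp
qed

lemma add_char_pi: "x \<in> oS \<Longrightarrow> add_char (\<pi> x) = \<psi> (x / p)"
  unfolding add_char_def using rep[of "\<pi> x"] resF_carrier by (intro psi_cong) (simp add: pi_eq_iff[symmetric])

lemma add_char_add: "B \<in> carrier resF \<Longrightarrow> C \<in> carrier resF \<Longrightarrow> add_char (B \<oplus>\<^bsub>resF\<^esub> C) = add_char B * add_char C"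
proof -
  assume "B \<in> carrier resF" "C \<in> carrier resF"
  then obtain x y where xy: "x \<in> oS" "B = \<pi> x" "y \<in> oS" "C = \<pi> y" unfolding resF_carrier by blast
  have "B \<oplus>\<^bsub>resF\<^esub> C = \<pi> (x + y)" using pi.hom_add[of x y] xy by simp
  then show ?thesis using xy add_char_pi oS_closed(1) psi_add by (simp add: add_divide_distrib)
qed

lemma add_char_zero: "add_char \<zero>\<^bsub>resF\<^esub> = 1"
  using add_char_pi[OF oS_closed(4)] pi.hom_zero psi_oS[OF oS_closed(4)] by simp

text \<open>A trivial character would, by the conductor condition, put 1/p into the ring of
  S-integers and make p a unit.\<close>

lemma add_char_nontrivial: "\<exists>B\<in>carrier resF. add_char B \<noteq> 1"
proof (rule ccontr)
  assume "\<not> ?thesis"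
  then have "\<psi> (x / p) = 1" if "x \<in> oS" for x using add_char_pi[OF that] resF_carrier that by auto
  then have "1 / p \<in> {x. \<forall>a \<in> S_integers S. \<psi> (x * a) = 1}" by (simp add: oS_def)
  then have "1 / p \<in> oS" using psi_conductor by (simp add: oS_def)
  then have "1 \<in> p_ideal" unfolding p_ideal_iff using p_nz by force
  then show False using one_notin_IP by simp
qed

lemma gauss_sum_0: "gauss_sum n S \<psi> \<epsilon> p 0 = -1"
  using resF.sum_additive_char[OF fin_KP add_char_add add_char_zero add_char_nontrivial] by (simp add: gauss_sum_eq)

lemma gauss_sum_cong: "[a = b] (mod int n) \<Longrightarrow> gauss_sum n S \<psi> \<epsilon> p a = gauss_sum n S \<psi> \<epsilon> p b"
  unfolding gauss_sum_eq by (intro sum.cong[OF refl]) (simp add: eps_powi_cong[OF residue_symbol(1)])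

text \<open>If the j-th power of the symbol were trivial, injectivity of \<epsilon> would carry this
  back to F, and all q - 1 units would be roots of X^{Nk} - 1 with k = j mod n. But N k < N n = q -
  1.\<close>

lemma char_nontrivial:
  assumes "\<not> int n dvd j"
  shows "\<exists>B\<in>Units resF. \<epsilon> (residue_symbol B) powi j \<noteq> 1"
proof (rule ccontr)
  assume neg: "\<not> ?thesis"
  define k where "k = nat (j mod int n)"
  have k: "int k = j mod int n" "k < n" "k \<noteq> 0"
  proof -
    have "0 \<le> j mod int n" "j mod int n < int n" "j mod int n \<noteq> 0"
      using n_pos assms by (simp_all add: dvd_eq_mod_eq_0)
    then show "int k = j mod int n" "k < n" "k \<noteq> 0" by (simp_all add: k_def nat_less_iff)
  qed
  have "B [^]\<^bsub>resF\<^esub> (N * k) = \<one>\<^bsub>resF\<^esub>" if B: "B \<in> Units resF" for B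
  proof -
    have "\<epsilon> (residue_symbol B) powi int k = 1" using neg B eps_powi_cong[OF residue_symbol(1)[OF B], of "int k" j] k(1) by (auto simp: cong_def)
    then have "\<epsilon> (residue_symbol B ^ k) = \<epsilon> 1" using eps_pow[OF residue_symbol(1)[OF B]] eps_one by simp
    moreover have "(residue_symbol B ^ k) ^ n = (residue_symbol B ^ n) ^ k" by (simp only: power_mult[symmetric] mult.commute)
    then have "(residue_symbol B ^ k) ^ n = 1" using residue_symbol(1)[OF B] by (simp add: \<mu>n_def)
    ultimately have "residue_symbol B ^ k = 1" using inj_onD[OF eps_inj, of "residue_symbol B ^ k" 1] by simp
    then have "\<pi> (residue_symbol B) [^]\<^bsub>resF\<^esub> k = \<one>\<^bsub>resF\<^esub>" using pi_pow[OF mu_oS[OF residue_symbol(1)[OF B]], of k] pi.hom_one by simp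
    then show ?thesis using residue_symbol(2)[OF B] B by (simp add: resF.nat_pow_pow resF.Units_closed)
  qed
  then have "Units resF \<subseteq> {x \<in> carrier resF. x [^]\<^bsub>resF\<^esub> (N * k) = \<one>\<^bsub>resF\<^esub>}" by (auto simp: resF.Units_closed)
  then have "card (Units resF) \<le> card {x \<in> carrier resF. x [^]\<^bsub>resF\<^esub> (N * k) = \<one>\<^bsub>resF\<^esub>}" using fin_KP by (intro card_mono) auto
  also have "\<dots> \<le> N * k" by (rule resF.num_roots_le_deg[OF fin_KP]) (use k N_props in auto)
  finally have "q - 1 \<le> N * k" using q_card fin_KP by (simp add: resF.field_Units)
  moreover have "N * k < N * n" using k(2) N_props(3) by simp
  ultimately show False using N_props by simp
qed

lemma gauss_sum_refl:
  assumes "\<not> int n dvd j"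
  shows "gauss_sum n S \<psi> \<epsilon> p j * gauss_sum n S \<psi> \<epsilon> p (- j) = of_nat q"
proof -
  let ?m = "\<ominus>\<^bsub>resF\<^esub> \<one>\<^bsub>resF\<^esub>"
  have m: "?m \<in> Units resF" by (simp add: resF.Units_minus_one_closed)
  have "residue_symbol ?m = 1"
  proof (rule residue_symbol_eqI[OF m])
    show "1 \<in> \<mu>n" by (simp add: \<mu>n_def)
    obtain t where t: "N = 2 * t" using N_props by auto
    have "?m [^]\<^bsub>resF\<^esub> (2::nat) = \<one>\<^bsub>resF\<^esub>"
      by (simp add: numeral_2_eq_2 resF.l_minus resF.r_minus)
    then have "?m [^]\<^bsub>resF\<^esub> N = \<one>\<^bsub>resF\<^esub>" unfolding t by (simp add: resF.nat_pow_pow[symmetric])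
    then show "\<pi> 1 = ?m [^]\<^bsub>resF\<^esub> N" using pi.hom_one by simp
  qed
  then have minus: "\<epsilon> (residue_symbol ?m) powi j = 1" by (simp add: eps_one)
  have "(\<Sum>B\<in>Units resF. \<epsilon> (residue_symbol B) powi j * add_char B) * (\<Sum>B\<in>Units resF. inverse (\<epsilon> (residue_symbol B) powi j) * add_char B) = of_nat (card (carrier resF))"
  proof (rule resF.gauss_sum_product[OF fin_KP _ _ char_nontrivial[OF assms] minus add_char_add add_char_zero add_char_nontrivial])
    fix B C assume B: "B \<in> Units resF" and C: "C \<in> Units resF"
    show "\<epsilon> (residue_symbol (B \<otimes>\<^bsub>resF\<^esub> C)) powi j = \<epsilon> (residue_symbol B) powi j * \<epsilon> (residue_symbol C) powi j"
      using residue_symbol_mult[OF B C] eps_mult[of "residue_symbol B" "residue_symbol C"] residue_symbol(1)[OF B] residue_symbol(1)[OF C] by (simp add: \<mu>n_def power_int_mult_distrib)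
  next
    fix B assume B: "B \<in> Units resF"
    show "\<epsilon> (residue_symbol B) powi j \<noteq> 0" using eps_nz[OF residue_symbol(1)[OF B]] by simp
  qed
  then show ?thesis unfolding gauss_sum_eq q_card by (simp add: power_int_minus)
qed

end

theorem theorem2p2:
  fixes r n :: nat
    and lam :: "nat \<Rightarrow> int"
    and S :: "'f::field_char_0 set set"
    and \<psi> \<epsilon> :: "'f \<Rightarrow> complex"
    and p :: 'f
    and v :: complex
    and g :: "int \<Rightarrow> complex"
  assumes "r \<ge> 1" and "n \<ge> 1"
    and "metaplectic_data n S \<psi> \<epsilon> p"
    and "v = 1 / of_nat (residue_card S p)"
    and "g = gauss_sum n S \<psi> \<epsilon> p"
    and "\<forall>i \<in> {1..r}. lam i \<ge> lam (i + 1)" and "lam (r + 1) \<ge> 0"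
  shows "(\<Sum>u \<in> {u. u permutes {1..r+1}}.
            demazure_lusztig_perm n r v g u (rmonom r (w0_act r lam))) =
         rmonom r (\<lambda>i. - w0_act r (rho r) i) *
         (\<Sum>a \<in> gt_patterns r (\<lambda>i. lam i + rho r i).
            rconst (gt_coeff n v g r a) * rmonom r (gt_weight r a))"
proof -
  interpret data: metaplectic_data n S \<psi> \<epsilon> p by (rule assms(3))
  have v: "v = 1 / of_nat data.q" using assms(4) by (simp add: data.q_def)
  interpret metaplectic_parameters n v g
  proof
    show "g a = g b" if "[a = b] (mod int n)" for a b
      unfolding assms(5) by (rule data.gauss_sum_cong[OF that])
    show "g 0 = -1" unfolding assms(5) by (rule data.gauss_sum_0)
    show "v * (g a * g (- a)) = 1" if "\<not> int n dvd a" for a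
      unfolding assms(5) data.gauss_sum_refl[OF that] v using data.q_pos by simp
  qed (rule assms(2))
  show ?thesis by (rule sum_demazure_lusztig[OF assms(6)])
qed

end
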